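(* Let $q\ge 2$ be any integer and let $R$ be the reals or any totally ordered semi-ring. Over $R$, neither the family $\mathsf{Sat^q}=(\mathsf{Sat^q}_n)$ nor the family $\mathsf{Clow^q}=(\mathsf{Clow^q}_n)$ is a monotone affine $p$-projection of the permanent family $(\mathsf{Perm}_n)$. More precisely, any monotone affine projection from the permanent family to $\mathsf{Sat^q}$ must have blow-up at least $2^{\Omega(\sqrt n)}$, and any monotone affine projection from the permanent family to $\mathsf{Clow^q}$ must have blow-up at least $2^{\Omega(n)}$. Here: $\mathsf{Sat^q}_n=\sum_{a\in\{0,1\}^n}\big(\prod_{i:a_i=1}X_i^{q-1}\big)\big(\prod_{c\in\mathsf{Cl}_n:\ a\text{ satisfies }c}Y_c^{q-1}\big)$, where $\mathsf{Cl}_n$ is the set of all 3-literal clauses over the literals $x_1,\dots,x_n,\bar x_1,\dots,\bar x_n$, with variables $X_1,\dots,X_n$ and $Y_c$ ($c\in\mathsf{Cl}_n$). With $K_n$ the complete graph on $\{1,\dots,n\}$, variables $X_e$ (edges) and $Y_v$ (vertices), $\mathsf{Clow^q}_n=\sum_{w}\big(\prod_{i\in[n]}X_{\{v_{i-1},v_{i\bmod n}\}}^{q-1}\big)\big(\prod_{v\in\{v_0,\dots,v_{n-1}\}}Y_v^{q-1}\big)$, the sum over all closed walks $w=\langle v_0,\dots,v_{n-1}\rangle$ of length $n$ in $K_n$ with $v_0<v_j$ for all $j>0$ (edges repeated in $w$ contribute with multiplicity, each visited vertex contributes $Y_v^{q-1}$ once). $\mathsf{Perm}_n=\sum_{\sigma\in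 S_n}\prod_{i=1}^n y_{i,\sigma(i)}$.
   Context: A polynomial $f(x_1,\dots,x_n)$ is an affine projection of $g(y_1,\dots,y_m)$ if $f$ is obtained from $g$ by replacing each $y_i$ by an affine linear function $\ell_i(x_1,\dots,x_n)$. Over a totally ordered semi-ring, a monotone (affine) projection is one in which all constants appearing in the substitution are non-negative. The family $(f_n)$ is a monotone affine projection of $(g_n)$ with blow-up $t(n)$ if for all sufficiently large $n$, $f_n$ is a monotone affine projection of $g_{t(n)}$; it is a monotone affine $p$-projection if this holds with $t$ polynomially bounded. *)

theory Defs
  imports Complex_Main "HOL-Library.Poly_Mapping" "HOL-Combinatorics.Permutations"
begin

type_synonym ('v, 'a) fpoly = "('v \<Rightarrow>\<^sub>0 nat) \<Rightarrow>\<^sub>0 'a"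

definition pvar :: "'v \<Rightarrow> ('v, 'a::comm_semiring_1) fpoly" where
  "pvar v = Poly_Mapping.single (Poly_Mapping.single v 1) 1"

definition pconst :: "'a::comm_semiring_1 \<Rightarrow> ('v, 'a) fpoly" where
  "pconst c = Poly_Mapping.single 0 c"

definition psubst :: "('w \<Rightarrow> ('v, 'a::comm_semiring_1) fpoly) \<Rightarrow> ('w, 'a) fpoly \<Rightarrow> ('v, 'a) fpoly" where
  "psubst l g = sum (\<lambda>mon. pconst (Poly_Mapping.lookup g mon) * prod (\<lambda>y. (l y) ^ (Poly_Mapping.lookup mon y)) (Poly_Mapping.keys mon)) (Poly_Mapping.keys g)"

definition mono_affine :: "'v set \<Rightarrow> ('v, 'a::{comm_semiring_1, ordered_comm_semiring, linorder}) fpoly \<Rightarrow> bool" where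
  "mono_affine V l \<longleftrightarrow>
     Poly_Mapping.keys l \<subseteq> insert 0 ((\<lambda>v. Poly_Mapping.single v 1) ` V) \<and> (\<forall>m. 0 \<le> Poly_Mapping.lookup l m)"

definition mono_proj :: "'v set \<Rightarrow> ('v, 'a::{comm_semiring_1, ordered_comm_semiring, linorder}) fpoly
    \<Rightarrow> ('w, 'a) fpoly \<Rightarrow> bool" where
  "mono_proj V f g \<longleftrightarrow> (\<exists>l. (\<forall>y. mono_affine V (l y)) \<and> f = psubst l g)"

definition Perm :: "nat \<Rightarrow> (nat \<times> nat, 'a::comm_semiring_1) fpoly" where
  "Perm n = (\<Sum>\<sigma>\<in>{\<sigma>. \<sigma> permutes {1..n}}. \<Prod>i\<in>{1..n}. pvar (i, \<sigma> i))"

text \<open>Literals: (i, True) is x_i, (i, False) is the negated x_i. A 3-literal clause is a set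
  of three distinct literals over x_1..x_n. Sat variables: Inl i = X_i, Inr c = Y_c.\<close>
definition clauses :: "nat \<Rightarrow> (nat \<times> bool) set set" where
  "clauses n = {c. c \<subseteq> {1..n} \<times> UNIV \<and> card c = 3}"

text \<open>An assignment a in {0,1}^n is represented by the set S of indices with a_i = 1.\<close>
definition satisfies :: "nat set \<Rightarrow> (nat \<times> bool) set \<Rightarrow> bool" where
  "satisfies S c \<longleftrightarrow> (\<exists>(i, b)\<in>c. (i \<in> S) = b)"

definition Sat :: "nat \<Rightarrow> nat \<Rightarrow> (nat + (nat \<times> bool) set, 'a::comm_semiring_1) fpoly" where
  "Sat q n = (\<Sum>S\<in>Pow {1..n}.
      (\<Prod>i\<in>S. pvar (Inl i) ^ (q - 1)) *
      (\<Prod>c\<in>{c\<in>clauses n. satisfies S c}. pvar (Inr c) ^ (q - 1)))"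

definition Sat_vars :: "nat \<Rightarrow> (nat + (nat \<times> bool) set) set" where
  "Sat_vars n = Inl ` {1..n} \<union> Inr ` clauses n"

text \<open>Closed walks of length n in K_n on vertices 1..n, as maps w: {0..<n} \<rightarrow> {1..n}
  (w i = v_i), consecutive vertices distinct (edges of K_n), with v_0 < v_j for all 0<j<n.
  Clow variables: Inl e = X_e for edges e, Inr v = Y_v.\<close>
definition clow_walks :: "nat \<Rightarrow> (nat \<Rightarrow> nat) set" where
  "clow_walks n = {w \<in> {0..<n} \<rightarrow>\<^sub>E {1..n}.
      (\<forall>i\<in>{1..n}. w (i - 1) \<noteq> w (i mod n)) \<and> (\<forall>j\<in>{1..<n}. w 0 < w j)}"

definition Clow :: "nat \<Rightarrow> nat \<Rightarrow> (nat set + nat, 'a::comm_semiring_1) fpoly" where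
  "Clow q n = (\<Sum>w\<in>clow_walks n.
      (\<Prod>i\<in>{1..n}. pvar (Inl {w (i - 1), w (i mod n)}) ^ (q - 1)) *
      (\<Prod>v\<in>w ` {0..<n}. pvar (Inr v) ^ (q - 1)))"

definition Clow_vars :: "nat \<Rightarrow> (nat set + nat) set" where
  "Clow_vars n = Inl ` {e. \<exists>u v. e = {u, v} \<and> u \<noteq> v \<and> u \<in> {1..n} \<and> v \<in> {1..n}} \<union> Inr ` {1..n}"

definition mono_proj_blowup ::
  "(nat \<Rightarrow> 'v set) \<Rightarrow> (nat \<Rightarrow> ('v, 'a::{comm_semiring_1, ordered_comm_semiring, linorder}) fpoly)
    \<Rightarrow> (nat \<Rightarrow> ('w, 'a) fpoly) \<Rightarrow> (nat \<Rightarrow> nat) \<Rightarrow> bool" where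
  "mono_proj_blowup V f g t \<longleftrightarrow> (\<forall>\<^sub>F n in sequentially. mono_proj (V n) (f n) (g (t n)))"

definition poly_bounded :: "(nat \<Rightarrow> nat) \<Rightarrow> bool" where
  "poly_bounded t \<longleftrightarrow> (\<exists>C k. \<forall>n. t n \<le> C * (n + 1) ^ k)"

definition mono_p_proj ::
  "(nat \<Rightarrow> 'v set) \<Rightarrow> (nat \<Rightarrow> ('v, 'a::{comm_semiring_1, ordered_comm_semiring, linorder}) fpoly)
    \<Rightarrow> (nat \<Rightarrow> ('w, 'a) fpoly) \<Rightarrow> bool" where
  "mono_p_proj V f g \<longleftrightarrow> (\<exists>t. poly_bounded t \<and> mono_proj_blowup V f g t)"

end

theory Submission
  imports Defs "HOL-Combinatorics.Cycles" "HOL-Combinatorics.Multiset_Permutations"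
    "HOL-Real_Asymp.Real_Asymp"
begin

text \<open>
  Over a totally ordered semiring, call \<open>a \<ge> 0\<close> unital if \<open>1 \<le> r * a\<close> for some \<open>r \<ge> 0\<close>. This is a
  homomorphism from the non-negative elements to the Boolean semiring, so a monotone projection
  of the permanent describes the support of the projected polynomial exactly: it consists of all
  sums of labels along permutations of a \<open>t \<times> t\<close> array.

  Both families have a face whose exponent vectors restrict to \<open>q - 1\<close> times the perfect matchings
  of a complete graph, with \<open>\<Omega>(\<surd>n)\<close> vertices for Sat and \<open>\<Omega>(n)\<close> vertices for Clow. Fix a base matching
  and a permutation representing it. Every matching whose union with the base matching is a
  Hamiltonian cycle (a tour) arises from this permutation by a single cycle of row changes; cut it
  at a row \<open>y\<close> where half of the edges of the tour have been touched. Two tours with the same \<open>y\<close> can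
  be spliced, and the spliced closed walk decomposes into cycles, that is, into perfect matchings.
  Since a perfect matching crosses every odd cut, this restricts the tours sharing \<open>y\<close>: while an
  interval of the tour is extended, whenever the edge on its left is touched before \<open>y\<close> and the edge
  on its right is not, no vertex can be attached both on the left and on the right, so that one side
  has at most half of the possible extensions. A cycle lemma provides a starting point for which this
  happens \<open>m / 2\<close> times. Hence a fixed \<open>y\<close> accounts for an exponentially small fraction of all tours,
  and \<open>t\<close> must be exponentially large in the number of vertices.
\<close>

section \<open>Supports of polynomials over ordered semirings\<close>

text \<open>"Nonzero" could not replace \<open>unital\<close>: the order axioms admit positive
  elements whose product is 0, and then the support of a product is not the sum of the supports.

  A spliced walk may repeat rows, so it describes no permutation; only the cycles of its
  decomposition do. What survives is a lower bound: if every perfect matching meets a set of edges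
  at least as often as the base matching does, the total change on this set is non-negative. All
  restrictions on tours sharing a row are instances of this, for the star of a vertex or for an odd
  cut. Stars meet each perfect matching exactly once and yield equalities. These show that the
  colours at the two ends of an interval depend on the interval alone, once the value on the base
  edge at its start is fixed. That value lies between -d and 0, whence the factor
  \<open>d + 1\<close> beside the \<open>t\<close> rows and the \<open>2 * m\<close> start vertices.
  Cutting where half of the edges are touched balances the two colours, as the cycle lemma
  requires.\<close>

definition unital :: "'a::{comm_semiring_1, ordered_comm_semiring, linorder} \<Rightarrow> bool" where
  "unital a \<longleftrightarrow> (\<exists>r\<ge>0. 1 \<le> r * a)"

definition psupp :: "('v, 'a::{comm_semiring_1, ordered_comm_semiring, linorder}) fpoly \<Rightarrow> ('v \<Rightarrow>\<^sub>0 nat) set" where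
  "psupp f = {m. unital (Poly_Mapping.lookup f m)}"

definition nonneg_poly :: "('v, 'a::{comm_semiring_1, ordered_comm_semiring, linorder}) fpoly \<Rightarrow> bool" where
  "nonneg_poly f \<longleftrightarrow> (\<forall>m. 0 \<le> Poly_Mapping.lookup f m)"

section \<open>Unital elements under sums and products\<close>

lemma osr_mult_nonneg:
  fixes a b :: "'a::{comm_semiring_1, ordered_comm_semiring, linorder}"
  shows "0 \<le> a \<Longrightarrow> 0 \<le> b \<Longrightarrow> 0 \<le> a * b"
  using mult_left_mono[of 0 b a] by simp

lemma osr_add_nonneg:
  fixes a b :: "'a::{comm_semiring_1, ordered_comm_semiring, linorder}"
  shows "0 \<le> a \<Longrightarrow> 0 \<le> b \<Longrightarrow> 0 \<le> a + b"
  using add_mono[of 0 a 0 b] by simp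

lemma osr_sum_nonneg:
  fixes f :: "'b \<Rightarrow> 'a::{comm_semiring_1, ordered_comm_semiring, linorder}"
  shows "(\<And>x. x \<in> A \<Longrightarrow> 0 \<le> f x) \<Longrightarrow> 0 \<le> sum f A"
  by (induction A rule: infinite_finite_induct) (auto intro: osr_add_nonneg)

lemma unital_one: "unital (1::'a::{comm_semiring_1, ordered_comm_semiring, linorder})" if "(0::'a) \<le> 1"
  unfolding unital_def using that by (intro exI[of _ 1]) auto

lemma not_unital_zero: "\<not> unital (0::'a::{comm_semiring_1, ordered_comm_semiring, linorder})" if "(0::'a) \<le> 1"
  unfolding unital_def using that by auto

lemma unital_mono:
  fixes a b :: "'a::{comm_semiring_1, ordered_comm_semiring, linorder}"
  shows "unital a \<Longrightarrow> a \<le> b \<Longrightarrow> unital b"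
  unfolding unital_def by (meson mult_left_mono order_trans)

text \<open>Totality of the order is what counts: one summand is the smaller, say x \<le> y, and
  then r * (x + y) \<le> (r + r) * y.\<close>

lemma unital_add:
  fixes a b :: "'a::{comm_semiring_1, ordered_comm_semiring, linorder}"
  assumes "0 \<le> a" "0 \<le> b"
  shows "unital (a + b) \<longleftrightarrow> unital a \<or> unital b"
proof
  assume "unital a \<or> unital b"
  moreover have "a \<le> a + b" "b \<le> a + b"
    using add_mono[of a a 0 b] add_mono[of 0 a b b] assms by auto
  ultimately show "unital (a + b)" using unital_mono by blast
next
  have *: "unital y" if "unital (x + y)" "x \<le> y" for x y :: 'a
  proof -
    from that(1) obtain r where r: "0 \<le> r" "1 \<le> r * (x + y)" unfolding unital_def by auto
    have "r * (x + y) \<le> r * (y + y)"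
      using r(1) that(2) by (intro mult_left_mono add_mono) auto
    also have "\<dots> = (r + r) * y" by (simp add: algebra_simps)
    finally show ?thesis unfolding unital_def using r osr_add_nonneg by (meson order_trans)
  qed
  assume "unital (a + b)"
  thus "unital a \<or> unital b"
    using *[of a b] *[of b a] by (cases "a \<le> b") (auto simp: add.commute)
qed

lemma unital_mult:
  fixes a b :: "'a::{comm_semiring_1, ordered_comm_semiring, linorder}"
  assumes "0 \<le> a" "0 \<le> b"
  shows "unital (a * b) \<longleftrightarrow> unital a \<and> unital b"
proof
  assume "unital (a * b)"
  then obtain r where r: "0 \<le> r" "1 \<le> r * (a * b)" unfolding unital_def by auto
  have "1 \<le> (r * b) * a" "1 \<le> (r * a) * b" using r by (auto simp: ac_simps)
  thus "unital a \<and> unital b" unfolding unital_def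
    using osr_mult_nonneg r assms by blast
next
  assume "unital a \<and> unital b"
  then obtain r s where rs: "0 \<le> r" "1 \<le> r * a" "0 \<le> s" "1 \<le> s * b" unfolding unital_def by auto
  have "s * b \<le> (s * b) * (r * a)"
    using mult_left_mono[of 1 "r * a" "s * b"] rs osr_mult_nonneg assms by auto
  with rs have "1 \<le> (r * s) * (a * b)" by (auto simp: ac_simps)
  thus "unital (a * b)" unfolding unital_def using osr_mult_nonneg rs by blast
qed

lemma unital_sum:
  fixes f :: "'b \<Rightarrow> 'a::{comm_semiring_1, ordered_comm_semiring, linorder}"
  assumes "(0::'a) \<le> 1" "finite A" "\<And>x. x \<in> A \<Longrightarrow> 0 \<le> f x"
  shows "unital (sum f A) \<longleftrightarrow> (\<exists>x\<in>A. unital (f x))"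
  using assms(2,3)
  by (induction A rule: finite_induct) (auto simp: not_unital_zero assms(1) unital_add osr_sum_nonneg)

section \<open>Supports of sums and products of polynomials\<close>

lemma nonneg_poly_add: "nonneg_poly f \<Longrightarrow> nonneg_poly g \<Longrightarrow> nonneg_poly (f + g)"
  by (auto simp: nonneg_poly_def lookup_add intro: osr_add_nonneg)

lemma nonneg_poly_zero: "nonneg_poly 0"
  by (auto simp: nonneg_poly_def)

lemma nonneg_poly_single: "0 \<le> c \<Longrightarrow> nonneg_poly (Poly_Mapping.single m c)"
  by (auto simp: nonneg_poly_def lookup_single when_def)

lemma sum_single_lookup:
  "(\<Sum>a\<in>Poly_Mapping.keys f. Poly_Mapping.single a (Poly_Mapping.lookup f a)) = f"
proof (rule poly_mapping_eqI)
  fix k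
  have "Poly_Mapping.lookup (\<Sum>a\<in>Poly_Mapping.keys f. Poly_Mapping.single a (Poly_Mapping.lookup f a)) k
      = (\<Sum>a\<in>Poly_Mapping.keys f. if a = k then Poly_Mapping.lookup f a else 0)"
    unfolding lookup_sum by (intro sum.cong) (auto simp: lookup_single when_def)
  also have "\<dots> = Poly_Mapping.lookup f k" by (simp add: in_keys_iff)
  finally show "Poly_Mapping.lookup (\<Sum>a\<in>Poly_Mapping.keys f. Poly_Mapping.single a (Poly_Mapping.lookup f a)) k
      = Poly_Mapping.lookup f k" .
qed

lemma lookup_mult_finite:
  fixes f g :: "('v, 'a::comm_semiring_1) fpoly"
  shows "Poly_Mapping.lookup (f * g) m =
    (\<Sum>(a, b)\<in>Poly_Mapping.keys f \<times> Poly_Mapping.keys g.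
       (Poly_Mapping.lookup f a * Poly_Mapping.lookup g b when m = a + b))"
proof -
  have "f * g = (\<Sum>a\<in>Poly_Mapping.keys f. Poly_Mapping.single a (Poly_Mapping.lookup f a)) *
      (\<Sum>b\<in>Poly_Mapping.keys g. Poly_Mapping.single b (Poly_Mapping.lookup g b))"
    by (simp add: sum_single_lookup)
  also have "\<dots> = (\<Sum>(a, b)\<in>Poly_Mapping.keys f \<times> Poly_Mapping.keys g.
      Poly_Mapping.single (a + b) (Poly_Mapping.lookup f a * Poly_Mapping.lookup g b))"
    by (simp add: sum_product mult_single sum.cartesian_product)
  finally show ?thesis
    by (auto simp: lookup_sum lookup_single when_def intro!: sum.cong)
qed

lemma nonneg_poly_mult: "nonneg_poly f \<Longrightarrow> nonneg_poly g \<Longrightarrow> nonneg_poly (f * g)"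
  unfolding nonneg_poly_def lookup_mult_finite
  by (intro allI osr_sum_nonneg) (simp add: when_def osr_mult_nonneg split: prod.split)

lemma nonneg_poly_prod:
  fixes f :: "'i \<Rightarrow> ('v, 'a::{comm_semiring_1, ordered_comm_semiring, linorder}) fpoly"
  assumes "(0::'a) \<le> 1" "\<And>x. x \<in> A \<Longrightarrow> nonneg_poly (f x)"
  shows "nonneg_poly (prod f A)"
  using assms(2)
  by (induction A rule: infinite_finite_induct)
     (auto intro: nonneg_poly_mult nonneg_poly_single assms(1) simp flip: single_one)

lemma psupp_single_one:
  assumes "(0::'a::{comm_semiring_1, ordered_comm_semiring, linorder}) \<le> 1"
  shows "psupp (Poly_Mapping.single m (1::'a)) = {m}"
  by (auto simp: psupp_def lookup_single when_def not_unital_zero[OF assms] unital_one[OF assms] split: if_splits)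

lemma psupp_sum:
  fixes f :: "'i \<Rightarrow> ('v, 'a::{comm_semiring_1, ordered_comm_semiring, linorder}) fpoly"
  assumes "(0::'a) \<le> 1" "finite A" "\<And>x. x \<in> A \<Longrightarrow> nonneg_poly (f x)"
  shows "psupp (sum f A) = (\<Union>x\<in>A. psupp (f x))"
  using unital_sum[OF assms(1,2)] assms(3)
  by (auto simp: psupp_def lookup_sum nonneg_poly_def)

text \<open>Coefficients are non-negative, so nothing cancels: a sum of products is unital exactly
  when one of the products is.\<close>

lemma psupp_mult:
  fixes f g :: "('v, 'a::{comm_semiring_1, ordered_comm_semiring, linorder}) fpoly"
  assumes 0: "(0::'a) \<le> 1" and "nonneg_poly f" "nonneg_poly g"
  shows "psupp (f * g) = {a + b | a b. a \<in> psupp f \<and> b \<in> psupp g}"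
proof -
  have k: "unital (Poly_Mapping.lookup h a) \<Longrightarrow> a \<in> Poly_Mapping.keys h" for a and h :: "('v, 'a) fpoly"
    using not_unital_zero[OF 0] by (metis in_keys_iff)
  have nn: "0 \<le> Poly_Mapping.lookup f a" "0 \<le> Poly_Mapping.lookup g a" for a
    using assms by (auto simp: nonneg_poly_def)
  have "unital (Poly_Mapping.lookup (f * g) m) \<longleftrightarrow>
      (\<exists>x\<in>Poly_Mapping.keys f \<times> Poly_Mapping.keys g. unital (case x of (a, b) \<Rightarrow>
       (Poly_Mapping.lookup f a * Poly_Mapping.lookup g b when m = a + b)))" for m
    unfolding lookup_mult_finite
    by (rule unital_sum[OF 0]) (simp_all add: when_def nn osr_mult_nonneg split: prod.split)
  also have "\<dots> m \<longleftrightarrow> (\<exists>a b. m = a + b \<and> unital (Poly_Mapping.lookup f a) \<and> unital (Poly_Mapping.lookup g b))"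
    (is "?l m \<longleftrightarrow> ?r m") for m
  proof
    assume "?l m"
    then obtain a b where "unital (Poly_Mapping.lookup f a * Poly_Mapping.lookup g b when m = a + b)" by auto
    hence "m = a + b" "unital (Poly_Mapping.lookup f a)" "unital (Poly_Mapping.lookup g b)"
      by (auto simp: when_def unital_mult[OF nn(1) nn(2)] not_unital_zero[OF 0] split: if_splits)
    thus "?r m" by blast
  next
    assume "?r m"
    then obtain a b where *: "m = a + b" "unital (Poly_Mapping.lookup f a)" "unital (Poly_Mapping.lookup g b)"
      by blast
    show "?l m"
      by (rule bexI[of _ "(a, b)"]) (use * k in \<open>auto simp: unital_mult[OF nn(1) nn(2)]\<close>)
  qed
  finally show ?thesis by (auto simp: psupp_def)
qed

lemma psupp_prod:
  fixes f :: "'i \<Rightarrow> ('v, 'a::{comm_semiring_1, ordered_comm_semiring, linorder}) fpoly"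
  assumes 0: "(0::'a) \<le> 1" and "finite A" and "\<And>x. x \<in> A \<Longrightarrow> nonneg_poly (f x)"
  shows "psupp (prod f A) = {sum \<mu> A | \<mu>. \<forall>x\<in>A. \<mu> x \<in> psupp (f x)}"
  using assms(2,3)
proof (induction A rule: finite_induct)
  case empty
  show ?case using psupp_single_one[OF 0, of 0] by simp
next
  case (insert x A)
  have "psupp (prod f (insert x A)) = {a + b | a b. a \<in> psupp (f x) \<and> b \<in> {sum \<mu> A | \<mu>. \<forall>x\<in>A. \<mu> x \<in> psupp (f x)}}"
    using insert by (simp add: psupp_mult[OF 0] nonneg_poly_prod[OF 0])
  also have "\<dots> = {sum \<mu> (insert x A) | \<mu>. \<forall>y\<in>insert x A. \<mu> y \<in> psupp (f y)}" (is "?l = ?r")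
  proof
    show "?l \<subseteq> ?r"
    proof clarify
      fix a \<mu> assume a: "a \<in> psupp (f x)" and m: "\<forall>x\<in>A. \<mu> x \<in> psupp (f x)"
      have "sum (\<mu>(x := a)) A = sum \<mu> A" using insert by (intro sum.cong) auto
      hence "a + sum \<mu> A = sum (\<mu>(x := a)) (insert x A)" using insert by simp
      moreover have "\<forall>y\<in>insert x A. (\<mu>(x := a)) y \<in> psupp (f y)" using a m by auto
      ultimately show "\<exists>\<mu>'. a + sum \<mu> A = sum \<mu>' (insert x A) \<and> (\<forall>y\<in>insert x A. \<mu>' y \<in> psupp (f y))"
        by blast
    qed
    show "?r \<subseteq> ?l" using insert by auto
  qed
  finally show ?case .
qed

section \<open>The permanent under monotone substitution\<close>

definition perm_mon :: "nat \<Rightarrow> (nat \<Rightarrow> nat) \<Rightarrow> (nat \<times> nat) \<Rightarrow>\<^sub>0 nat" where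
  "perm_mon t \<sigma> = (\<Sum>i\<in>{1..t}. Poly_Mapping.single (i, \<sigma> i) 1)"

lemma prod_single_one:
  "(\<Prod>i\<in>A. Poly_Mapping.single (m i) (1::'a::comm_semiring_1)) = Poly_Mapping.single (\<Sum>i\<in>A. m i) 1"
  by (induction A rule: infinite_finite_induct) (auto simp: mult_single)

lemma power_single_one:
  "Poly_Mapping.single m (1::'a::comm_semiring_1) ^ k = Poly_Mapping.single (\<Sum>i<k. m) 1"
  by (induction k) (auto simp: mult_single add.commute)

lemma lookup_perm_mon:
  "Poly_Mapping.lookup (perm_mon t \<sigma>) (i, j) = (if i \<in> {1..t} \<and> \<sigma> i = j then 1 else 0)"
proof -
  have "Poly_Mapping.lookup (perm_mon t \<sigma>) (i, j) = (\<Sum>k\<in>{1..t}. if k = i then (if \<sigma> i = j then 1 else 0) else 0)"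
    unfolding perm_mon_def lookup_sum by (intro sum.cong) (auto simp: lookup_single when_def)
  also have "\<dots> = (if i \<in> {1..t} \<and> \<sigma> i = j then 1 else 0)"
    by (subst sum.delta) auto
  finally show ?thesis .
qed

text \<open>No two terms of \<open>Perm t\<close> merge, so every coefficient is 1. This matters
  because \<open>psubst\<close> runs over the keys of a polynomial and not over
  permutations.\<close>

lemma inj_on_perm_mon: "inj_on (perm_mon t) {\<sigma>. \<sigma> permutes {1..t}}"
proof (rule inj_onI, clarify)
  fix \<sigma> \<tau> assume p: "\<sigma> permutes {1..t}" "\<tau> permutes {1..t}" and e: "perm_mon t \<sigma> = perm_mon t \<tau>"
  show "\<sigma> = \<tau>"
  proof
    fix i show "\<sigma> i = \<tau> i"
    proof (cases "i \<in> {1..t}")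
      case True
      have "Poly_Mapping.lookup (perm_mon t \<tau>) (i, \<sigma> i) = 1"
        unfolding e[symmetric] lookup_perm_mon using True by simp
      hence "\<tau> i = \<sigma> i" unfolding lookup_perm_mon by (metis zero_neq_one)
      thus ?thesis ..
    next
      case False
      thus ?thesis using p permutes_not_in by metis
    qed
  qed
qed

lemma psubst_Perm:
  fixes l :: "nat \<times> nat \<Rightarrow> ('v, 'a::comm_semiring_1) fpoly"
  shows "psubst l (Perm t) = (\<Sum>\<sigma>\<in>{\<sigma>. \<sigma> permutes {1..t}}. \<Prod>i\<in>{1..t}. l (i, \<sigma> i))"
proof -
  let ?S = "{\<sigma>. \<sigma> permutes {1..t}}"
  have fin: "finite ?S" by (simp add: finite_permutations)
  have P: "(Perm t :: (_, 'a) fpoly) = (\<Sum>\<sigma>\<in>?S. Poly_Mapping.single (perm_mon t \<sigma>) 1)"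
    unfolding Perm_def pvar_def perm_mon_def by (simp add: prod_single_one)
  have lk: "Poly_Mapping.lookup (Perm t :: (_, 'a) fpoly) (perm_mon t \<sigma>) = 1" if "\<sigma> \<in> ?S" for \<sigma>
  proof -
    have "Poly_Mapping.lookup (Perm t :: (_, 'a) fpoly) (perm_mon t \<sigma>) = (\<Sum>\<tau>\<in>?S. if \<tau> = \<sigma> then 1 else 0)"
      unfolding P lookup_sum using that inj_on_perm_mon[of t]
      by (intro sum.cong) (auto simp: lookup_single when_def inj_on_def)
    also have "\<dots> = 1" using that fin by simp
    finally show ?thesis .
  qed
  have keys: "Poly_Mapping.keys (Perm t :: (_, 'a) fpoly) = perm_mon t ` ?S"
  proof
    show "Poly_Mapping.keys (Perm t :: (_, 'a) fpoly) \<subseteq> perm_mon t ` ?S"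
      unfolding P using keys_sum[of "\<lambda>\<sigma>. Poly_Mapping.single (perm_mon t \<sigma>) (1::'a)" ?S] by fastforce
    show "perm_mon t ` ?S \<subseteq> Poly_Mapping.keys (Perm t :: (_, 'a) fpoly)"
      using lk by (auto simp: in_keys_iff)
  qed
  have "psubst l (Perm t) = (\<Sum>\<sigma>\<in>?S. \<Prod>y\<in>Poly_Mapping.keys (perm_mon t \<sigma>). l y ^ Poly_Mapping.lookup (perm_mon t \<sigma>) y)"
    unfolding psubst_def keys sum.reindex[OF inj_on_perm_mon] using lk
    by (intro sum.cong) (auto simp: pconst_def)
  also have "\<dots> = (\<Sum>\<sigma>\<in>?S. \<Prod>i\<in>{1..t}. l (i, \<sigma> i))"
  proof (intro sum.cong refl)
    fix \<sigma> assume "\<sigma> \<in> ?S"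
    have k: "Poly_Mapping.keys (perm_mon t \<sigma>) = (\<lambda>i. (i, \<sigma> i)) ` {1..t}"
      using lookup_perm_mon[of t \<sigma>] by (auto simp: in_keys_iff image_iff split: if_splits)
    show "(\<Prod>y\<in>Poly_Mapping.keys (perm_mon t \<sigma>). l y ^ Poly_Mapping.lookup (perm_mon t \<sigma>) y) = (\<Prod>i\<in>{1..t}. l (i, \<sigma> i))"
      unfolding k by (subst prod.reindex) (auto simp: inj_on_def lookup_perm_mon)
  qed
  finally show ?thesis .
qed

text \<open>The support of a permanent whose entry in row \<open>i\<close> and column
  \<open>j\<close> has support \<open>L i j\<close>.\<close>

definition perm_sums :: "nat \<Rightarrow> (nat \<Rightarrow> nat \<Rightarrow> ('v \<Rightarrow>\<^sub>0 nat) set) \<Rightarrow> ('v \<Rightarrow>\<^sub>0 nat) set" where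
  "perm_sums t L = {\<Sum>i\<in>{1..t}. \<mu> i | \<sigma> \<mu>. \<sigma> permutes {1..t} \<and> (\<forall>i\<in>{1..t}. \<mu> i \<in> L i (\<sigma> i))}"

lemma mono_proj_perm_sums:
  fixes f :: "('v, 'a::{comm_semiring_1, ordered_comm_semiring, linorder}) fpoly"
  assumes 0: "(0::'a) \<le> 1" and "mono_proj V f (Perm t :: (_, 'a) fpoly)"
  obtains L where "psupp f = perm_sums t L"
    "\<And>i j \<mu>. \<mu> \<in> L i j \<Longrightarrow> \<mu> = 0 \<or> (\<exists>v. \<mu> = Poly_Mapping.single v 1)"
proof -
  obtain l where l: "\<And>y. mono_affine V (l y)" and f: "f = psubst l (Perm t :: (_, 'a) fpoly)"
    using assms(2) by (auto simp: mono_proj_def)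
  have nn: "nonneg_poly (l y)" for y using l[of y] by (auto simp: mono_affine_def nonneg_poly_def)
  show ?thesis
  proof (rule that[of "\<lambda>i j. psupp (l (i, j))"])
    show "psupp f = perm_sums t (\<lambda>i j. psupp (l (i, j)))"
      unfolding f psubst_Perm perm_sums_def
      by (subst psupp_sum[OF 0]) (auto simp: finite_permutations nn psupp_prod[OF 0] intro!: nonneg_poly_prod[OF 0])
    fix i j \<mu> assume "\<mu> \<in> psupp (l (i, j))"
    hence "\<mu> \<in> Poly_Mapping.keys (l (i, j))"
      unfolding psupp_def using not_unital_zero[OF 0] by (metis in_keys_iff mem_Collect_eq)
    thus "\<mu> = 0 \<or> (\<exists>v. \<mu> = Poly_Mapping.single v 1)" using l[of "(i, j)"] by (auto simp: mono_affine_def)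
  qed
qed

text \<open>If \<open>1 < 0\<close>, then 0 is the only non-negative element, and only constants are monotone projections.\<close>

lemma mono_proj_degenerate:
  fixes f :: "('v, 'a::{comm_semiring_1, ordered_comm_semiring, linorder}) fpoly"
  assumes 0: "\<not> (0::'a) \<le> 1" and "mono_proj V f (Perm t :: (_, 'a) fpoly)" and "m \<noteq> 0"
  shows "Poly_Mapping.lookup f m = 0"
proof -
  obtain l where l: "\<And>y. mono_affine V (l y)" and f: "f = psubst l (Perm t :: (_, 'a) fpoly)"
    using assms(2) by (auto simp: mono_proj_def)
  have z: "c = 0" if "0 \<le> c" for c :: 'a
    using mult_left_mono[of 1 0 c] 0 that by auto
  have "l y = 0" for y
    using l[of y] z by (auto simp: mono_affine_def intro!: poly_mapping_eqI)
  hence "f = (\<Sum>\<sigma>\<in>{\<sigma>. \<sigma> permutes {1..t}}. \<Prod>i\<in>{1..t}. 0)" unfolding f psubst_Perm by simp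
  also have "\<dots> = (if t = 0 then 1 else 0)" by (cases "t = 0") (auto simp: prod_constant power_0_left)
  finally show ?thesis using assms(3) by (auto simp: lookup_one)
qed

section \<open>Perfect matchings and tours\<close>

text \<open>The base matching pairs \<open>(i, True)\<close> with \<open>(i, False)\<close>. A tour lists, for each of the \<open>m\<close> base edges, the vertex
  by which it is entered; it leaves the edge by the flipped vertex.\<close>

definition flip :: "nat \<times> bool \<Rightarrow> nat \<times> bool" where
  "flip v = (fst v, \<not> snd v)"

lemma flip_simps [simp]: "flip (flip v) = v" "fst (flip v) = fst v" "flip v \<noteq> v" "v \<noteq> flip v"
  "flip u = flip v \<longleftrightarrow> u = v"
  by (auto simp: flip_def prod_eq_iff)

lemma fst_eq_flip: "fst u = fst v \<longleftrightarrow> u = v \<or> u = flip v"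
  by (auto simp: flip_def prod_eq_iff)

definition verts :: "nat \<Rightarrow> (nat \<times> bool) set" where
  "verts m = {..<m} \<times> UNIV"

lemma verts_flip [simp]: "flip v \<in> verts m \<longleftrightarrow> v \<in> verts m"
  by (auto simp: verts_def flip_def mem_Times_iff)

lemma finite_verts [simp]: "finite (verts m)"
  by (simp add: verts_def)

lemma card_verts: "card (verts m) = 2 * m"
  by (simp add: verts_def card_cartesian_product)

definition vpairs :: "nat \<Rightarrow> (nat \<times> bool) set set" where
  "vpairs m = {e. e \<subseteq> verts m \<and> card e = 2}"

lemma finite_vpairs [simp]: "finite (vpairs m)"
  by (rule finite_subset[of _ "Pow (verts m)"]) (auto simp: vpairs_def)

lemma vpairs_insert [simp]: "{u, v} \<in> vpairs m \<longleftrightarrow> u \<in> verts m \<and> v \<in> verts m \<and> u \<noteq> v"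
  by (auto simp: vpairs_def card_insert_if)

lemma card_Union_vpairs:
  assumes "N \<subseteq> vpairs m" and "\<And>e f. e \<in> N \<Longrightarrow> f \<in> N \<Longrightarrow> e \<noteq> f \<Longrightarrow> e \<inter> f = {}"
  shows "card (\<Union>N) = 2 * card N"
proof -
  have "card (\<Union>N) = (\<Sum>e\<in>N. card e)"
  proof (rule card_Union_disjoint)
    show "disjoint N" using assms(2) unfolding disjoint_def by blast
    show "finite e" if "e \<in> N" for e
      using that assms(1) finite_subset[OF _ finite_verts[of m]] by (auto simp: vpairs_def)
  qed
  also have "\<dots> = (\<Sum>e\<in>N. 2)" using assms(1) by (intro sum.cong) (auto simp: vpairs_def)
  finally show ?thesis by simp
qed

definition perfect_matching :: "nat \<Rightarrow> (nat \<times> bool) set set \<Rightarrow> bool" where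
  "perfect_matching m N \<longleftrightarrow> N \<subseteq> vpairs m \<and> (\<forall>v\<in>verts m. \<exists>!e. e \<in> N \<and> v \<in> e)"

definition crosses :: "'b set \<Rightarrow> 'b set \<Rightarrow> bool" where
  "crosses U e \<longleftrightarrow> e \<inter> U \<noteq> {} \<and> \<not> e \<subseteq> U"

lemma perfect_matching_unique:
  "perfect_matching m N \<Longrightarrow> e \<in> N \<Longrightarrow> e' \<in> N \<Longrightarrow> v \<in> e \<Longrightarrow> v \<in> e' \<Longrightarrow> e = e'"
  unfolding perfect_matching_def vpairs_def by blast

lemma perfect_matching_cover:
  assumes "perfect_matching m N" "v \<in> verts m" obtains e where "e \<in> N" "v \<in> e"
  using assms unfolding perfect_matching_def by blast

lemma perfect_matching_subset_eq:
  assumes "perfect_matching m N" "perfect_matching m M" "M \<subseteq> N"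
  shows "N = M"
proof
  show "N \<subseteq> M"
  proof
    fix e assume e: "e \<in> N"
    hence "e \<subseteq> verts m" "e \<noteq> {}" using assms(1) by (auto simp: perfect_matching_def vpairs_def)
    then obtain v where v: "v \<in> e" "v \<in> verts m" by blast
    then obtain e' where "e' \<in> M" "v \<in> e'" using perfect_matching_cover[OF assms(2)] by blast
    thus "e \<in> M" using perfect_matching_unique[OF assms(1) e _ v(1)] assms(3) by blast
  qed
qed (rule assms)

text \<open>Without a crossing edge, the edges inside \<open>U\<close> would partition
  \<open>U\<close> into pairs.\<close>

lemma perfect_matching_odd_cut:
  assumes "perfect_matching m N" "U \<subseteq> verts m" "odd (card U)"
  shows "\<exists>e\<in>N. crosses U e"
proof (rule ccontr)
  assume "\<not> ?thesis"
  hence nc: "\<not> crosses U e" if "e \<in> N" for e using that by blast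
  let ?D = "{e \<in> N. e \<subseteq> U}"
  have Nv: "N \<subseteq> vpairs m" using assms(1) by (simp add: perfect_matching_def)
  have U: "U = \<Union>?D"
  proof
    show "U \<subseteq> \<Union>?D"
    proof
      fix v assume v: "v \<in> U"
      then obtain e where "e \<in> N" "v \<in> e" using perfect_matching_cover[OF assms(1)] assms(2) by blast
      thus "v \<in> \<Union>?D" using nc[of e] v by (auto simp: crosses_def)
    qed
  qed auto
  have "card (\<Union>?D) = 2 * card ?D"
    using Nv perfect_matching_unique[OF assms(1)] by (intro card_Union_vpairs) blast+
  hence "even (card U)" using U by simp
  thus False using assms(3) by simp
qed

definition base_matching :: "nat \<Rightarrow> (nat \<times> bool) set set" where
  "base_matching m = (\<lambda>v. {v, flip v}) ` verts m"

lemma base_matching_iff: "e \<in> base_matching m \<and> v \<in> e \<longleftrightarrow> e = {v, flip v} \<and> v \<in> verts m"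
  by (auto simp: base_matching_def)

lemma perfect_matching_base: "perfect_matching m (base_matching m)"
  unfolding perfect_matching_def base_matching_iff by (auto simp: base_matching_def)

section \<open>Paths and tours, and the matchings they carry\<close>

fun path_edges :: "(nat \<times> bool) list \<Rightarrow> (nat \<times> bool) set set" where
  "path_edges (x # y # zs) = insert {flip x, y} (path_edges (y # zs))"
| "path_edges _ = {}"

lemma path_edges_append:
  "path_edges (xs @ y # ys) = path_edges (xs @ [y]) \<union> path_edges (y # ys)"
proof (induction xs)
  case (Cons x xs)
  thus ?case by (cases xs) auto
qed simp

lemma path_edges_snoc2: "path_edges (xs @ [x, y]) = insert {flip x, y} (path_edges (xs @ [x]))"
  using path_edges_append[of xs x "[y]"] by auto

text \<open>Walked backwards, a base edge is entered by the vertex through which it was left, so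
  reversing a path also flips its vertices.\<close>

lemma path_edges_rev: "path_edges (rev (map flip xs)) = path_edges xs"
proof (induction xs rule: path_edges.induct)
  case (1 x y zs)
  have "path_edges (rev (map flip (x # y # zs))) = path_edges (rev (map flip zs) @ [flip y, flip x])" by simp
  also have "\<dots> = insert {y, flip x} (path_edges (rev (map flip (y # zs))))"
    by (subst path_edges_snoc2) simp
  finally show ?case using 1 by (simp add: insert_commute)
qed auto

lemma path_edges_verts:
  "e \<in> path_edges xs \<Longrightarrow> v \<in> e \<Longrightarrow> v \<in> flip ` set (butlast xs) \<union> set (tl xs)"
proof (induction xs rule: path_edges.induct)
  case (1 x y zs)
  have sub: "set (tl (y # zs)) \<subseteq> set (y # zs)" by auto
  from 1(2) consider "e = {flip x, y}" | "e \<in> path_edges (y # zs)" by auto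
  thus ?case
    using 1 sub by cases auto
qed auto

definition tour_edges :: "(nat \<times> bool) list \<Rightarrow> (nat \<times> bool) set set" where
  "tour_edges T = path_edges (T @ [hd T])"

definition tour :: "nat \<Rightarrow> (nat \<times> bool) list \<Rightarrow> bool" where
  "tour m T \<longleftrightarrow> distinct (map fst T) \<and> fst ` set T = {..<m}"

lemma tour_length: "tour m T \<Longrightarrow> length T = m"
  unfolding tour_def by (metis card_lessThan distinct_card length_map list.set_map)

lemma tour_verts: "tour m T \<Longrightarrow> set T \<subseteq> verts m"
  unfolding tour_def verts_def by (metis imageI mem_Times_iff subsetI UNIV_I)

lemma tour_rotate: "tour m (xs @ ys) \<longleftrightarrow> tour m (ys @ xs)"
  unfolding tour_def by auto

lemma tour_edges_rotate: "tour_edges (xs @ ys) = tour_edges (ys @ xs)"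
proof (cases "xs = [] \<or> ys = []")
  case False
  then obtain x xs' y ys' where [simp]: "xs = x # xs'" "ys = y # ys'" by (meson neq_Nil_conv)
  show ?thesis
    unfolding tour_edges_def
    using path_edges_append[of "x # xs'" y "ys' @ [x]"] path_edges_append[of "y # ys'" x "xs' @ [y]"]
    by auto
qed auto

lemma tour_edges_snoc:
  "T \<noteq> [] \<Longrightarrow> tour_edges T = insert {flip (last T), hd T} (path_edges T)"
  unfolding tour_edges_def
  using path_edges_snoc2[of "butlast T" "last T" "hd T"] append_butlast_last_id[of T]
  by (metis append.assoc append_Cons append_Nil)

lemma tour_rotate_to:
  assumes "tour m T" "i < m"
  obtains x S where "fst x = i" "tour m (x # S)" "tour_edges (x # S) = tour_edges T"
proof -
  obtain x where "x \<in> set T" "fst x = i" using assms unfolding tour_def by (metis imageE lessThan_iff)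
  then obtain as bs where T: "T = as @ x # bs" by (meson split_list)
  show ?thesis
    using that[of x "bs @ as"] \<open>fst x = i\<close> assms(1) T tour_rotate[of m as "x # bs"] tour_edges_rotate[of as "x # bs"]
    by simp
qed

text \<open>The cyclic successor of \<open>x\<close> is \<open>hd (bs @ as @ [x])\<close>; in this
  form the closing edge needs no separate case.\<close>

lemma tour_edges_cases:
  assumes "e \<in> tour_edges T" "T \<noteq> []"
  obtains as x bs where "T = as @ x # bs" "e = {flip x, hd (bs @ as @ [x])}"
proof -
  have *: "\<exists>as x bs. xs = as @ x # bs \<and> e = {flip x, hd (bs @ [z])}" if "e \<in> path_edges (xs @ [z])" for xs z
    using that
  proof (induction xs)
    case (Cons x xs)
    show ?case
    proof (cases "e \<in> path_edges (xs @ [z])")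
      case True
      then obtain as y bs where "xs = as @ y # bs" "e = {flip y, hd (bs @ [z])}" using Cons by blast
      thus ?thesis by (intro exI[of _ "x # as"] exI[of _ y] exI[of _ bs]) auto
    next
      case False
      hence "e = {flip x, hd (xs @ [z])}" using Cons.prems by (cases xs) auto
      thus ?thesis by (intro exI[of _ "[]"] exI[of _ x] exI[of _ xs]) auto
    qed
  qed simp
  obtain as x bs where 1: "T = as @ x # bs" "e = {flip x, hd (bs @ [hd T])}"
    using *[of T "hd T"] assms unfolding tour_edges_def by blast
  have "hd (bs @ [hd T]) = hd (bs @ as @ [x])" using 1(1) by (cases bs; cases as) auto
  thus ?thesis using that 1 by metis
qed

lemma perfect_matching_tour:
  assumes "tour m T" "m \<ge> 2"
  shows "perfect_matching m (tour_edges T)"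
  unfolding perfect_matching_def
proof (intro conjI ballI)
  have len: "length T = m" "T \<noteq> []" using tour_length[OF assms(1)] assms(2) by auto
  show "tour_edges T \<subseteq> vpairs m"
  proof
    fix e assume "e \<in> tour_edges T"
    then obtain as x bs where T: "T = as @ x # bs" "e = {flip x, hd (bs @ as @ [x])}"
      using len(2) by (rule tour_edges_cases)
    let ?y = "hd (bs @ as @ [x])"
    have ne: "bs @ as \<noteq> []" using T len assms(2) by auto
    hence y: "?y \<in> set (bs @ as)" by (metis append_assoc hd_append2 hd_in_set)
    hence "fst ?y \<in> fst ` set (bs @ as)" by (rule imageI)
    moreover have "fst x \<notin> fst ` set (bs @ as)" using assms(1) unfolding tour_def T(1) by auto
    ultimately have "fst ?y \<noteq> fst x" by metis
    moreover have "x \<in> verts m" "?y \<in> verts m" using tour_verts[OF assms(1)] T y by auto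
    moreover have "flip x \<noteq> ?y" using calculation(1) by (metis flip_simps(2))
    ultimately show "e \<in> vpairs m" unfolding T(2) by auto
  qed
  fix v assume "v \<in> verts m"
  hence "fst v < m" by (auto simp: verts_def)
  \<comment> \<open>The tour is rotated so that the base edge of \<open>v\<close> comes first. Then
    \<open>v\<close> is the vertex through which this edge is left or the one through which it is
    entered, and the other base edges avoid both.\<close>
  then obtain x S where x: "fst x = fst v" "tour m (x # S)" "tour_edges (x # S) = tour_edges T"
    using tour_rotate_to[OF assms(1)] by blast
  have dS: "u \<noteq> x" "u \<noteq> flip x" "flip u \<noteq> x" "flip u \<noteq> flip x" if "u \<in> set S" for u
    using x(2) that unfolding tour_def by (auto simp: image_iff)
  have "v = x \<or> v = flip x" using x(1) fst_eq_flip by metis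
  thus "\<exists>!e. e \<in> tour_edges T \<and> v \<in> e"
  proof
    assume v: "v = flip x"
    have "tour_edges (x # S) = insert {flip x, hd (S @ [x])} (path_edges (S @ [x]))"
      unfolding tour_edges_def by (cases S) auto
    hence E: "tour_edges T = insert {flip x, hd (S @ [x])} (path_edges (S @ [x]))"
      using x(3) by simp
    have "v \<notin> e" if "e \<in> path_edges (S @ [x])" for e
    proof
      assume "v \<in> e"
      moreover have "set (tl (S @ [x])) \<subseteq> insert x (set S)" by (cases S) auto
      ultimately have "v \<in> flip ` set S \<union> insert x (set S)"
        using path_edges_verts[OF that, of v] by auto
      then consider u where "u \<in> set S" "flip x = flip u" | "flip x = x" | "flip x \<in> set S"
        unfolding v by blast
      thus False using dS(1) dS(2) flip_simps by cases metis+
    qed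
    thus ?thesis unfolding E using v by blast
  next
    assume v: "v = x"
    have E: "tour_edges T = insert {flip (last (x # S)), x} (path_edges (x # S))"
      using x(3) tour_edges_snoc[of "x # S"] by simp
    have "v \<notin> e" if "e \<in> path_edges (x # S)" for e
    proof
      assume "v \<in> e"
      moreover have "set (butlast (x # S)) \<subseteq> insert x (set S)" by (auto dest: in_set_butlastD)
      ultimately have "v \<in> flip ` insert x (set S) \<union> set S"
        using path_edges_verts[OF that, of v] by auto
      then consider u where "u \<in> set S" "x = flip u" | "x \<in> set S"
        unfolding v by (elim UnE imageE insertE) (use flip_simps(4) in metis)+
      thus False using dS(1) dS(3) by cases metis+
    qed
    thus ?thesis unfolding E using v by blast
  qed
qed

lemma tour_edges_base_disjoint:
  assumes "tour m T" "m \<ge> 2"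
  shows "tour_edges T \<inter> base_matching m = {}"
proof (rule ccontr)
  assume "\<not> ?thesis"
  then obtain e where e: "e \<in> tour_edges T" "e \<in> base_matching m" by auto
  have len: "length T = m" "T \<noteq> []" using tour_length[OF assms(1)] assms(2) by auto
  obtain as x bs where T: "T = as @ x # bs" "e = {flip x, hd (bs @ as @ [x])}"
    using e(1) len(2) by (rule tour_edges_cases)
  let ?y = "hd (bs @ as @ [x])"
  have ne: "bs @ as \<noteq> []" using T len assms(2) by auto
  hence y: "?y \<in> set (bs @ as)" by (metis append_assoc hd_append2 hd_in_set)
  hence "fst ?y \<in> fst ` set (bs @ as)" by (rule imageI)
  moreover have "fst x \<notin> fst ` set (bs @ as)" using assms(1) unfolding tour_def T(1) by auto
    ultimately have "fst ?y \<noteq> fst x" by metis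
  moreover obtain w where "e = {w, flip w}" using e(2) by (auto simp: base_matching_def)
  ultimately show False using T(2) flip_simps(2) by (metis doubleton_eq_iff)
qed

text \<open>In the union, base edges and tour edges alternate along one cycle. A missing base edge
  forces the next tour edge, which excludes the next base edge, and so on around the cycle.\<close>

lemma perfect_matching_in_tour_union:
  assumes T: "tour m T" "m \<ge> 2" and N: "perfect_matching m N" "N \<subseteq> tour_edges T \<union> base_matching m"
    and h: "{hd T, flip (hd T)} \<notin> N"
  shows "N = tour_edges T"
proof -
  let ?M = "tour_edges T"
  note M = perfect_matching_tour[OF T]
  have *: "path_edges W \<subseteq> N"
    if "path_edges W \<subseteq> ?M" "set W \<subseteq> verts m" "{hd W, flip (hd W)} \<notin> N" for W
    using that
  proof (induction W rule: path_edges.induct)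
    case (1 x y zs)
    have "flip x \<in> verts m" using 1(3) by auto
    then obtain e where e: "e \<in> N" "flip x \<in> e" using perfect_matching_cover[OF N(1)] by blast
    have "e \<notin> base_matching m" using e 1(4) base_matching_iff[of e m "flip x"] by (auto simp: insert_commute)
    hence "e \<in> ?M" using e N(2) by blast
    hence "e = {flip x, y}" using perfect_matching_unique[OF M _ _ e(2), of "{flip x, y}"] 1(2) by auto
    hence xy: "{flip x, y} \<in> N" using e by simp
    have "{y, flip y} \<notin> N"
    proof
      assume "{y, flip y} \<in> N"
      hence "{y, flip y} = {flip x, y}" using perfect_matching_unique[OF N(1) _ xy, of _ y] by auto
      moreover have "{y, flip y} \<in> base_matching m" using 1(3) by (auto simp: base_matching_def)
      ultimately show False using tour_edges_base_disjoint[OF T] 1(2) by auto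
    qed
    thus ?case using 1 xy by auto
  qed auto
  have ne: "T \<noteq> []" using tour_length[OF T(1)] T(2) by auto
  have "?M \<subseteq> N" unfolding tour_edges_def
    by (rule *) (use h ne tour_verts[OF T(1)] in \<open>auto simp: tour_edges_def\<close>)
  thus ?thesis using perfect_matching_subset_eq[OF N(1) M] by blast
qed

section \<open>Counting tours by growing intervals\<close>

text \<open>Savings collected while an interval of a tour is extended: the colours \<open>cR R\<close> and \<open>cL L\<close>
  belong to the tour edges that leave the interval \<open>L @ v # R\<close> on the right and on the left.\<close>

definition saveR :: "('b list \<Rightarrow> bool) \<Rightarrow> 'b list \<Rightarrow> nat" where
  "saveR cR R = (\<Sum>k<length R. of_bool (\<not> cR (take k R)))"

definition saveL :: "('b list \<Rightarrow> bool) \<Rightarrow> 'b list \<Rightarrow> nat" where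
  "saveL cL L = (\<Sum>k<length L. of_bool (cL (drop (Suc k) L)))"

lemma saveR_snoc: "saveR cR (R @ [a]) = saveR cR R + of_bool (\<not> cR R)"
  unfolding saveR_def by (auto intro!: sum.cong)

lemma saveL_Cons: "saveL cL (a # L) = saveL cL L + of_bool (cL L)"
  unfolding saveL_def by (simp add: sum.lessThan_Suc_shift del: sum.lessThan_Suc)

text \<open>The interval \<open>L @ v # R\<close> is grown to the tours in \<open>C\<close>. With
  \<open>u\<close> base edges missing there are \<open>2 * u\<close> candidates for the next vertex,
  which gives the factor \<open>2 ^ u * fact u\<close>. A step that halves the candidates is
  compensated by one recorded saving, and \<open>good\<close> guarantees \<open>K\<close> savings
  for every complete tour, wherever the two sides meet. In \<open>excl\<close>, the entry
  \<open>flip a\<close> is left through \<open>a\<close>, so both tours attach the vertex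
  \<open>a\<close> to the interval, one on the left and one on the right.\<close>

lemma card_completions:
  fixes C :: "(nat \<times> bool) list set"
  assumes fin: "finite C" and tours: "\<And>xs. xs \<in> C \<Longrightarrow> tour m (v # xs)"
    and excl: "\<And>R L a mid1 mid2. cL L \<Longrightarrow> \<not> cR R \<Longrightarrow> R @ mid1 @ flip a # L \<in> C \<Longrightarrow> R @ a # mid2 @ L \<in> C \<Longrightarrow> False"
    and good: "\<And>R L. R @ L \<in> C \<Longrightarrow> K \<le> saveR cR R + saveL cL L"
    and len: "Suc (length R + length L + u) = m"
  shows "card {xs \<in> C. \<exists>mid. xs = R @ mid @ L} * 2 ^ K \<le> 2 ^ u * fact u * 2 ^ (saveR cR R + saveL cL L)"
  using len
proof (induction u arbitrary: R L)
  case 0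
  have "{xs \<in> C. \<exists>mid. xs = R @ mid @ L} \<subseteq> {R @ L} \<inter> C"
  proof
    fix xs assume "xs \<in> {xs \<in> C. \<exists>mid. xs = R @ mid @ L}"
    then obtain mid where "xs = R @ mid @ L" "xs \<in> C" by blast
    with tour_length[OF tours[of xs]] 0 show "xs \<in> {R @ L} \<inter> C" by auto
  qed
  hence c: "card {xs \<in> C. \<exists>mid. xs = R @ mid @ L} \<le> card ({R @ L} \<inter> C)" by (intro card_mono) auto
  show ?case
  proof (cases "R @ L \<in> C")
    case True
    have "card {xs \<in> C. \<exists>mid. xs = R @ mid @ L} * 2 ^ K \<le> 1 * 2 ^ (saveR cR R + saveL cL L)"
      using c True good[OF True] by (intro mult_mono power_increasing) auto
    thus ?thesis by simp
  qed (use c in auto)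
next
  case (Suc u)
  let ?N = "\<lambda>R L. {xs \<in> C. \<exists>mid. xs = R @ mid @ L}"
  define A where "A = {a. \<exists>mid. R @ a # mid @ L \<in> C}"
  define A' where "A' = {a. \<exists>mid. R @ mid @ flip a # L \<in> C}"
  define V where "V = {a \<in> verts m. fst a \<notin> fst ` set (v # R @ L)}"
  have finV: "finite V" unfolding V_def by (rule finite_subset[OF _ finite_verts[of m]]) auto
  show ?case
  proof (cases "?N R L = {}")
    case False
    then obtain mid0 where m0: "R @ mid0 @ L \<in> C" by blast
    have AV: "A \<subseteq> V" "A' \<subseteq> V"
    proof safe
      fix a b assume "(a, b) \<in> A"
      then obtain mid where "R @ (a, b) # mid @ L \<in> C" by (auto simp: A_def)
      from tours[OF this] show "(a, b) \<in> V" unfolding V_def tour_def verts_def by auto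
    next
      fix a b assume "(a, b) \<in> A'"
      then obtain mid where "R @ mid @ flip (a, b) # L \<in> C" by (auto simp: A'_def)
      from tours[OF this] show "(a, b) \<in> V" unfolding V_def tour_def verts_def by auto
    qed
    have cardV: "card V = 2 * Suc u"
    proof -
      have d: "distinct (map fst (v # R @ L))" "fst ` set (v # R @ L) \<subseteq> {..<m}"
        using tours[OF m0] unfolding tour_def by auto
      have "V = ({..<m} - fst ` set (v # R @ L)) \<times> UNIV"
        unfolding V_def verts_def by (intro set_eqI) (simp add: mem_Times_iff)
      hence "card V = 2 * (m - card (fst ` set (v # R @ L)))"
        using d(2) by (simp add: card_cartesian_product card_Diff_subset)
      also have "card (fst ` set (v # R @ L)) = length (map fst (v # R @ L))"
        using distinct_card[OF d(1)] by (simp add: image_Un)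
      finally show ?thesis using Suc.prems by simp
    qed
    have fA: "finite A" "finite A'" using AV finV finite_subset by auto
    have NR: "?N R L \<subseteq> (\<Union>a\<in>A. ?N (R @ [a]) L)"
    proof clarify
      fix mid assume m: "R @ mid @ L \<in> C"
      have "length mid = Suc u" using tour_length[OF tours[OF m]] Suc.prems by simp
      then obtain a mid' where "mid = a # mid'" by (cases mid) auto
      thus "R @ mid @ L \<in> (\<Union>a\<in>A. ?N (R @ [a]) L)" using m by (auto simp: A_def)
    qed
    have NL: "?N R L \<subseteq> (\<Union>a\<in>A'. ?N R (flip a # L))"
    proof clarify
      fix mid assume m: "R @ mid @ L \<in> C"
      have "length mid = Suc u" using tour_length[OF tours[OF m]] Suc.prems by simp
      then obtain a mid' where mid: "mid = mid' @ [a]" by (cases mid rule: rev_cases) auto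
      have "flip a \<in> A'" using m mid by (auto simp: A'_def)
      moreover have "R @ mid @ L \<in> ?N R (flip (flip a) # L)" using m mid by auto
      ultimately show "R @ mid @ L \<in> (\<Union>a\<in>A'. ?N R (flip a # L))" by blast
    qed
    have bound: "card (?N R L) * 2 ^ K \<le> card I * B"
      if "finite I" "?N R L \<subseteq> (\<Union>a\<in>I. X a)" "\<And>a. a \<in> I \<Longrightarrow> X a \<subseteq> C"
         "\<And>a. a \<in> I \<Longrightarrow> card (X a) * 2 ^ K \<le> B" for I :: "(nat \<times> bool) set" and X B
    proof -
      have "card (?N R L) \<le> card (\<Union>a\<in>I. X a)"
        using that(3) by (intro card_mono[OF finite_subset[OF _ fin] that(2)]) auto
      also have "\<dots> \<le> (\<Sum>a\<in>I. card (X a))" using that(1) by (rule card_UN_le)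
      finally have "card (?N R L) * 2 ^ K \<le> (\<Sum>a\<in>I. card (X a)) * 2 ^ K" by simp
      also have "\<dots> = (\<Sum>a\<in>I. card (X a) * 2 ^ K)" by (rule sum_distrib_right)
      also have "\<dots> \<le> (\<Sum>a\<in>I. B)" using that(4) by (rule sum_mono)
      finally show ?thesis by simp
    qed
    let ?c = "saveR cR R + saveL cL L"
    have bR: "card (?N R L) * 2 ^ K \<le> card A * (2 ^ u * fact u * 2 ^ (?c + of_bool (\<not> cR R)))"
      by (rule bound[OF fA(1) NR]) (use Suc.IH[of "R @ [_]" L] Suc.prems in \<open>auto simp: saveR_snoc add_ac\<close>)
    have bL: "card (?N R L) * 2 ^ K \<le> card A' * (2 ^ u * fact u * 2 ^ (?c + of_bool (cL L)))"
      by (rule bound[OF fA(2) NL]) (use Suc.IH[of R "flip _ # L"] Suc.prems in \<open>auto simp: saveL_Cons add_ac\<close>)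
    have mono: "x \<le> c * B \<Longrightarrow> c \<le> d \<Longrightarrow> x \<le> d * B" for x c d B :: nat
      by (meson mult_le_mono1 order_trans)
    have cA: "card A \<le> 2 * Suc u" "card A' \<le> 2 * Suc u"
      using card_mono[OF finV AV(1)] card_mono[OF finV AV(2)] cardV by auto
    show ?thesis
    \<comment> \<open>The candidate sets lie in \<open>V\<close>, which has \<open>2 * Suc u\<close>
      elements. When growth on either side would record a saving, the sets are disjoint, so one has
      at most \<open>Suc u\<close> elements and the interval grows there. Otherwise it grows on a
      side that records none.\<close>
    proof (cases "cL L \<and> \<not> cR R")
      case True
      hence "A \<inter> A' = {}" using excl unfolding A_def A'_def by blast
      hence "card A + card A' = card (A \<union> A')" using card_Un_disjoint[OF fA] by simp
      also have "\<dots> \<le> card V" using finV AV by (intro card_mono) auto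
      finally have "card A \<le> Suc u \<or> card A' \<le> Suc u" using cardV by arith
      hence "card (?N R L) * 2 ^ K \<le> Suc u * (2 ^ u * fact u * 2 ^ (?c + 1))"
      proof
        assume "card A \<le> Suc u"
        with mono[OF bR, of "Suc u"] True show ?thesis by simp
      next
        assume "card A' \<le> Suc u"
        with mono[OF bL, of "Suc u"] True show ?thesis by simp
      qed
      thus ?thesis by (simp add: algebra_simps)
    next
      case False
      hence "card (?N R L) * 2 ^ K \<le> (2 * Suc u) * (2 ^ u * fact u * 2 ^ ?c)"
      proof (cases "cL L")
        case True
        with False mono[OF bR cA(1)] show ?thesis by simp
      next
        case False
        with mono[OF bL cA(2)] show ?thesis by simp
      qed
      thus ?thesis by (simp add: algebra_simps)
    qed
  next
    case True
    hence "card (?N R L) = 0" by (simp only: card.empty)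
    thus ?thesis by simp
  qed
qed

text \<open>Start where the height function of the two colours is maximal: going forward it can only have
  decreased, going backward it can only have increased.\<close>

lemma cycle_lemma:
  fixes c :: "nat \<Rightarrow> bool"
  assumes n: "n > 0" and bal: "2 * card {k. k < n \<and> c k} = n"
  obtains j where "j < n"
    "\<And>r. r < n \<Longrightarrow> n div 2 \<le> (\<Sum>k<r. of_bool (\<not> c ((j + k) mod n))) + (\<Sum>k=Suc r..<n. of_bool (c ((j + k) mod n)) :: nat)"
proof -
  define w :: "nat \<Rightarrow> int" where "w k = (if c (k mod n) then 1 else -1)" for k
  define H where "H r = (\<Sum>k<r. w k)" for r
  have Hn: "H n = 0"
  proof -
    have "H n = (\<Sum>k<n. 2 * of_bool (c k) - 1)" unfolding H_def w_def by (intro sum.cong) auto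
    also have "\<dots> = 2 * (\<Sum>k<n. of_bool (c k)) - int n" by (simp add: sum_subtractf sum_distrib_left)
    also have "(\<Sum>k<n. of_bool (c k)) = int (card {k. k < n \<and> c k})"
      by (simp add: of_bool_def sum.If_cases Int_def)
    finally show ?thesis using bal by linarith
  qed
  have per: "H (n + r) = H r" for r
  proof (induction r)
    case (Suc r)
    have "w (n + r) = w r" by (simp add: w_def)
    thus ?case using Suc by (simp add: H_def)
  qed (use Hn in \<open>simp add: H_def\<close>)
  have fin: "finite (H ` {..<n})" "H ` {..<n} \<noteq> {}" using n by auto
  obtain j where j: "j < n" "H j = Max (H ` {..<n})" using Max_in[OF fin] by auto
  have mx: "H r \<le> H j" if "r < 2 * n" for r
  proof (cases "r < n")
    case True thus ?thesis using j Max_ge[OF fin(1)] by simp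
  next
    case False
    hence "H r = H (r - n)" using per[of "r - n"] by simp
    moreover have "r - n < n" using that False by simp
    ultimately show ?thesis using j Max_ge[OF fin(1)] by simp
  qed
  have shift: "(\<Sum>k=a..<b. w (j + k)) = H (j + b) - H (j + a)" if "a \<le> b" for a b
    using that
  proof (induction b)
    case (Suc b)
    thus ?case by (cases "a = Suc b") (auto simp: H_def)
  qed simp
  show ?thesis
  proof (rule that[OF j(1)])
    fix r assume r: "r < n"
    define q where "q = (\<Sum>k<r. of_bool (\<not> c ((j + k) mod n)) :: nat)"
    define p where "p = (\<Sum>k=Suc r..<n. of_bool (c ((j + k) mod n)) :: nat)"
    have "(\<Sum>k=0..<r. w (j + k)) = (\<Sum>k<r. 1 - 2 * of_bool (\<not> c ((j + k) mod n)))"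
      unfolding w_def lessThan_atLeast0 by (intro sum.cong) auto
    also have "\<dots> = int r - 2 * int q" by (simp add: sum_subtractf sum_distrib_left q_def)
    finally have 1: "int r - 2 * int q \<le> 0" using shift[of 0 r] mx[of "j + r"] r j(1) by simp
    have "(\<Sum>k=Suc r..<n. w (j + k)) = (\<Sum>k=Suc r..<n. 2 * of_bool (c ((j + k) mod n)) - 1)"
      unfolding w_def by (intro sum.cong) auto
    also have "\<dots> = 2 * int p - int (n - Suc r)" by (simp add: sum_subtractf sum_distrib_left p_def)
    also have "int (n - Suc r) = int n - int r - 1" using r by simp
    finally have 2: "0 \<le> 2 * int p - (int n - int r - 1)"
      using shift[of "Suc r" n] mx[of "j + Suc r"] per[of j] r j(1) by (simp add: add.commute)
    \<comment> \<open>Position \<open>r\<close> belongs to neither sum; the loss of 1 disappears in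
      the rounding of \<open>n div 2\<close>.\<close>
    have "n \<le> 2 * (q + p) + 1" using 1 2 by presburger
    hence "n div 2 \<le> q + p" by presburger
    thus "n div 2 \<le> (\<Sum>k<r. of_bool (\<not> c ((j + k) mod n))) + (\<Sum>k=Suc r..<n. of_bool (c ((j + k) mod n)))"
      by (simp only: p_def q_def)
  qed
qed

section \<open>Closed walks of row changes\<close>

text \<open>Only the coordinates of edge variables are prescribed; all others remain free.\<close>

definition matching_shape :: "nat \<Rightarrow> nat \<Rightarrow> ((nat \<times> bool) set \<Rightarrow> 'v) \<Rightarrow> ('v \<Rightarrow>\<^sub>0 nat) \<Rightarrow> (nat \<times> bool) set set \<Rightarrow> bool" where
  "matching_shape m d var f N \<longleftrightarrow> perfect_matching m N \<and>
     (\<forall>e\<in>vpairs m. Poly_Mapping.lookup f (var e) = (if e \<in> N then d else 0))"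

definition weight :: "'v set \<Rightarrow> ('v \<Rightarrow> int) \<Rightarrow> ('v \<Rightarrow>\<^sub>0 nat) \<Rightarrow> int" where
  "weight W a f = (\<Sum>v\<in>W. a v * int (Poly_Mapping.lookup f v))"

text \<open>A tour can be rotated, or reversed and flipped, without changing its edges; the start
  \<open>(0, True)\<close> fixes both choices.\<close>

definition target_matchings :: "nat \<Rightarrow> (nat \<times> bool) set set set" where
  "target_matchings m = tour_edges ` {T. tour m T \<and> hd T = (0, True)}"

text \<open>What the two families have in common: permutation sums in a half-space, whose bounding
  hyperplane, given by \<open>a\<close> and \<open>A\<close>, contains only points that carry
  perfect matchings, among them the base matching and all tours. The multiplicity \<open>d\<close>
  will be \<open>q - 1\<close>.\<close>

locale matching_face =
  fixes t m d :: nat and L :: "nat \<Rightarrow> nat \<Rightarrow> ('v \<Rightarrow>\<^sub>0 nat) set" and var :: "(nat \<times> bool) set \<Rightarrow> 'v"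
    and W :: "'v set" and a :: "'v \<Rightarrow> int" and A :: int
  assumes label: "\<mu> \<in> L i j \<Longrightarrow> \<mu> = 0 \<or> (\<exists>v. \<mu> = Poly_Mapping.single v 1)"
    and m: "m \<ge> 2" "even m" and d: "d \<ge> 1"
    and var_inj: "inj_on var (vpairs m)"
    and weight_le: "f \<in> perm_sums t L \<Longrightarrow> weight W a f \<le> A"
    and face: "f \<in> perm_sums t L \<Longrightarrow> weight W a f = A \<Longrightarrow> \<exists>N. matching_shape m d var f N"
    and realize: "N \<in> insert (base_matching m) (target_matchings m) \<Longrightarrow>
        \<exists>f\<in>perm_sums t L. weight W a f = A \<and> matching_shape m d var f N"

text \<open>Row \<open>i0\<close> contributes the base edge at \<open>(0, True)\<close> to the base
  point. No tour uses this edge, so each change to a tour must relabel \<open>i0\<close>; this gives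
  all walks a common first row, without which they could not be spliced.\<close>

locale matching_face_base = matching_face t m d L var W a A
  for t m d L and var :: "(nat \<times> bool) set \<Rightarrow> 'v" and W a A +
  fixes \<sigma>0 \<mu>0 i0
  assumes \<sigma>0: "\<sigma>0 permutes {1..t}" and \<mu>0: "\<And>i. i \<in> {1..t} \<Longrightarrow> \<mu>0 i \<in> L i (\<sigma>0 i)"
    and base_weight: "weight W a (\<Sum>i\<in>{1..t}. \<mu>0 i) = A"
    and base_shape: "matching_shape m d var (\<Sum>i\<in>{1..t}. \<mu>0 i) (base_matching m)"
    and i0: "i0 \<in> {1..t}" "Poly_Mapping.lookup (\<mu>0 i0) (var {(0, True), flip (0, True)}) > 0"
begin

text \<open>An element \<open>(i, \<mu>)\<close> of a walk sends row \<open>i\<close> to the column that \<open>\<sigma>0\<close> assigns to the next row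
  and relabels it by \<open>\<mu>\<close>. A closed walk without repeated rows changes \<open>\<sigma>0\<close> into another permutation.\<close>

fun walk :: "(nat \<times> ('v \<Rightarrow>\<^sub>0 nat)) list \<Rightarrow> nat \<Rightarrow> bool" where
  "walk [] z \<longleftrightarrow> True"
| "walk (p # ps) z \<longleftrightarrow> fst p \<in> {1..t} \<and>
     snd p \<in> L (fst p) (\<sigma>0 (case ps of [] \<Rightarrow> z | q # _ \<Rightarrow> fst q)) \<and> walk ps z"

definition closed_walk where "closed_walk w \<longleftrightarrow> walk w (fst (hd w))"

definition change where
  "change v p = int (Poly_Mapping.lookup (snd p) v) - int (Poly_Mapping.lookup (\<mu>0 (fst p)) v)"

text \<open>The rise of the exponent of \<open>e\<close> over the base point, as a sum over list
  elements: it thus makes sense for parts of walks and for walks with repeated rows, to which no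
  permutation belongs.\<close>

definition height where "height w e = sum_list (map (change (var e)) w)"

definition wchange where "wchange w = sum_list (map (\<lambda>p. \<Sum>v\<in>W. a v * change v p) w)"

lemma walk_append:
  "walk (xs @ ys) z \<longleftrightarrow> walk xs (if ys = [] then z else fst (hd ys)) \<and> walk ys z"
  by (induction xs) (auto split: list.splits)

lemma walk_nth:
  "walk w z \<Longrightarrow> k < length w \<Longrightarrow> fst (w ! k) \<in> {1..t} \<and> snd (w ! k) \<in> L (fst (w ! k)) (\<sigma>0 ((map fst w @ [z]) ! Suc k))"
proof (induction w arbitrary: k)
  case (Cons p w)
  show ?case
  proof (cases k)
    case 0
    thus ?thesis using Cons.prems by (cases w) auto
  next
    case (Suc k')
    thus ?thesis using Cons by auto
  qed
qed simp

lemma walkI: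
  "(\<And>k. k < length w \<Longrightarrow> fst (w ! k) \<in> {1..t} \<and> snd (w ! k) \<in> L (fst (w ! k)) (\<sigma>0 ((map fst w @ [z]) ! Suc k))) \<Longrightarrow> walk w z"
proof (induction w)
  case (Cons p w)
  have "walk w z"
  proof (rule Cons.IH)
    fix k assume "k < length w"
    thus "fst (w ! k) \<in> {1..t} \<and> snd (w ! k) \<in> L (fst (w ! k)) (\<sigma>0 ((map fst w @ [z]) ! Suc k))"
      using Cons.prems[of "Suc k"] by simp
  qed
  thus ?case using Cons.prems[of 0] by (cases w) auto
qed simp

text \<open>The condition on an element involves only the row of its successor, so cutting at two
  visits to the same row leaves two closed walks. An arbitrary \<open>\<phi>\<close> covers heights
  and weight changes at once.\<close>

lemma closed_walk_decompose:
  "closed_walk w \<Longrightarrow> \<exists>ws. (\<forall>c\<in>set ws. c \<noteq> [] \<and> closed_walk c \<and> distinct (map fst c)) \<and>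
     (\<forall>\<phi> :: _ \<Rightarrow> int. sum_list (map \<phi> w) = sum_list (map (\<lambda>c. sum_list (map \<phi> c)) ws))"
proof (induction "length w" arbitrary: w rule: less_induct)
  case less
  show ?case
  proof (cases "distinct (map fst w)")
    case True
    thus ?thesis using less.prems by (cases "w = []") (auto intro: exI[of _ "[]"] exI[of _ "[w]"])
  next
    case False
    then obtain as bs cs i where *: "map fst w = as @ [i] @ bs @ [i] @ cs"
      using not_distinct_decomp by blast
    then obtain xs w1 where w1: "w = xs @ w1" "map fst xs = as" "map fst w1 = [i] @ bs @ [i] @ cs"
      by (auto simp: map_eq_append_conv)
    then obtain p w2 where w2: "w1 = p # w2" "fst p = i" "map fst w2 = bs @ [i] @ cs" by auto
    then obtain ys w3 where w3: "w2 = ys @ w3" "map fst w3 = [i] @ cs" by (auto simp: map_eq_append_conv)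
    then obtain q zs where w4: "w3 = q # zs" "fst q = i" by auto
    have w: "w = xs @ (p # ys) @ (q # zs)" using w1 w2 w3 w4 by simp
    have "closed_walk (p # ys)" "closed_walk (xs @ q # zs)"
      using less.prems w2(2) w4(2) unfolding closed_walk_def w walk_append by (cases xs; auto)+
    with less.hyps[of "p # ys"] less.hyps[of "xs @ q # zs"] obtain ws1 ws2 where
      "\<forall>c\<in>set ws1. c \<noteq> [] \<and> closed_walk c \<and> distinct (map fst c)"
      "\<forall>c\<in>set ws2. c \<noteq> [] \<and> closed_walk c \<and> distinct (map fst c)"
      "\<And>\<phi> :: _ \<Rightarrow> int. sum_list (map \<phi> (p # ys)) = sum_list (map (\<lambda>c. sum_list (map \<phi> c)) ws1)"
      "\<And>\<phi> :: _ \<Rightarrow> int. sum_list (map \<phi> (xs @ q # zs)) = sum_list (map (\<lambda>c. sum_list (map \<phi> c)) ws2)"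
      using w by (auto simp: less_Suc_eq_le)
    note ws = this
    show ?thesis
    proof (intro exI[of _ "ws1 @ ws2"] conjI allI)
      fix \<phi> :: "_ \<Rightarrow> int"
      have "sum_list (map \<phi> w) = sum_list (map \<phi> (p # ys)) + sum_list (map \<phi> (xs @ q # zs))"
        unfolding w by simp
      also have "\<dots> = sum_list (map (\<lambda>c. sum_list (map \<phi> c)) (ws1 @ ws2))"
        unfolding ws(3,4) by simp
      finally show "sum_list (map \<phi> w) = sum_list (map (\<lambda>c. sum_list (map \<phi> c)) (ws1 @ ws2))" .
    qed (use ws(1,2) in auto)
  qed
qed

text \<open>The rows of \<open>c\<close> form a cycle, and composing \<open>\<sigma>0\<close> with
  this cycle is again a permutation. Distinctness ensures that no row is asked to carry two
  labels.\<close>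

lemma simple_closed_walk:
  assumes c: "closed_walk c" "distinct (map fst c)" "c \<noteq> []"
  obtains g where "g \<in> perm_sums t L"
    "\<And>v. int (Poly_Mapping.lookup g v) = int (Poly_Mapping.lookup (\<Sum>i\<in>{1..t}. \<mu>0 i) v) + sum_list (map (change v) c)"
    "weight W a g = A + wchange c"
    "\<And>v p. p \<in> set c \<Longrightarrow> Poly_Mapping.lookup (snd p) v \<le> Poly_Mapping.lookup g v"
proof -
  let ?cs = "map fst c"
  let ?\<kappa> = "cycle_of_list ?cs"
  define \<mu> where "\<mu> i = (case map_of c i of Some \<nu> \<Rightarrow> \<nu> | None \<Rightarrow> \<mu>0 i)" for i
  define g where "g = (\<Sum>i\<in>{1..t}. \<mu> i)"
  have nth: "fst (c ! k) \<in> {1..t}" "snd (c ! k) \<in> L (fst (c ! k)) (\<sigma>0 (?\<kappa> (fst (c ! k))))" if k: "k < length c" for k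
  proof -
    have "map ?\<kappa> ?cs = rotate1 ?cs" using cyclic_rotation[OF c(2), of 1] by simp
    hence "?\<kappa> (fst (c ! k)) = rotate1 ?cs ! k" using k by (metis length_map nth_map)
    also have "rotate1 ?cs ! k = (?cs @ [fst (hd c)]) ! Suc k" using c(3) by (cases c) auto
    finally show "fst (c ! k) \<in> {1..t}" "snd (c ! k) \<in> L (fst (c ! k)) (\<sigma>0 (?\<kappa> (fst (c ! k))))"
      using walk_nth[OF c(1)[unfolded closed_walk_def] k] by auto
  qed
  have \<mu>c: "\<mu> (fst p) = snd p" if "p \<in> set c" for p
    using map_of_is_SomeI[OF c(2), of "fst p" "snd p"] that unfolding \<mu>_def by simp
  have \<mu>n: "\<mu> i = \<mu>0 i" if "i \<notin> fst ` set c" for i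
    using that unfolding \<mu>_def by (simp add: map_of_eq_None_iff[symmetric])
  have sub: "fst ` set c \<subseteq> {1..t}" using nth(1) unfolding in_set_conv_nth image_subset_iff Ball_def by metis
  have "\<sigma>0 \<circ> ?\<kappa> permutes {1..t}"
    using permutes_compose[OF permutes_subset[OF cycle_permutes] \<sigma>0] sub by simp
  moreover have "\<mu> i \<in> L i ((\<sigma>0 \<circ> ?\<kappa>) i)" if "i \<in> {1..t}" for i
  proof (cases "i \<in> fst ` set c")
    case True
    then obtain k where "k < length c" "i = fst (c ! k)" by (auto simp: in_set_conv_nth)
    thus ?thesis using nth(2) \<mu>c by simp
  next
    case False
    thus ?thesis using \<mu>n \<mu>0 that id_outside_supp[of i ?cs] by simp
  qed
  ultimately have gF: "g \<in> perm_sums t L" unfolding g_def perm_sums_def by blast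
  have lk: "int (Poly_Mapping.lookup g v) = int (Poly_Mapping.lookup (\<Sum>i\<in>{1..t}. \<mu>0 i) v) + sum_list (map (change v) c)" for v
  proof -
    have "int (Poly_Mapping.lookup g v) - int (Poly_Mapping.lookup (\<Sum>i\<in>{1..t}. \<mu>0 i) v)
        = (\<Sum>i\<in>{1..t}. int (Poly_Mapping.lookup (\<mu> i) v) - int (Poly_Mapping.lookup (\<mu>0 i) v))"
      unfolding g_def by (simp add: lookup_sum sum_subtractf)
    also have "\<dots> = (\<Sum>i\<in>fst ` set c. int (Poly_Mapping.lookup (\<mu> i) v) - int (Poly_Mapping.lookup (\<mu>0 i) v))"
      using sub \<mu>n by (intro sum.mono_neutral_right) auto
    also have "\<dots> = (\<Sum>p\<in>set c. change v p)"
      using c(2) \<mu>c by (subst sum.reindex) (auto simp: distinct_map change_def)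
    also have "\<dots> = sum_list (map (change v) c)"
      using c(2) by (simp add: distinct_map sum.distinct_set_conv_list)
    finally show ?thesis by simp
  qed
  have "weight W a g = weight W a (\<Sum>i\<in>{1..t}. \<mu>0 i) + (\<Sum>v\<in>W. a v * sum_list (map (change v) c))"
    unfolding weight_def lk by (simp add: algebra_simps sum.distrib)
  also have "(\<Sum>v\<in>W. a v * sum_list (map (change v) c)) = wchange c"
    unfolding wchange_def by (induction c) (auto simp: algebra_simps sum.distrib)
  finally have "weight W a g = A + wchange c" using base_weight by simp
  moreover have "Poly_Mapping.lookup (snd p) v \<le> Poly_Mapping.lookup g v" if "p \<in> set c" for p v
  proof -
    have "Poly_Mapping.lookup (\<mu> (fst p)) v \<le> (\<Sum>i\<in>{1..t}. Poly_Mapping.lookup (\<mu> i) v)"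
      using that sub by (intro member_le_sum) auto
    thus ?thesis using \<mu>c[OF that] by (simp add: g_def lookup_sum)
  qed
  ultimately show ?thesis using that gF lk by blast
qed

lemma simple_walk_wchange_le: "closed_walk c \<Longrightarrow> distinct (map fst c) \<Longrightarrow> c \<noteq> [] \<Longrightarrow> wchange c \<le> 0"
  using simple_closed_walk[of c] weight_le by (metis add_le_same_cancel1)

lemma closed_walk_wchange_le:
  assumes "closed_walk w" shows "wchange w \<le> 0"
proof -
  obtain ws where ws: "\<forall>c\<in>set ws. c \<noteq> [] \<and> closed_walk c \<and> distinct (map fst c)"
     "\<And>\<phi> :: _ \<Rightarrow> int. sum_list (map \<phi> w) = sum_list (map (\<lambda>c. sum_list (map \<phi> c)) ws)"
    using closed_walk_decompose[OF assms] by blast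
  have "wchange w = sum_list (map wchange ws)" unfolding wchange_def ws(2) by (simp add: comp_def)
  also have "\<dots> \<le> sum_list (map (\<lambda>_. 0) ws)"
    using ws(1) simple_walk_wchange_le by (intro sum_list_mono) auto
  finally show ?thesis by simp
qed

text \<open>The cycles of the decomposition have weight changes \<le> 0 with sum 0, so each leads to
  a point of the face, hence to a perfect matching, which meets \<open>X\<close> at least as often
  as the base matching.\<close>

lemma closed_walk_ge:
  assumes w: "closed_walk w" "wchange w = 0" and X: "X \<subseteq> vpairs m"
    and min: "\<And>N. perfect_matching m N \<Longrightarrow> card (base_matching m \<inter> X) \<le> card (N \<inter> X)"
  shows "0 \<le> (\<Sum>e\<in>X. height w e)"
proof -
  obtain ws where ws: "\<forall>c\<in>set ws. c \<noteq> [] \<and> closed_walk c \<and> distinct (map fst c)"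
     "\<And>\<phi> :: _ \<Rightarrow> int. sum_list (map \<phi> w) = sum_list (map (\<lambda>c. sum_list (map \<phi> c)) ws)"
    using closed_walk_decompose[OF w(1)] by blast
  have finX: "finite X" using X finite_vpairs finite_subset by blast
  have "sum_list (map wchange ws) = 0" using w(2) unfolding wchange_def ws(2) by (simp add: comp_def)
  moreover have "\<forall>c\<in>set ws. wchange c \<le> 0" using ws(1) simple_walk_wchange_le by blast
  ultimately have z: "wchange c = 0" if "c \<in> set ws" for c
  proof -
    have "sum_list (map (\<lambda>c. - wchange c) ws) = 0"
      using \<open>sum_list (map wchange ws) = 0\<close> by (simp add: uminus_sum_list_map[unfolded comp_def, symmetric])
    moreover have "\<And>x. x \<in> set (map (\<lambda>c. - wchange c) ws) \<Longrightarrow> 0 \<le> x" using \<open>\<forall>c\<in>set ws. wchange c \<le> 0\<close> by auto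
    ultimately show ?thesis using sum_list_nonneg_eq_0_iff[of "map (\<lambda>c. - wchange c) ws"] that by auto
  qed
  have c: "0 \<le> (\<Sum>e\<in>X. height c e)" if cw: "c \<in> set ws" for c
  proof -
    have c: "closed_walk c" "distinct (map fst c)" "c \<noteq> []" using ws(1) cw by auto
    obtain g where g: "g \<in> perm_sums t L" "weight W a g = A"
      "\<And>v. int (Poly_Mapping.lookup g v) = int (Poly_Mapping.lookup (\<Sum>i\<in>{1..t}. \<mu>0 i) v) + sum_list (map (change v) c)"
      using simple_closed_walk[OF c] z[OF cw] by (metis add.right_neutral)
    obtain N where N: "matching_shape m d var g N" using face[OF g(1,2)] by blast
    have ind: "(\<Sum>e\<in>X. if e \<in> M then int d else 0) = int d * int (card (M \<inter> X))" for M
      using finX by (simp add: sum.If_cases Int_commute)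
    have "(\<Sum>e\<in>X. height c e) = (\<Sum>e\<in>X. (if e \<in> N then int d else 0) - (if e \<in> base_matching m then int d else 0))"
    proof (intro sum.cong refl)
      fix e assume "e \<in> X"
      hence "e \<in> vpairs m" using X by auto
      thus "height c e = (if e \<in> N then int d else 0) - (if e \<in> base_matching m then int d else 0)"
        using g(3)[of "var e"] N base_shape unfolding matching_shape_def height_def by auto
    qed
    also have "\<dots> = int d * (int (card (N \<inter> X)) - int (card (base_matching m \<inter> X)))"
      unfolding sum_subtractf ind by (simp add: algebra_simps)
    also have "\<dots> \<ge> 0" using min[of N] N unfolding matching_shape_def by simp
    finally show ?thesis .
  qed
  have "(\<Sum>e\<in>X. height w e) = sum_list (map (\<lambda>p. \<Sum>e\<in>X. change (var e) p) w)"
    unfolding height_def by (induction w) (auto simp: sum.distrib)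
  also have "\<dots> = sum_list (map (\<lambda>c. \<Sum>e\<in>X. height c e) ws)"
  proof -
    have "sum_list (map (\<lambda>p. \<Sum>e\<in>X. change (var e) p) c) = (\<Sum>e\<in>X. height c e)" for c
      unfolding height_def by (induction c) (auto simp: sum.distrib)
    thus ?thesis unfolding ws(2) by simp
  qed
  also have "\<dots> \<ge> 0" using c by (intro sum_list_nonneg) auto
  finally show ?thesis .
qed

end

section \<open>Cutting the walk of a tour and splicing two cut walks\<close>

lemma perfect_matching_card:
  assumes "perfect_matching m N" shows "card N = m"
proof -
  have U: "verts m = \<Union>N"
    using assms unfolding perfect_matching_def vpairs_def by blast
  have "N \<subseteq> vpairs m" using assms by (simp add: perfect_matching_def)
  hence "card (\<Union>N) = 2 * card N"
    using perfect_matching_unique[OF assms] by (intro card_Union_vpairs) blast+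
  thus ?thesis using U card_verts[of m] by simp
qed

text \<open>All that the counting argument uses of permutations and labels. \<open>y N\<close> is
  the row at which the walk of \<open>N\<close> is cut, and \<open>h N e\<close> is the height of
  \<open>e\<close> reached there. In the last clause, the first part of the walk of
  \<open>N1\<close> is followed by the second part for \<open>N2\<close>, which contributes the full
  change of \<open>N2\<close> minus \<open>h N2 e\<close>.\<close>

definition class_data :: "nat \<Rightarrow> nat \<Rightarrow> nat \<Rightarrow> ((nat \<times> bool) set set \<Rightarrow> nat) \<Rightarrow>
    ((nat \<times> bool) set set \<Rightarrow> (nat \<times> bool) set \<Rightarrow> int) \<Rightarrow> bool" where
  "class_data m t d y h \<longleftrightarrow>
    (\<forall>N\<in>target_matchings m. y N \<in> {1..t} \<and> card {e \<in> N. 1 \<le> h N e} = m div 2 \<and>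
      (\<forall>e\<in>base_matching m. - int d \<le> h N e \<and> h N e \<le> 0) \<and>
      (\<forall>e\<in>vpairs m - (N \<union> base_matching m). h N e = 0)) \<and>
    (\<forall>N1 N2 X. N1 \<in> target_matchings m \<longrightarrow> N2 \<in> target_matchings m \<longrightarrow> y N1 = y N2 \<longrightarrow> X \<subseteq> vpairs m \<longrightarrow>
      (\<forall>N. perfect_matching m N \<longrightarrow> card (base_matching m \<inter> X) \<le> card (N \<inter> X)) \<longrightarrow>
      0 \<le> (\<Sum>e\<in>X. h N1 e - h N2 e) + int d * (int (card (N2 \<inter> X)) - int (card (base_matching m \<inter> X))))"

context matching_face_base
begin

lemma base_row_le:
  assumes "i \<in> {1..t}" "e \<in> vpairs m"
  shows "Poly_Mapping.lookup (\<mu>0 i) (var e) \<le> (if e \<in> base_matching m then d else 0)"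
proof -
  have "Poly_Mapping.lookup (\<mu>0 i) (var e) \<le> (\<Sum>i\<in>{1..t}. Poly_Mapping.lookup (\<mu>0 i) (var e))"
    using assms by (intro member_le_sum) auto
  also have "\<dots> = (if e \<in> base_matching m then d else 0)"
    using base_shape assms(2) unfolding matching_shape_def by (auto simp flip: lookup_sum)
  finally show ?thesis .
qed

text \<open>Only the cycle through row \<open>i0\<close> is kept: the union of a tour with the base matching contains
  no other perfect matchings than these two, so this cycle already carries the whole change.\<close>

lemma target_walk:
  assumes "N \<in> target_matchings m"
  obtains w where "w \<noteq> []" "closed_walk w" "distinct (map fst w)" "fst (hd w) = i0" "wchange w = 0"
    "\<And>e. e \<in> vpairs m \<Longrightarrow> height w e = (if e \<in> N then int d else 0) - (if e \<in> base_matching m then int d else 0)"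
    "\<And>p e. p \<in> set w \<Longrightarrow> e \<in> vpairs m - N \<Longrightarrow> Poly_Mapping.lookup (snd p) (var e) = 0"
proof -
  obtain T where T: "tour m T" "hd T = (0, True)" "N = tour_edges T"
    using assms by (auto simp: target_matchings_def)
  obtain f where f: "f \<in> perm_sums t L" "weight W a f = A" "matching_shape m d var f N"
    using realize[of N] assms by auto
  then obtain \<sigma> \<mu> where \<sigma>: "\<sigma> permutes {1..t}" "\<And>i. i \<in> {1..t} \<Longrightarrow> \<mu> i \<in> L i (\<sigma> i)" "f = (\<Sum>i\<in>{1..t}. \<mu> i)"
    unfolding perm_sums_def by blast
  let ?e0 = "{(0, True), flip (0, True)}"
  have "(0, True) \<in> verts m" using m by (simp add: verts_def)
  hence e0: "?e0 \<in> base_matching m" "?e0 \<in> vpairs m" by (auto simp: base_matching_def)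
  have e0N: "?e0 \<notin> N" using tour_edges_base_disjoint[OF T(1) m(1)] e0 T(3) by auto
  \<comment> \<open>\<open>\<pi>\<close> is the change of rows relative to \<open>\<sigma>0\<close>;
    the walk follows its cycle through \<open>i0\<close>.\<close>
  define \<pi> where "\<pi> = inv \<sigma>0 \<circ> \<sigma>"
  have \<pi>: "\<pi> permutes {1..t}" unfolding \<pi>_def by (intro permutes_compose \<sigma>(1) permutes_inv \<sigma>0)
  have \<sigma>\<pi>: "\<sigma> i = \<sigma>0 (\<pi> i)" for i unfolding \<pi>_def using permutes_inverses(1)[OF \<sigma>0] by simp
  have perm: "permutation \<pi>" using \<pi> permutation_permutes by blast
  define n where "n = least_power \<pi> i0"
  have n: "(\<pi> ^^ n) i0 = i0" "n > 0" unfolding n_def using least_power_of_permutation[OF perm] by auto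
  define cs where "cs = map (\<lambda>k. (\<pi> ^^ k) i0) [0..<n]"
  have dcs: "distinct cs" unfolding cs_def n_def by (rule cycle_of_permutation[OF perm])
  have cs: "length cs = n" "\<And>k. k < n \<Longrightarrow> cs ! k = (\<pi> ^^ k) i0" by (auto simp: cs_def)
  have cst: "set cs \<subseteq> {1..t}"
    unfolding cs_def using permutes_in_image[OF permutes_funpow[OF \<pi>]] i0(1) by auto
  have nxt: "(cs @ [i0]) ! Suc k = \<pi> (cs ! k)" if "k < n" for k
    using that n cs by (cases "Suc k < n") (auto simp: nth_append dest: not_less_eq[THEN iffD1] simp: less_Suc_eq)
  define w where "w = map (\<lambda>i. (i, \<mu> i)) cs"
  have fw: "map fst w = cs" by (simp add: w_def comp_def)
  have hw: "fst (hd w) = i0" "w \<noteq> []" using n by (auto simp: w_def cs_def hd_map)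
  have cw: "closed_walk w"
    unfolding closed_walk_def hw(1)
  proof (rule walkI)
    fix k assume "k < length w"
    hence k: "k < n" using cs by (simp add: w_def)
    have "cs ! k \<in> {1..t}" using cst k cs(1) nth_mem by blast
    thus "fst (w ! k) \<in> {1..t} \<and> snd (w ! k) \<in> L (fst (w ! k)) (\<sigma>0 ((map fst w @ [i0]) ! Suc k))"
      unfolding fw nxt[OF k] using \<sigma>(2)[of "cs ! k"] \<sigma>\<pi> k cs(1) by (simp add: w_def)
  qed
  have dw: "distinct (map fst w)" using fw dcs by simp
  obtain g where g: "g \<in> perm_sums t L"
    "\<And>v. int (Poly_Mapping.lookup g v) = int (Poly_Mapping.lookup (\<Sum>i\<in>{1..t}. \<mu>0 i) v) + sum_list (map (change v) w)"
    "weight W a g = A + wchange w"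
    "\<And>v p. p \<in> set w \<Longrightarrow> Poly_Mapping.lookup (snd p) v \<le> Poly_Mapping.lookup g v"
    using simple_closed_walk[OF cw dw hw(2)] by blast
  let ?\<kappa> = "cycle_of_list cs"
  have \<kappa>: "?\<kappa> permutes set cs" by (rule cycle_permutes)
  have \<kappa>\<pi>: "?\<kappa> i = \<pi> i" if "i \<in> set cs" for i
  proof -
    have "\<exists>k<length cs. cs ! k = i" using that by (simp only: in_set_conv_nth)
    then obtain k where k: "k < n" "i = cs ! k" unfolding cs(1) by blast
    have "map ?\<kappa> cs = rotate1 cs" using cyclic_rotation[OF dcs, of 1] by simp
    hence "?\<kappa> i = rotate1 cs ! k" using k cs(1) by (metis nth_map)
    also have "rotate1 cs ! k = (cs @ [i0]) ! Suc k" using hw fw by (cases w) auto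
    finally show ?thesis using nxt[OF k(1)] k by simp
  qed
  \<comment> \<open>\<open>\<beta>\<close> is \<open>\<pi>\<close> without that cycle. It yields a
    complementary point \<open>g'\<close>, for which \<open>g + g'\<close> is the base point plus
    \<open>f\<close>.\<close>
  define \<beta> where "\<beta> = inv ?\<kappa> \<circ> \<pi>"
  have \<beta>: "\<beta> permutes {1..t}"
    unfolding \<beta>_def by (intro permutes_compose \<pi> permutes_subset[OF permutes_inv[OF \<kappa>]] cst)
  have \<beta>1: "\<beta> i = i" if "i \<in> set cs" for i
    unfolding \<beta>_def using \<kappa>\<pi>[OF that, symmetric] permutes_inverses(2)[OF \<kappa>] by simp
  have \<beta>2: "\<beta> i = \<pi> i" if "i \<notin> set cs" for i
  proof -
    have "\<pi> i \<notin> set cs"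
    proof
      assume "\<pi> i \<in> set cs"
      then obtain j where "j \<in> set cs" "?\<kappa> j = \<pi> i" using permutes_image[OF \<kappa>] by (metis imageE)
      hence "\<pi> j = \<pi> i" using \<kappa>\<pi> by simp
      hence "j = i" using permutes_inj[OF \<pi>] by (simp add: inj_eq)
      thus False using that \<open>j \<in> set cs\<close> by simp
    qed
    thus ?thesis unfolding \<beta>_def using permutes_not_in[OF permutes_inv[OF \<kappa>]] by simp
  qed
  define \<nu> where "\<nu> i = (if i \<in> set cs then \<mu>0 i else \<mu> i)" for i
  define g' where "g' = (\<Sum>i\<in>{1..t}. \<nu> i)"
  have "\<sigma>0 \<circ> \<beta> permutes {1..t}" by (intro permutes_compose \<beta> \<sigma>0)
  moreover have "\<nu> i \<in> L i ((\<sigma>0 \<circ> \<beta>) i)" if "i \<in> {1..t}" for i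
    using that \<beta>1 \<beta>2 \<mu>0 \<sigma>(2) \<sigma>\<pi> by (simp add: \<nu>_def)
  ultimately have g'F: "g' \<in> perm_sums t L" unfolding g'_def perm_sums_def by blast
  have chg: "sum_list (map (change v) w) = (\<Sum>i\<in>set cs. int (Poly_Mapping.lookup (\<mu> i) v) - int (Poly_Mapping.lookup (\<mu>0 i) v))" for v
    unfolding w_def using dcs by (simp add: comp_def change_def sum.distinct_set_conv_list)
  have g': "int (Poly_Mapping.lookup g' v) = int (Poly_Mapping.lookup f v) - sum_list (map (change v) w)" for v
  proof -
    have "int (Poly_Mapping.lookup f v) - int (Poly_Mapping.lookup g' v)
        = (\<Sum>i\<in>{1..t}. int (Poly_Mapping.lookup (\<mu> i) v) - int (Poly_Mapping.lookup (\<nu> i) v))"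
      unfolding g'_def \<sigma>(3) by (simp add: lookup_sum sum_subtractf)
    also have "\<dots> = (\<Sum>i\<in>set cs. int (Poly_Mapping.lookup (\<mu> i) v) - int (Poly_Mapping.lookup (\<nu> i) v))"
      using cst by (intro sum.mono_neutral_right) (auto simp: \<nu>_def)
    also have "\<dots> = sum_list (map (change v) w)"
      unfolding chg by (intro sum.cong) (auto simp: \<nu>_def)
    finally show ?thesis by simp
  qed
  have "weight W a g' = weight W a f - (\<Sum>v\<in>W. a v * sum_list (map (change v) w))"
    unfolding weight_def g' by (simp add: algebra_simps sum_subtractf)
  also have "(\<Sum>v\<in>W. a v * sum_list (map (change v) w)) = wchange w"
    unfolding wchange_def by (induction w) (auto simp: algebra_simps sum.distrib)
  finally have w': "weight W a g' = A - wchange w" using f(2) by simp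
  \<comment> \<open>The points \<open>g\<close> and \<open>g'\<close> have weights
    \<open>A + wchange w\<close> and \<open>A - wchange w\<close>, and neither may exceed
    \<open>A\<close>.\<close>
  have wc: "wchange w = 0" using weight_le[OF g'F] w' weight_le[OF g(1)] g(3) by simp
  obtain N1 where N1: "matching_shape m d var g N1" using face[OF g(1)] g(3) wc by auto
  obtain N2 where N2: "matching_shape m d var g' N2" using face[OF g'F] w' wc by auto
  have sub: "N1 \<subseteq> N \<union> base_matching m"
  proof
    fix e assume e: "e \<in> N1"
    hence ev: "e \<in> vpairs m" using N1 by (auto simp: matching_shape_def perfect_matching_def)
    have "int (Poly_Mapping.lookup g (var e)) + int (Poly_Mapping.lookup g' (var e)) =
       int (Poly_Mapping.lookup (\<Sum>i\<in>{1..t}. \<mu>0 i) (var e)) + int (Poly_Mapping.lookup f (var e))"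
      using g(2) g' by simp
    thus "e \<in> N \<union> base_matching m"
      using e ev N1 N2 base_shape f(3) d unfolding matching_shape_def by (auto split: if_splits)
  qed
  \<comment> \<open>No label of the tour contains this edge, whereas row \<open>i0\<close> gives it
    up, so its exponent strictly drops.\<close>
  have "?e0 \<notin> N1"
  proof
    assume "?e0 \<in> N1"
    hence "int (Poly_Mapping.lookup g (var ?e0)) = int d" using N1 e0 by (auto simp: matching_shape_def)
    moreover have "int (Poly_Mapping.lookup (\<Sum>i\<in>{1..t}. \<mu>0 i) (var ?e0)) = int d"
      using base_shape e0 by (auto simp: matching_shape_def)
    ultimately have "sum_list (map (change (var ?e0)) w) = 0" using g(2)[of "var ?e0"] by simp
    moreover have "sum_list (map (change (var ?e0)) w) < 0"
      unfolding chg
    proof (rule order.strict_trans2)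
      have z: "Poly_Mapping.lookup (\<mu> i) (var ?e0) = 0" if "i \<in> {1..t}" for i
      proof -
        have "(\<Sum>i\<in>{1..t}. Poly_Mapping.lookup (\<mu> i) (var ?e0)) = 0"
          using f(3) e0N e0(2) unfolding \<sigma>(3) matching_shape_def lookup_sum by auto
        thus ?thesis using that by auto
      qed
      show "(\<Sum>i\<in>set cs. int (Poly_Mapping.lookup (\<mu> i) (var ?e0)) - int (Poly_Mapping.lookup (\<mu>0 i) (var ?e0))) < (\<Sum>i\<in>set cs. 0)"
      proof (rule sum_strict_mono_ex1)
        have "i0 \<in> set cs" using hw fw by (metis list.map_disc_iff hd_in_set hd_map)
        thus "\<exists>i\<in>set cs. int (Poly_Mapping.lookup (\<mu> i) (var ?e0)) - int (Poly_Mapping.lookup (\<mu>0 i) (var ?e0)) < 0"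
          using z i0 by (intro bexI[of _ i0]) auto
      qed (use z cst in auto)
    qed simp
    ultimately show False by simp
  qed
  hence "N1 = N"
    using perfect_matching_in_tour_union[OF T(1) m(1), of N1] N1 sub T unfolding matching_shape_def by simp
  show ?thesis
  proof (rule that[OF hw(2) cw dw hw(1) wc])
    fix e assume "e \<in> vpairs m"
    thus "height w e = (if e \<in> N then int d else 0) - (if e \<in> base_matching m then int d else 0)"
      using g(2)[of "var e"] N1 base_shape \<open>N1 = N\<close> unfolding matching_shape_def height_def by auto
  next
    fix p e assume "p \<in> set w" "e \<in> vpairs m - N"
    thus "Poly_Mapping.lookup (snd p) (var e) = 0"
      using g(4)[of p "var e"] N1 \<open>N1 = N\<close> unfolding matching_shape_def by auto
  qed
qed

text \<open>A label is 0 or a single variable, so the number of touched tour edges grows by at most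
  1 per step and hits \<open>m div 2\<close> exactly. As rows are distinct, a part of the walk takes
  from a base edge at most its total exponent \<open>d\<close>.\<close>

lemma target_split:
  assumes N: "N \<in> target_matchings m"
  obtains w1 w2 where "closed_walk (w1 @ w2)" "w1 \<noteq> []" "w2 \<noteq> []" "fst (hd w1) = i0" "wchange (w1 @ w2) = 0"
    "fst (hd w2) \<in> {1..t}"
    "\<And>e. e \<in> vpairs m \<Longrightarrow> height (w1 @ w2) e = (if e \<in> N then int d else 0) - (if e \<in> base_matching m then int d else 0)"
    "card {e \<in> N. 1 \<le> height w1 e} = m div 2"
    "\<And>e. e \<in> base_matching m \<Longrightarrow> - int d \<le> height w1 e \<and> height w1 e \<le> 0"
    "\<And>e. e \<in> vpairs m - (N \<union> base_matching m) \<Longrightarrow> height w1 e = 0"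
proof -
  obtain w where w: "w \<noteq> []" "closed_walk w" "distinct (map fst w)" "fst (hd w) = i0" "wchange w = 0"
    "\<And>e. e \<in> vpairs m \<Longrightarrow> height w e = (if e \<in> N then int d else 0) - (if e \<in> base_matching m then int d else 0)"
    "\<And>p e. p \<in> set w \<Longrightarrow> e \<in> vpairs m - N \<Longrightarrow> Poly_Mapping.lookup (snd p) (var e) = 0"
    using target_walk[OF N] by blast
  obtain T where T: "tour m T" "N = tour_edges T" using N by (auto simp: target_matchings_def)
  have pN: "perfect_matching m N" using perfect_matching_tour[OF T(1) m(1)] T(2) by simp
  have dis: "N \<inter> base_matching m = {}" using tour_edges_base_disjoint[OF T(1) m(1)] T(2) by simp
  have Nv: "N \<subseteq> vpairs m" "finite N"
    using pN finite_subset[OF _ finite_vpairs] by (auto simp: perfect_matching_def)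
  have bv: "base_matching m \<subseteq> vpairs m" using perfect_matching_base by (auto simp: perfect_matching_def)
  have rows: "fst p \<in> {1..t}" "\<exists>j. snd p \<in> L (fst p) j" if "p \<in> set w" for p
    using walk_nth[OF w(2)[unfolded closed_walk_def]] that by (auto simp: in_set_conv_nth)
  define c where "c k = card {e \<in> N. 1 \<le> height (take k w) e}" for k
  have c0: "c 0 = 0" by (simp add: c_def height_def)
  have cl: "c (length w) = m"
  proof -
    have "1 \<le> height w e" if "e \<in> N" for e
    proof -
      have "e \<in> vpairs m" "e \<notin> base_matching m" using that Nv dis by auto
      thus ?thesis using w(6)[of e] that d by simp
    qed
    hence "{e \<in> N. 1 \<le> height w e} = N" by blast
    thus ?thesis using perfect_matching_card[OF pN] by (simp add: c_def)
  qed
  have step: "c (Suc k) \<le> c k + 1" if k: "k < length w" for k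
  proof -
    let ?p = "w ! k"
    let ?I = "{e \<in> N. Poly_Mapping.lookup (snd ?p) (var e) \<noteq> 0}"
    have p: "?p \<in> set w" using k by simp
    have hs: "height (take (Suc k) w) e = height (take k w) e + int (Poly_Mapping.lookup (snd ?p) (var e))" if "e \<in> N" for e
    proof -
      have "e \<notin> base_matching m" "e \<in> vpairs m" using that dis Nv by auto
      hence "Poly_Mapping.lookup (\<mu>0 (fst ?p)) (var e) = 0"
        using base_row_le[OF rows(1)[OF p], of e] by simp
      thus ?thesis by (simp add: take_Suc_conv_app_nth[OF k] height_def change_def)
    qed
    have "{e \<in> N. 1 \<le> height (take (Suc k) w) e} \<subseteq> {e \<in> N. 1 \<le> height (take k w) e} \<union> ?I"
      using hs by fastforce
    hence "c (Suc k) \<le> card ({e \<in> N. 1 \<le> height (take k w) e} \<union> ?I)"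
      unfolding c_def using Nv(2) by (intro card_mono) auto
    also have "\<dots> \<le> c k + card ?I" unfolding c_def by (rule card_Un_le)
    also have "card ?I \<le> 1"
    proof -
      obtain j where "snd ?p \<in> L (fst ?p) j" using rows(2)[OF p] by blast
      then consider "snd ?p = 0" | v where "snd ?p = Poly_Mapping.single v 1" using label by blast
      hence "\<exists>e. ?I \<subseteq> {e}"
      proof cases
        case (2 v)
        have "e = e'" if "e \<in> ?I" "e' \<in> ?I" for e e'
          using that var_inj Nv unfolding 2 by (auto simp: lookup_single when_def inj_on_def split: if_splits)
        thus ?thesis by (cases "?I = {}") blast+
      qed simp
      then obtain e where "?I \<subseteq> {e}" by blast
      thus ?thesis using card_mono[of "{e}" ?I] by simp
    qed
    finally show ?thesis by simp
  qed
  define k where "k = (LEAST k. m div 2 \<le> c k)"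
  have k1: "m div 2 \<le> c k" unfolding k_def by (rule LeastI[of _ "length w"]) (simp add: cl)
  have kl: "k \<le> length w" unfolding k_def by (rule Least_le) (simp add: cl)
  \<comment> \<open>Both parts of the cut are nonempty because 0 < m div 2 < m.\<close>
  have k0: "k \<noteq> 0" using k1 c0 m by (cases "k = 0") auto
  then obtain k' where k': "k = Suc k'" by (cases k) auto
  have "\<not> m div 2 \<le> c k'" using not_less_Least[of k' "\<lambda>k. m div 2 \<le> c k"] k' unfolding k_def by simp
  hence ck: "c k = m div 2" using step[of k'] k1 kl k' by simp
  have kl': "k < length w" using kl ck cl m by (cases "k = length w") auto
  have wk: "take k w @ drop k w = w" by simp
  show ?thesis
  proof (rule that[of "take k w" "drop k w", unfolded wk])
    show "closed_walk w" "wchange w = 0" by fact+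
    show "take k w \<noteq> []" "drop k w \<noteq> []" "fst (hd (take k w)) = i0" using k0 kl' w(1,4) by auto
    show "fst (hd (drop k w)) \<in> {1..t}" using rows(1)[of "w ! k"] kl' by (simp add: hd_drop_conv_nth)
    show "card {e \<in> N. 1 \<le> height (take k w) e} = m div 2" using ck by (simp add: c_def)
    show "height w e = (if e \<in> N then int d else 0) - (if e \<in> base_matching m then int d else 0)" if "e \<in> vpairs m" for e
      by (rule w(6)[OF that])
  next
    fix e assume e: "e \<in> base_matching m"
    hence ev: "e \<in> vpairs m - N" using dis bv by auto
    have tw: "p \<in> set w" if "p \<in> set (take k w)" for p using that by (rule in_set_takeD)
    have "height (take k w) e = sum_list (map (\<lambda>p. - int (Poly_Mapping.lookup (\<mu>0 (fst p)) (var e))) (take k w))"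
      unfolding height_def using w(7)[OF tw ev] by (intro arg_cong[of _ _ sum_list] map_cong) (auto simp: change_def)
    also have "\<dots> = (\<Sum>i\<in>fst ` set (take k w). - int (Poly_Mapping.lookup (\<mu>0 i) (var e)))"
      using distinct_take[OF w(3), of k]
      by (subst sum.reindex) (simp_all add: take_map distinct_map sum.distinct_set_conv_list comp_def)
    also have "\<dots> = - int (\<Sum>i\<in>fst ` set (take k w). Poly_Mapping.lookup (\<mu>0 i) (var e))"
      by (simp add: sum_negf)
    finally have h: "height (take k w) e = - int (\<Sum>i\<in>fst ` set (take k w). Poly_Mapping.lookup (\<mu>0 i) (var e))" .
    have "fst ` set (take k w) \<subseteq> {1..t}" using rows(1) tw by (metis image_subsetI)
    hence "(\<Sum>i\<in>fst ` set (take k w). Poly_Mapping.lookup (\<mu>0 i) (var e)) \<le> (\<Sum>i\<in>{1..t}. Poly_Mapping.lookup (\<mu>0 i) (var e))"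
      by (intro sum_mono2) auto
    also have "\<dots> = d" using base_shape e ev unfolding matching_shape_def by (auto simp flip: lookup_sum)
    finally show "- int d \<le> height (take k w) e \<and> height (take k w) e \<le> 0"
      unfolding h by (simp only: neg_le_iff_le of_nat_le_iff neg_le_0_iff_le of_nat_0_le_iff simp_thms)
  next
    fix e assume e: "e \<in> vpairs m - (N \<union> base_matching m)"
    have "height (take k w) e = sum_list (map (\<lambda>p. 0) (take k w))"
      unfolding height_def
    proof (intro arg_cong[of _ _ sum_list] map_cong refl)
      fix p assume "p \<in> set (take k w)"
      hence p: "p \<in> set w" by (rule in_set_takeD)
      show "change (var e) p = 0"
        using w(7)[OF p, of e] base_row_le[OF rows(1)[OF p], of e] e by (simp add: change_def)
    qed
    thus "height (take k w) e = 0" by simp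
  qed
qed

text \<open>The walks share their first row and the row of the cut, so exchanging second parts gives
  two closed walks. Their weight changes are \<le> 0 and add up to 0, so both vanish and
  \<open>closed_walk_ge\<close> applies.\<close>

lemma splice_ge:
  assumes N: "N2 \<subseteq> vpairs m"
    and w1: "closed_walk (w1 @ w1')" "w1 \<noteq> []" "w1' \<noteq> []" "fst (hd w1) = i0" "wchange (w1 @ w1') = 0"
    and w2: "closed_walk (w2 @ w2')" "w2 \<noteq> []" "w2' \<noteq> []" "fst (hd w2) = i0" "wchange (w2 @ w2') = 0"
      "\<And>e. e \<in> vpairs m \<Longrightarrow> height (w2 @ w2') e = (if e \<in> N2 then int d else 0) - (if e \<in> base_matching m then int d else 0)"
    and eq: "fst (hd w1') = fst (hd w2')"
    and X: "X \<subseteq> vpairs m"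
      "\<And>N. perfect_matching m N \<Longrightarrow> card (base_matching m \<inter> X) \<le> card (N \<inter> X)"
  shows "0 \<le> (\<Sum>e\<in>X. height w1 e - height w2 e) + int d * (int (card (N2 \<inter> X)) - int (card (base_matching m \<inter> X)))"
proof -
  have cl: "closed_walk (w1 @ w2')" "closed_walk (w2 @ w1')"
    using w1 w2 eq unfolding closed_walk_def walk_append by auto
  have app: "wchange (x @ y) = wchange x + wchange y" for x y by (simp add: wchange_def)
  have happ: "height (x @ y) e = height x e + height y e" for x y e by (simp add: height_def)
  have "wchange (w1 @ w2') = 0"
    using closed_walk_wchange_le[OF cl(1)] closed_walk_wchange_le[OF cl(2)] w1(5) w2(5) unfolding app by linarith
  from closed_walk_ge[OF cl(1) this X] have "0 \<le> (\<Sum>e\<in>X. height (w1 @ w2') e)" by simp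
  also have "\<dots> = (\<Sum>e\<in>X. (height w1 e - height w2 e) + ((if e \<in> N2 then int d else 0) - (if e \<in> base_matching m then int d else 0)))"
  proof (intro sum.cong refl)
    fix e assume "e \<in> X"
    hence "e \<in> vpairs m" using X(1) by auto
    thus "height (w1 @ w2') e = height w1 e - height w2 e + ((if e \<in> N2 then int d else 0) - (if e \<in> base_matching m then int d else 0))"
      using w2(6)[of e] unfolding happ by linarith
  qed
  also have "\<dots> = (\<Sum>e\<in>X. height w1 e - height w2 e) + int d * (int (card (N2 \<inter> X)) - int (card (base_matching m \<inter> X)))"
  proof -
    have "finite X" using X(1) finite_vpairs finite_subset by blast
    hence "(\<Sum>e\<in>X. if e \<in> M then int d else 0) = int d * int (card (M \<inter> X))" for M
      by (simp add: sum.If_cases Int_commute)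
    thus ?thesis by (simp add: sum.distrib sum_subtractf algebra_simps)
  qed
  finally show ?thesis .
qed

lemma class_data_base:
  "\<exists>y h. class_data m t d y h"
proof -
  define P where "P N w1 w2 \<longleftrightarrow> closed_walk (w1 @ w2) \<and> w1 \<noteq> [] \<and> w2 \<noteq> [] \<and> fst (hd w1) = i0 \<and> wchange (w1 @ w2) = 0 \<and>
    fst (hd w2) \<in> {1..t} \<and>
    (\<forall>e\<in>vpairs m. height (w1 @ w2) e = (if e \<in> N then int d else 0) - (if e \<in> base_matching m then int d else 0)) \<and>
    card {e \<in> N. 1 \<le> height w1 e} = m div 2 \<and>
    (\<forall>e\<in>base_matching m. - int d \<le> height w1 e \<and> height w1 e \<le> 0) \<and>
    (\<forall>e\<in>vpairs m - (N \<union> base_matching m). height w1 e = 0)" for N w1 w2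
  have "\<exists>w1 w2. P N w1 w2" if "N \<in> target_matchings m" for N
  proof (rule target_split[OF that], goal_cases)
    case (1 w1 w2)
    hence "P N w1 w2" unfolding P_def by (intro conjI ballI; blast)
    thus ?case by blast
  qed
  then obtain F1 F2 where F: "\<And>N. N \<in> target_matchings m \<Longrightarrow> P N (F1 N) (F2 N)" by metis
  show ?thesis
    unfolding class_data_def
  proof (intro exI[of _ "\<lambda>N. fst (hd (F2 N))"] exI[of _ "\<lambda>N. height (F1 N)"] conjI allI impI ballI)
    fix N1 N2 X
    assume *: "N1 \<in> target_matchings m" "N2 \<in> target_matchings m" "fst (hd (F2 N1)) = fst (hd (F2 N2))" "X \<subseteq> vpairs m"
      "\<forall>N. perfect_matching m N \<longrightarrow> card (base_matching m \<inter> X) \<le> card (N \<inter> X)"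
    have "N2 \<subseteq> vpairs m"
      using *(2) perfect_matching_tour[OF _ m(1)] by (auto simp: target_matchings_def perfect_matching_def)
    from splice_ge[OF this, of "F1 N1" "F2 N1" "F1 N2" "F2 N2" X]
    show "0 \<le> (\<Sum>e\<in>X. height (F1 N1) e - height (F1 N2) e) + int d * (int (card (N2 \<inter> X)) - int (card (base_matching m \<inter> X)))"
      using F[OF *(1)] F[OF *(2)] * unfolding P_def by blast
  qed (use F in \<open>unfold P_def, blast+\<close>)
qed

end

lemma (in matching_face) class_data_exists: "\<exists>y h. class_data m t d y h"
proof -
  obtain f where f: "f \<in> perm_sums t L" "weight W a f = A" "matching_shape m d var f (base_matching m)"
    using realize by auto
  then obtain \<sigma>0 \<mu>0 where \<sigma>0: "\<sigma>0 permutes {1..t}" "\<And>i. i \<in> {1..t} \<Longrightarrow> \<mu>0 i \<in> L i (\<sigma>0 i)" "f = (\<Sum>i\<in>{1..t}. \<mu>0 i)"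
    unfolding perm_sums_def by blast
  let ?e0 = "{(0, True), flip (0, True)}"
  have "(0, True) \<in> verts m" using m by (simp add: verts_def)
  hence "?e0 \<in> base_matching m" "?e0 \<in> vpairs m" by (auto simp: base_matching_def)
  hence "(\<Sum>i\<in>{1..t}. Poly_Mapping.lookup (\<mu>0 i) (var ?e0)) = d"
    using f(3) unfolding \<sigma>0(3) matching_shape_def lookup_sum by auto
  hence "\<exists>i\<in>{1..t}. Poly_Mapping.lookup (\<mu>0 i) (var ?e0) \<noteq> 0" using d by (intro ccontr[of "\<exists>i\<in>_. _ i"]) simp
  then obtain i0 where i0: "i0 \<in> {1..t}" "Poly_Mapping.lookup (\<mu>0 i0) (var ?e0) > 0" by auto
  have "matching_face_base t m d L var W a A \<sigma>0 \<mu>0 i0"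
  proof (rule matching_face_base.intro[OF matching_face_axioms], rule matching_face_base_axioms.intro)
    show "weight W a (\<Sum>i\<in>{1..t}. \<mu>0 i) = A" using f(2) unfolding \<sigma>0(3) .
    show "matching_shape m d var (\<Sum>i\<in>{1..t}. \<mu>0 i) (base_matching m)" using f(3) unfolding \<sigma>0(3) .
    show "\<sigma>0 permutes {1..t}" by (rule \<sigma>0(1))
    show "\<mu>0 i \<in> L i (\<sigma>0 i)" if "i \<in> {1..t}" for i using that by (rule \<sigma>0(2))
    show "i0 \<in> {1..t}" "Poly_Mapping.lookup (\<mu>0 i0) (var ?e0) > 0" by (rule i0)+
  qed
  thus ?thesis by (rule matching_face_base.class_data_base)
qed

section \<open>Tours sharing a splitting row\<close>

lemma path_edges_sub: "path_edges xs \<subseteq> path_edges (as @ xs @ bs)"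
proof -
  have c: "path_edges ys \<subseteq> path_edges (y # ys)" for y ys by (cases ys) auto
  have 1: "path_edges ys \<subseteq> path_edges (as @ ys)" for ys
  proof (induction as)
    case (Cons a as)
    thus ?case using c[of "as @ ys" a] by simp
  qed simp
  have 2: "path_edges xs \<subseteq> path_edges (xs @ bs)"
    by (induction xs rule: path_edges.induct) auto
  from 2 1[of "xs @ bs"] show ?thesis by (rule subset_trans)
qed

lemma tour_edges_rev:
  assumes "T \<noteq> []" shows "tour_edges (rev (map flip T)) = tour_edges T"
  using assms tour_edges_snoc[of T] tour_edges_snoc[of "rev (map flip T)"] path_edges_rev[of T]
  by (simp add: hd_rev last_rev hd_map last_map insert_commute)

lemma tour_rev: "tour m (rev (map flip T)) \<longleftrightarrow> tour m T"
proof -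
  have [simp]: "fst \<circ> flip = fst" by (auto simp: flip_def)
  show ?thesis by (simp add: tour_def rev_map[symmetric] image_image)
qed

section \<open>Odd cuts around an interval of a tour\<close>

definition block :: "(nat \<times> bool) list \<Rightarrow> (nat \<times> bool) set" where
  "block I = fst ` set I \<times> UNIV"

lemma block_iff: "u \<in> block I \<longleftrightarrow> fst u \<in> fst ` set I"
  by (auto simp: block_def mem_Times_iff)

lemma block_rev: "block (rev (map flip I)) = block I"
  by (auto simp: block_def image_image)

text \<open>\<open>flip (last J)\<close> is the vertex from which the tour returns to
  \<open>hd I\<close>. Adding it to the block puts this edge inside the cut, and only the edge from
  \<open>I\<close> to \<open>J\<close> still crosses.\<close>

lemma cut_tour_edges:
  assumes T: "tour m (I @ J)" and ne: "I \<noteq> []" "J \<noteq> []"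
  shows "{e \<in> tour_edges (I @ J). crosses (insert (flip (last J)) (block I)) e} = {{flip (last I), hd J}}"
proof -
  let ?U = "insert (flip (last J)) (block I)"
  have dJ: "distinct (map fst J)" and IJ: "fst ` set I \<inter> fst ` set J = {}"
    using T by (auto simp: tour_def)
  have same: "x = y" if "x \<in> set J" "y \<in> set J" "fst x = fst y" for x y
    using that dJ by (simp add: distinct_map inj_on_def)
  have JI: "u \<notin> block I" if "x \<in> set J" "fst u = fst x" for u x
    using that IJ unfolding block_iff by auto
  have lJ: "last J \<in> set J" "hd J \<in> set J" using ne by auto
  have bl: "last J \<notin> set (butlast J)"
    using dJ ne by (cases J rule: rev_cases) (auto simp: distinct_map)
  have E: "tour_edges (I @ J) = path_edges I \<union> path_edges J \<union> {{flip (last I), hd J}, {flip (last J), hd I}}"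
  proof -
    have "path_edges (I @ J) = insert {flip (last I), hd J} (path_edges I \<union> path_edges J)"
      using path_edges_append[of I "hd J" "tl J"] path_edges_snoc2[of "butlast I" "last I" "hd J"] ne
      by (metis Un_insert_left append_butlast_last_id append_assoc append_Cons append_Nil list.collapse)
    thus ?thesis using tour_edges_snoc[of "I @ J"] ne by auto
  qed
  have "\<not> crosses ?U e" if "e \<in> path_edges I" for e
  proof -
    have "u \<in> block I" if "u \<in> e" for u
    proof -
      have "u \<in> flip ` set (butlast I) \<union> set (tl I)" using path_edges_verts[OF \<open>e \<in> path_edges I\<close> that] .
      thus ?thesis unfolding block_iff using ne(1)
        by (auto dest: in_set_butlastD list.set_sel(2) intro: rev_image_eqI)
    qed
    thus ?thesis by (auto simp: crosses_def)
  qed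
  moreover have "\<not> crosses ?U e" if "e \<in> path_edges J" for e
  proof -
    have "u \<notin> ?U" if "u \<in> e" for u
    proof -
      have "u \<in> flip ` set (butlast J) \<union> set (tl J)" using path_edges_verts[OF \<open>e \<in> path_edges J\<close> that] .
      then consider x where "x \<in> set (butlast J)" "u = flip x" | "u \<in> set (tl J)" by blast
      thus ?thesis
      proof cases
        case 1
        hence "x \<in> set J" by (simp add: in_set_butlastD)
        thus ?thesis using 1 bl JI[of x u] by auto
      next
        case 2
        hence "u \<in> set J" using ne(2) by (simp add: list.set_sel(2))
        moreover have "u \<noteq> flip (last J)"
        proof
          assume "u = flip (last J)"
          with same[OF \<open>u \<in> set J\<close> lJ(1)] show False by simp
        qed
        ultimately show ?thesis using JI[of u u] by simp
      qed
    qed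
    thus ?thesis unfolding crosses_def by blast
  qed
  moreover have "\<not> crosses ?U {flip (last J), hd I}"
    using ne by (auto simp: crosses_def block_iff)
  moreover have "crosses ?U {flip (last I), hd J}"
  proof -
    have "flip (last I) \<in> ?U" using ne by (simp add: block_iff)
    moreover have "hd J \<notin> ?U"
    proof -
      have "hd J \<noteq> flip (last J)"
      proof
        assume *: "hd J = flip (last J)"
        with same[OF lJ(2,1)] show False by simp
      qed
      thus ?thesis using JI[OF lJ(2)] by simp
    qed
    ultimately show ?thesis by (auto simp: crosses_def)
  qed
  ultimately show ?thesis unfolding E by blast
qed

text \<open>Mirror image of the preceding cut: reading the tour backwards exchanges the two edges
  between \<open>I\<close> and \<open>J\<close>.\<close>

lemma cut_tour_edges':
  assumes T: "tour m (I @ J)" and ne: "I \<noteq> []" "J \<noteq> []"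
  shows "{e \<in> tour_edges (I @ J). crosses (insert (hd J) (block I)) e} = {{flip (last J), hd I}}"
proof -
  let ?I = "rev (map flip I)" and ?J = "rev (map flip J)"
  have "tour_edges (?I @ ?J) = tour_edges (I @ J)"
    using tour_edges_rev[of "I @ J"] ne tour_edges_rotate[of ?I ?J] by simp
  moreover have "tour m (?I @ ?J)" using T tour_rev[of m "I @ J"] tour_rotate[of m ?I ?J] by simp
  ultimately show ?thesis
    using cut_tour_edges[of m ?I ?J] ne
    by (simp add: block_rev hd_rev last_rev hd_map last_map insert_commute)
qed

lemma cut_base_matching:
  assumes "fst a \<notin> fst ` set I" "a \<in> verts m"
  shows "{e \<in> base_matching m. crosses (insert a (block I)) e} = {{a, flip a}}"
proof
  have "crosses (insert a (block I)) {a, flip a}"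
    using assms(1) by (auto simp: crosses_def block_iff)
  thus "{{a, flip a}} \<subseteq> {e \<in> base_matching m. crosses (insert a (block I)) e}"
    using assms(2) by (auto simp: base_matching_def)
  show "{e \<in> base_matching m. crosses (insert a (block I)) e} \<subseteq> {{a, flip a}}"
  proof clarify
    fix e assume e: "e \<in> base_matching m" "crosses (insert a (block I)) e"
    then obtain u where u: "e = {u, flip u}" by (auto simp: base_matching_def)
    hence "u = a \<or> flip u = a" using e(2) by (auto simp: crosses_def block_iff)
    thus "e = {a, flip a}" using u by (auto simp: insert_commute)
  qed
qed

lemma card_block_odd:
  assumes "fst a \<notin> fst ` set I"
  shows "odd (card (insert a (block I)))"
proof -
  have "a \<notin> block I" using assms by (simp add: block_iff)
  moreover have "finite (block I)" unfolding block_def by simp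
  ultimately show ?thesis by (simp add: block_def card_cartesian_product)
qed

section \<open>Inequalities between tours with the same cut row\<close>

definition mate_edge :: "(nat \<times> bool) set set \<Rightarrow> nat \<times> bool \<Rightarrow> (nat \<times> bool) set" where
  "mate_edge N u = (THE e. e \<in> N \<and> u \<in> e)"

lemma mate_edge:
  assumes "perfect_matching m N" "u \<in> verts m"
  shows "mate_edge N u \<in> N" "u \<in> mate_edge N u"
  using theI'[of "\<lambda>e. e \<in> N \<and> u \<in> e"] assms unfolding mate_edge_def perfect_matching_def by auto

lemma mate_edge_eq:
  assumes "perfect_matching m N" "e \<in> N" "u \<in> e"
  shows "mate_edge N u = e"
  unfolding mate_edge_def using perfect_matching_unique[OF assms(1) _ assms(2) _ assms(3)] assms(2,3)
  by (intro the_equality) blast+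

locale tour_classes =
  fixes m t d :: nat and y h
  assumes m: "m \<ge> 2" "even m" and cd: "class_data m t d y h"
begin

lemma target_pm:
  assumes "N \<in> target_matchings m"
  shows "perfect_matching m N" "N \<inter> base_matching m = {}" "N \<subseteq> vpairs m"
proof -
  obtain T where T: "tour m T" "N = tour_edges T" using assms by (auto simp: target_matchings_def)
  show "perfect_matching m N" "N \<inter> base_matching m = {}"
    using perfect_matching_tour[OF T(1) m(1)] tour_edges_base_disjoint[OF T(1) m(1)] T(2) by simp_all
  thus "N \<subseteq> vpairs m" by (simp add: perfect_matching_def)
qed

lemma sum_h:
  assumes N: "N \<in> target_matchings m" and X: "X \<subseteq> vpairs m"
  shows "(\<Sum>e\<in>X. h N e) = (\<Sum>e\<in>N \<inter> X. h N e) + (\<Sum>e\<in>base_matching m \<inter> X. h N e)"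
proof -
  have fin: "finite X" using X finite_vpairs finite_subset by blast
  have "(\<Sum>e\<in>X. h N e) = (\<Sum>e\<in>(N \<inter> X) \<union> (base_matching m \<inter> X). h N e)"
    using cd N X fin unfolding class_data_def by (intro sum.mono_neutral_right) auto
  also have "\<dots> = (\<Sum>e\<in>N \<inter> X. h N e) + (\<Sum>e\<in>base_matching m \<inter> X. h N e)"
    using fin target_pm(2)[OF N] by (intro sum.union_disjoint) auto
  finally show ?thesis .
qed

text \<open>As the base matching meets \<open>X\<close> once, the minimality condition only says
  that every perfect matching meets \<open>X\<close>; as \<open>N2\<close> also meets it once, the
  terms with \<open>d\<close> cancel.\<close>

lemma splice:
  assumes "N1 \<in> target_matchings m" "N2 \<in> target_matchings m" "y N1 = y N2" "X \<subseteq> vpairs m"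
    "\<And>N. perfect_matching m N \<Longrightarrow> N \<inter> X \<noteq> {}"
    and 1: "N1 \<inter> X = {g1}" and 2: "N2 \<inter> X = {g2}" and b: "base_matching m \<inter> X = {b}"
  shows "h N2 g2 + h N2 b \<le> h N1 g1 + h N1 b"
proof -
  have "finite X" using assms(4) finite_vpairs finite_subset by blast
  hence "card (base_matching m \<inter> X) \<le> card (N \<inter> X)" if "perfect_matching m N" for N
    using assms(5)[OF that] b by (simp add: Suc_le_eq card_gt_0_iff)
  hence "0 \<le> (\<Sum>e\<in>X. h N1 e - h N2 e) + int d * (int (card (N2 \<inter> X)) - int (card (base_matching m \<inter> X)))"
    using cd assms(1-4) unfolding class_data_def by blast
  also have "\<dots> = (\<Sum>e\<in>X. h N1 e) - (\<Sum>e\<in>X. h N2 e)" using 2 b by (simp add: sum_subtractf)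
  finally show ?thesis using sum_h[OF assms(1,4)] sum_h[OF assms(2,4)] 1 2 b by simp
qed

text \<open>The star of \<open>v\<close> meets every perfect matching in exactly one edge, so
  splicing works in both orders and the two inequalities combine to an equality.\<close>

lemma vertex_balance:
  assumes N: "N1 \<in> target_matchings m" "N2 \<in> target_matchings m" "y N1 = y N2" and v: "v \<in> verts m"
  shows "h N1 (mate_edge N1 v) + h N1 {v, flip v} = h N2 (mate_edge N2 v) + h N2 {v, flip v}"
proof -
  let ?X = "{e \<in> vpairs m. v \<in> e}"
  have X: "N \<inter> ?X = {mate_edge N v}" if "perfect_matching m N" for N
    using mate_edge[OF that v] mate_edge_eq[OF that, of _ v] that unfolding perfect_matching_def by blast
  have b: "base_matching m \<inter> ?X = {{v, flip v}}"
    using X[OF perfect_matching_base] mate_edge_eq[OF perfect_matching_base, of "{v, flip v}" m v] v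
    by (simp add: base_matching_def)
  note X1 = X[OF target_pm(1)[OF N(1)]] and X2 = X[OF target_pm(1)[OF N(2)]]
  have "N \<inter> ?X \<noteq> {}" if "perfect_matching m N" for N using X[OF that] by simp
  from splice[OF N _ this X1 X2 b] splice[OF N(2,1) N(3)[symmetric] _ this X2 X1 b] show ?thesis by fastforce
qed

text \<open>Balance at \<open>flip v\<close> carries agreement from the base edge of
  \<open>v\<close> to the tour edge leaving it, and balance at the next entry carries it on to the
  next base edge.\<close>

lemma path_values:
  assumes N: "N1 \<in> target_matchings m" "N2 \<in> target_matchings m" "y N1 = y N2"
    and "path_edges (v # R) \<subseteq> N1 \<inter> N2" "set (v # R) \<subseteq> verts m" "h N1 {v, flip v} = h N2 {v, flip v}"
  shows "h N1 (mate_edge N1 (flip (last (v # R)))) = h N2 (mate_edge N2 (flip (last (v # R))))"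
  using assms(4-)
proof (induction R arbitrary: v)
  case Nil
  thus ?case using vertex_balance[OF N, of "flip v"] by (simp add: insert_commute)
next
  case (Cons x R)
  note pm = target_pm(1)[OF N(1)] target_pm(1)[OF N(2)]
  have e: "{flip v, x} \<in> N1" "{flip v, x} \<in> N2" using Cons.prems(1) by auto
  have m1: "mate_edge N1 (flip v) = {flip v, x}" "mate_edge N1 x = {flip v, x}"
    "mate_edge N2 (flip v) = {flip v, x}" "mate_edge N2 x = {flip v, x}"
    by (rule mate_edge_eq[OF pm(1) e(1)] mate_edge_eq[OF pm(2) e(2)], simp)+
  have "h N1 {flip v, x} = h N2 {flip v, x}"
    using vertex_balance[OF N, of "flip v"] Cons.prems m1 by (simp add: insert_commute)
  hence "h N1 {x, flip x} = h N2 {x, flip x}"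
    using vertex_balance[OF N, of x] Cons.prems m1 by simp
  thus ?case using Cons.IH[of x] Cons.prems by simp
qed

text \<open>The odd set \<open>U\<close> consists of the base edges met by the interval \<open>I\<close> and of the vertex \<open>a\<close>. Splicing the
  first part of \<open>N1\<close>, whose only edge across \<open>U\<close> is touched late, with the second part of \<open>N2\<close>, whose
  only edge across \<open>U\<close> is touched early, would give matchings that miss the cut.\<close>

lemma no_common_attachment:
  assumes N: "N1 \<in> target_matchings m" "N2 \<in> target_matchings m" "y N1 = y N2"
    and T1: "N1 = tour_edges (I @ J1 @ [flip a])" "tour m (I @ J1 @ [flip a])"
    and T2: "N2 = tour_edges (I @ a # J2)" "tour m (I @ a # J2)"
    and I: "I \<noteq> []"
    and l: "h N1 (mate_edge N1 (hd I)) \<ge> 1" "h N2 (mate_edge N2 (hd I)) \<ge> 1"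
    and r: "h N1 (mate_edge N1 (flip (last I))) < 1" "h N2 (mate_edge N2 (flip (last I))) < 1"
  shows False
proof -
  let ?U = "insert a (block I)"
  let ?X = "{e \<in> vpairs m. crosses ?U e}"
  note pm = target_pm(1)[OF N(1)] target_pm(1)[OF N(2)]
  have sub: "N1 \<subseteq> vpairs m" "N2 \<subseteq> vpairs m" using target_pm(3) N by auto
  have a: "a \<in> verts m" using tour_verts[OF T2(2)] by simp
  have aI: "fst a \<notin> fst ` set I" using T2(2) by (auto simp: tour_def)
  have U: "?U \<subseteq> verts m"
  proof -
    have "fst ` set I \<subseteq> {..<m}" using T2(2) by (auto simp: tour_def)
    thus ?thesis using a by (auto simp: block_def verts_def)
  qed
  have ne: "N \<inter> ?X \<noteq> {}" if "perfect_matching m N" for N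
    using perfect_matching_odd_cut[OF that U card_block_odd[OF aI]] that unfolding perfect_matching_def by blast
  have XN: "N \<inter> ?X = {e \<in> N. crosses ?U e}" if "N \<subseteq> vpairs m" for N using that by blast
  have X1: "N1 \<inter> ?X = {{flip (last I), hd (J1 @ [flip a])}}"
    unfolding XN[OF sub(1)] unfolding T1(1) using cut_tour_edges[OF T1(2) I] by simp
  hence g1: "mate_edge N1 (flip (last I)) = {flip (last I), hd (J1 @ [flip a])}"
    by (intro mate_edge_eq[OF pm(1)]) auto
  have X2: "N2 \<inter> ?X = {{flip (last (a # J2)), hd I}}"
    unfolding XN[OF sub(2)] unfolding T2(1) using cut_tour_edges'[OF T2(2) I] by simp
  hence f2: "mate_edge N2 (hd I) = {flip (last (a # J2)), hd I}"
    by (intro mate_edge_eq[OF pm(2)]) auto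
  have B: "base_matching m \<inter> ?X = {{a, flip a}}"
    using cut_base_matching[OF aI a] XN[of "base_matching m"] perfect_matching_base[of m]
    by (simp add: perfect_matching_def)
  have "h N2 (mate_edge N2 (hd I)) + h N2 {a, flip a} \<le> h N1 (mate_edge N1 (flip (last I))) + h N1 {a, flip a}"
    using splice[OF N _ ne X1 X2 B] unfolding f2 g1 by simp
  moreover have "mate_edge N1 a = mate_edge N1 (hd I)"
  proof -
    have "{a, hd I} \<in> N1" using tour_edges_snoc[of "I @ J1 @ [flip a]"] I T1(1) by auto
    thus ?thesis using mate_edge_eq[OF pm(1), of "{a, hd I}"] by auto
  qed
  moreover have "mate_edge N2 a = mate_edge N2 (flip (last I))"
  proof -
    have "path_edges (I @ a # J2) \<subseteq> N2" using tour_edges_snoc[of "I @ a # J2"] T2(1) by auto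
    moreover have "path_edges [last I, a] \<subseteq> path_edges (butlast I @ [last I, a] @ J2)" by (rule path_edges_sub)
    ultimately have "{flip (last I), a} \<in> N2" using I append_butlast_last_id[of I]
      by (metis append_Cons append_Nil append_assoc insert_subset path_edges.simps(1) subset_trans)
    thus ?thesis using mate_edge_eq[OF pm(2), of "{flip (last I), a}"] by auto
  qed
  \<comment> \<open>By \<open>l\<close> and \<open>r\<close>, the cut forces
    \<open>h N2 {a, flip a} < h N1 {a, flip a}\<close>, while balance at \<open>a\<close> forces the
    opposite strict inequality.\<close>
  ultimately show False using vertex_balance[OF N a] l r by simp
qed

end

section \<open>Counting all tours against a single class\<close>

lemma tours_count:
  assumes "m \<ge> 1"
  shows "2 ^ (m - 1) * fact (m - 1) \<le> card {T. tour m T \<and> hd T = (0, True)}"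
proof -
  let ?P = "permutations_of_set {1..<m}" and ?B = "{bs :: bool list. set bs \<subseteq> UNIV \<and> length bs = m - 1}"
  let ?F = "\<lambda>(ps, bs). (0::nat, True) # zip ps bs"
  have fin: "finite {T. tour m T \<and> hd T = (0, True)}"
  proof (rule finite_subset)
    show "{T. tour m T \<and> hd T = (0, True)} \<subseteq> {T. set T \<subseteq> verts m \<and> length T = m}"
      using tour_verts tour_length by blast
    show "finite {T. set T \<subseteq> verts m \<and> length T = m}" by (rule finite_lists_length_eq) simp
  qed
  have lenP: "length ps = m - 1" if "ps \<in> ?P" for ps
    using that length_finite_permutations_of_set by force
  have inj: "inj_on ?F (?P \<times> ?B)"
  proof (rule inj_onI)
    fix u w assume u: "u \<in> ?P \<times> ?B" and w: "w \<in> ?P \<times> ?B" and z: "?F u = ?F w"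
    have "length (fst u) = length (snd u)" "length (fst w) = length (snd w)" using u w lenP by auto
    moreover have "zip (fst u) (snd u) = zip (fst w) (snd w)" using z by (simp add: case_prod_beta)
    ultimately show "u = w" by (metis map_fst_zip map_snd_zip prod_eqI)
  qed
  have img: "?F ` (?P \<times> ?B) \<subseteq> {T. tour m T \<and> hd T = (0, True)}"
  proof (rule image_subsetI)
    fix u assume "u \<in> ?P \<times> ?B"
    then obtain ps bs where u: "u = (ps, bs)" and ps: "ps \<in> ?P" and l: "length bs = m - 1" by auto
    have "map fst (zip ps bs) = ps" using lenP[OF ps] l by simp
    hence f: "map fst ((0::nat, True) # zip ps bs) = 0 # ps" by simp
    have "distinct (0 # ps)" "set (0 # ps) = {..<m}"
      using ps assms by (auto dest: permutations_of_setD)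
    hence "tour m ((0, True) # zip ps bs)"
      unfolding tour_def f by (metis f list.set_map)
    thus "?F u \<in> {T. tour m T \<and> hd T = (0, True)}" by (simp add: u)
  qed
  have "card (?P \<times> ?B) = fact (m - 1) * 2 ^ (m - 1)"
    unfolding card_cartesian_product card_lists_length_eq[OF finite_UNIV] by simp
  moreover have "card (?P \<times> ?B) \<le> card {T. tour m T \<and> hd T = (0, True)}"
    using card_inj_on_le[OF inj img fin] .
  ultimately show ?thesis by (simp add: mult.commute)
qed

context tour_classes
begin

abbreviation E where "E T \<equiv> tour_edges T"

text \<open>Whether the tour edge leaving position \<open>k\<close> is touched before the
  cut.\<close>

definition colour :: "(nat \<times> bool) list \<Rightarrow> nat \<Rightarrow> bool" where
  "colour T k \<longleftrightarrow> 1 \<le> h (E T) (mate_edge (E T) (flip (T ! k)))"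

text \<open>The conclusion of \<open>cycle_lemma\<close> for a start at position 0.\<close>

definition balanced_from_start :: "(nat \<times> bool) list \<Rightarrow> bool" where
  "balanced_from_start T \<longleftrightarrow> (\<forall>r<m. m div 2 \<le> (\<Sum>k<r. of_bool (\<not> colour T k)) + (\<Sum>k=Suc r..<m. of_bool (colour T k)))"

text \<open>Fixing the value \<open>\<kappa>\<close> on the base edge of the start supplies the
  agreement from which \<open>path_values\<close> propagates.\<close>

definition tour_class :: "nat \<Rightarrow> nat \<times> bool \<Rightarrow> int \<Rightarrow> (nat \<times> bool) list set" where
  "tour_class z v \<kappa> = {xs. tour m (v # xs) \<and> E (v # xs) \<in> target_matchings m \<and> y (E (v # xs)) = z \<and>
     h (E (v # xs)) {v, flip v} = \<kappa> \<and> balanced_from_start (v # xs)}"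

lemma finite_tour_class: "finite (tour_class z v \<kappa>)"
proof (rule finite_subset)
  show "tour_class z v \<kappa> \<subseteq> {T. set T \<subseteq> verts m \<and> length T = m - 1}"
  proof
    fix xs assume "xs \<in> tour_class z v \<kappa>"
    hence "tour m (v # xs)" by (simp add: tour_class_def)
    thus "xs \<in> {T. set T \<subseteq> verts m \<and> length T = m - 1}" using tour_verts tour_length by force
  qed
  show "finite {T. set T \<subseteq> verts m \<and> length T = m - 1}" by (rule finite_lists_length_eq) simp
qed

lemma right_value:
  assumes xs: "R @ S \<in> tour_class z v \<kappa>" and xs': "R @ S' \<in> tour_class z v \<kappa>"
  defines "N \<equiv> E (v # R @ S)" and "N' \<equiv> E (v # R @ S')"
  shows "h N (mate_edge N (flip (last (v # R)))) = h N' (mate_edge N' (flip (last (v # R))))"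
proof (rule path_values)
  show "N \<in> target_matchings m" "N' \<in> target_matchings m" "y N = y N'" "h N {v, flip v} = h N' {v, flip v}"
    using xs xs' by (simp_all add: tour_class_def N_def N'_def)
  have "path_edges (v # R) \<subseteq> E (v # R @ U)" for U
    unfolding tour_edges_def using path_edges_sub[of "v # R" "[]" "U @ [v]"] by simp
  thus "path_edges (v # R) \<subseteq> N \<inter> N'" unfolding N_def N'_def by blast
  show "set (v # R) \<subseteq> verts m" using tour_verts[of m "v # R @ S"] xs by (auto simp: tour_class_def)
qed

text \<open>\<open>path_values\<close> run backwards: from \<open>flip v\<close> along the reversed
  and flipped list.\<close>

lemma left_value:
  assumes xs: "S @ L \<in> tour_class z v \<kappa>" and xs': "S' @ L \<in> tour_class z v \<kappa>"
  defines "N \<equiv> E (v # S @ L)" and "N' \<equiv> E (v # S' @ L)"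
  shows "h N (mate_edge N (hd (L @ [v]))) = h N' (mate_edge N' (hd (L @ [v])))"
proof -
  let ?R = "rev (map flip L)"
  have "h N (mate_edge N (flip (last (flip v # ?R)))) = h N' (mate_edge N' (flip (last (flip v # ?R))))"
  proof (rule path_values)
    show "N \<in> target_matchings m" "N' \<in> target_matchings m" "y N = y N'"
      "h N {flip v, flip (flip v)} = h N' {flip v, flip (flip v)}"
      using xs xs' by (simp_all add: tour_class_def N_def N'_def insert_commute)
    have "path_edges (flip v # ?R) = path_edges (L @ [v])"
      using path_edges_rev[of "L @ [v]"] by simp
    moreover have "path_edges (L @ [v]) \<subseteq> E (v # U @ L)" for U
      unfolding tour_edges_def using path_edges_sub[of "L @ [v]" "v # U" "[]"] by simp
    ultimately show "path_edges (flip v # ?R) \<subseteq> N \<inter> N'" unfolding N_def N'_def by blast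
    show "set (flip v # ?R) \<subseteq> verts m" using tour_verts[of m "v # S @ L"] xs by (auto simp: tour_class_def)
  qed
  moreover have "flip (last (flip v # ?R)) = hd (L @ [v])"
    by (cases L) (auto simp: last_rev)
  ultimately show ?thesis by simp
qed

text \<open>The interval grows around \<open>v\<close>: \<open>no_common_attachment\<close> supplies
  the exclusion in \<open>card_completions\<close>, and the balanced start supplies
  \<open>m div 2\<close> savings.\<close>

lemma card_tour_class: "card (tour_class z v \<kappa>) * 2 ^ (m div 2) \<le> 2 ^ (m - 1) * fact (m - 1)"
proof -
  let ?C = "tour_class z v \<kappa>"
  let ?N = "\<lambda>xs. E (v # xs)"
  \<comment> \<open>The colours must be functions of the list on one side. They are taken from some
    completion in the class; by \<open>right_value\<close> and \<open>left_value\<close> every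
    completion gives the same answer.\<close>
  define cR where "cR R \<longleftrightarrow> (\<exists>S. R @ S \<in> ?C \<and> 1 \<le> h (?N (R @ S)) (mate_edge (?N (R @ S)) (flip (last (v # R)))))" for R
  define cL where "cL L \<longleftrightarrow> (\<exists>S. S @ L \<in> ?C \<and> 1 \<le> h (?N (S @ L)) (mate_edge (?N (S @ L)) (hd (L @ [v]))))" for L
  have cR: "cR R \<longleftrightarrow> 1 \<le> h (?N (R @ S)) (mate_edge (?N (R @ S)) (flip (last (v # R))))" if "R @ S \<in> ?C" for R S
    unfolding cR_def using right_value[OF that] that by metis
  have cL: "cL L \<longleftrightarrow> 1 \<le> h (?N (S @ L)) (mate_edge (?N (S @ L)) (hd (L @ [v])))" if "S @ L \<in> ?C" for L S
    unfolding cL_def using left_value[OF that] that by metis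
  have Ct: "tour m (v # xs)" "E (v # xs) \<in> target_matchings m" "y (E (v # xs)) = z" "balanced_from_start (v # xs)"
    if "xs \<in> ?C" for xs using that by (auto simp: tour_class_def)
  have "card {xs \<in> ?C. \<exists>mid. xs = [] @ mid @ []} * 2 ^ (m div 2) \<le> 2 ^ (m - 1) * fact (m - 1) * 2 ^ (saveR cR [] + saveL cL [])"
  proof (rule card_completions)
    show "finite ?C" by (rule finite_tour_class)
    show "tour m (v # xs)" if "xs \<in> ?C" for xs using Ct(1)[OF that] .
    show "Suc (length [] + length [] + (m - 1)) = m" using m(1) by simp
  next
    fix R L a mid1 mid2
    assume c: "cL L" "\<not> cR R" and x1: "R @ mid1 @ flip a # L \<in> ?C" and x2: "R @ a # mid2 @ L \<in> ?C"
    let ?I = "L @ v # R"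
    have I: "hd ?I = hd (L @ [v])" "last ?I = last (v # R)" by (cases L; simp)+
    have r1: "E (v # R @ mid1 @ flip a # L) = E (?I @ mid1 @ [flip a])" "tour m (?I @ mid1 @ [flip a])"
      using tour_edges_rotate[of "v # R @ mid1 @ [flip a]" L] tour_rotate[of m "v # R @ mid1 @ [flip a]" L] Ct(1)[OF x1] by auto
    have r2: "E (v # R @ a # mid2 @ L) = E (?I @ a # mid2)" "tour m (?I @ a # mid2)"
      using tour_edges_rotate[of "v # R @ a # mid2" L] tour_rotate[of m "v # R @ a # mid2" L] Ct(1)[OF x2] by auto
    show False
    proof (rule no_common_attachment[of "?N (R @ mid1 @ flip a # L)" "?N (R @ a # mid2 @ L)", OF Ct(2)[OF x1] Ct(2)[OF x2] _ r1 r2])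
      show "y (E (v # R @ mid1 @ flip a # L)) = y (E (v # R @ a # mid2 @ L))" using Ct(3)[OF x1] Ct(3)[OF x2] by simp
      show "?I \<noteq> []" by simp
      show "1 \<le> h (E (v # R @ mid1 @ flip a # L)) (mate_edge (E (v # R @ mid1 @ flip a # L)) (hd ?I))"
        using cL[of "R @ mid1 @ [flip a]" L] x1 c(1) I(1) by simp
      show "1 \<le> h (E (v # R @ a # mid2 @ L)) (mate_edge (E (v # R @ a # mid2 @ L)) (hd ?I))"
        using cL[of "R @ a # mid2" L] x2 c(1) I(1) by simp
      show "h (E (v # R @ mid1 @ flip a # L)) (mate_edge (E (v # R @ mid1 @ flip a # L)) (flip (last ?I))) < 1"
        using cR[of R "mid1 @ flip a # L"] x1 c(2) I(2) by simp
      show "h (E (v # R @ a # mid2 @ L)) (mate_edge (E (v # R @ a # mid2 @ L)) (flip (last ?I))) < 1"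
        using cR[of R "a # mid2 @ L"] x2 c(2) I(2) by simp
    qed
  next
    fix R L assume x: "R @ L \<in> ?C"
    define xs where "xs = R @ L"
    define r where "r = length R"
    have len: "Suc (length R + length L) = m" using tour_length[OF Ct(1)[OF x]] by simp
    note pm = target_pm(1)[OF Ct(2)[OF x]]
    have R: "cR (take k R) \<longleftrightarrow> colour (v # xs) k" if "k < r" for k
    proof -
      have "take k R @ drop k R @ L \<in> ?C" using x by (simp flip: append_assoc)
      hence "cR (take k R) \<longleftrightarrow> 1 \<le> h (?N xs) (mate_edge (?N xs) (flip (last (v # take k R))))"
        using cR[of "take k R" "drop k R @ L"] by (simp add: xs_def flip: append_assoc)
      moreover have "last (v # take k R) = (v # xs) ! k"
        using that by (cases k) (auto simp: xs_def r_def take_Suc_conv_app_nth nth_append)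
      ultimately show ?thesis by (simp add: colour_def)
    qed
    \<comment> \<open>\<open>L ! k\<close> stands at position \<open>r + Suc k\<close>, and its edge
      enters the first vertex of the rest of \<open>L\<close>, or \<open>v\<close> at the end. The
      edge leaving position \<open>r\<close> closes the gap between \<open>R\<close> and
      \<open>L\<close> and is counted on neither side.\<close>
    have L: "cL (drop (Suc k) L) \<longleftrightarrow> colour (v # xs) (r + Suc k)" if k: "k < length L" for k
    proof -
      have split: "(R @ take (Suc k) L) @ drop (Suc k) L = xs" by (simp add: xs_def)
      hence "cL (drop (Suc k) L) \<longleftrightarrow> 1 \<le> h (?N xs) (mate_edge (?N xs) (hd (drop (Suc k) L @ [v])))"
        using cL[of "R @ take (Suc k) L" "drop (Suc k) L"] x by (simp add: xs_def)
      moreover have "mate_edge (?N xs) (hd (drop (Suc k) L @ [v])) = mate_edge (?N xs) (flip ((v # xs) ! (r + Suc k)))"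
      proof -
        let ?u = "(v # xs) ! (r + Suc k)" and ?w = "hd (drop (Suc k) L @ [v])"
        obtain w ws where W: "drop (Suc k) L @ [v] = w # ws" by (cases "drop (Suc k) L @ [v]") auto
        have "v # xs @ [v] = (v # R @ take k L) @ L ! k # drop (Suc k) L @ [v]"
          using id_take_nth_drop[OF k] by (simp add: xs_def)
        hence "E (v # xs) = path_edges ((v # R @ take k L) @ [L ! k, w] @ ws)"
          unfolding W by (simp add: tour_edges_def)
        hence e: "{flip (L ! k), ?w} \<in> E (v # xs)"
          using path_edges_sub[of "[L ! k, w]" "v # R @ take k L" ws] W by simp
        have "?u = L ! k" by (simp add: xs_def r_def nth_append)
        thus ?thesis using mate_edge_eq[OF pm, folded xs_def, OF e] by simp
      qed
      ultimately show ?thesis by (simp add: colour_def)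
    qed
    have "r < m" using len r_def by simp
    hence "m div 2 \<le> (\<Sum>k<r. of_bool (\<not> colour (v # xs) k)) + (\<Sum>k=Suc r..<m. of_bool (colour (v # xs) k))"
      using Ct(4)[OF x] unfolding balanced_from_start_def xs_def by blast
    also have "(\<Sum>k<r. of_bool (\<not> colour (v # xs) k)) = saveR cR R"
      unfolding saveR_def r_def[symmetric] using R by (intro sum.cong) auto
    also have "(\<Sum>k=Suc r..<m. of_bool (colour (v # xs) k)) = (\<Sum>k<length L. of_bool (colour (v # xs) (r + Suc k)))"
      by (rule sum.reindex_bij_witness[of _ "\<lambda>k. r + Suc k" "\<lambda>k. k - Suc r"]) (use len r_def in auto)
    also have "\<dots> = saveL cL L"
      unfolding saveL_def using L by (intro sum.cong) auto
    finally show "m div 2 \<le> saveR cR R + saveL cL L" .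
  qed
  thus ?thesis by (simp add: saveR_def saveL_def)
qed

text \<open>Exactly half of the tour edges are touched at the cut, so \<open>cycle_lemma\<close>
  provides a rotation with a balanced start.\<close>

lemma tour_rotation_class:
  assumes T: "tour m T" "hd T = (0, True)"
  obtains j v xs where "j < m" "rotate j T = v # xs" "v \<in> verts m"
    "xs \<in> tour_class (y (E T)) v (h (E T) {v, flip v})"
    "y (E T) \<in> {1..t}" "h (E T) {v, flip v} \<in> {- int d..0}"
proof -
  have len: "length T = m" "T \<noteq> []" using tour_length[OF T(1)] m by auto
  have N: "E T \<in> target_matchings m" using T by (auto simp: target_matchings_def)
  note pm = target_pm(1)[OF N]
  let ?e = "\<lambda>k. mate_edge (E T) (flip (T ! k))"
  have Tv: "flip (T ! k) \<in> verts m" if "k < m" for k using tour_verts[OF T(1)] that len nth_mem by fastforce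
  \<comment> \<open>Positions correspond bijectively to the edges leaving them, which turns the
    number of touched edges into a number of coloured positions.\<close>
  have surj: "?e ` {..<m} = E T"
  proof
    show "?e ` {..<m} \<subseteq> E T" using mate_edge(1)[OF pm Tv] by auto
    show "E T \<subseteq> ?e ` {..<m}"
    proof
      fix e assume "e \<in> E T"
      then obtain as x bs where x: "T = as @ x # bs" "e = {flip x, hd (bs @ as @ [x])}"
        using len(2) by (rule tour_edges_cases)
      hence "T ! length as = x" "length as < m" using len(1) by auto
      moreover have "mate_edge (E T) (flip x) = e" using mate_edge_eq[OF pm \<open>e \<in> E T\<close>] x(2) by auto
      ultimately show "e \<in> ?e ` {..<m}" by force
    qed
  qed
  have inj: "inj_on ?e {..<m}"
    by (rule eq_card_imp_inj_on) (simp_all add: surj perfect_matching_card[OF pm])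
  have "card {k. k < m \<and> colour T k} = card (?e ` {k. k < m \<and> colour T k})"
    by (rule card_image[symmetric]) (rule inj_on_subset[OF inj], auto)
  also have "?e ` {k. k < m \<and> colour T k} = {e \<in> E T. 1 \<le> h (E T) e}"
    unfolding colour_def by (subst surj[symmetric]) blast
  also have "card \<dots> = m div 2" using cd N unfolding class_data_def by blast
  finally have "2 * card {k. k < m \<and> colour T k} = m" using m(2) by simp
  then obtain j where j: "j < m" "\<And>r. r < m \<Longrightarrow> m div 2 \<le>
      (\<Sum>k<r. of_bool (\<not> colour T ((j + k) mod m))) + (\<Sum>k=Suc r..<m. of_bool (colour T ((j + k) mod m)))"
    using cycle_lemma[of m "colour T"] m by auto
  obtain v xs where vx: "rotate j T = v # xs" using len(2) by (cases "rotate j T") auto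
  have rot: "rotate j T = drop j T @ take j T" "T = take j T @ drop j T"
    using rotate_drop_take[of j T] j(1) len by auto
  have ET: "E (v # xs) = E T" and tT: "tour m (v # xs)"
    using rot tour_edges_rotate[of "drop j T" "take j T"] tour_rotate[of m "drop j T" "take j T"] T(1) vx by auto
  have col: "colour (v # xs) k = colour T ((j + k) mod m)" if "k < m" for k
    using that len vx ET nth_rotate[of k T j] by (simp add: colour_def)
  have "balanced_from_start (v # xs)"
    unfolding balanced_from_start_def
  proof (intro allI impI)
    fix r assume "r < m"
    with j(2)[OF this] show "m div 2 \<le> (\<Sum>k<r. of_bool (\<not> colour (v # xs) k)) + (\<Sum>k=Suc r..<m. of_bool (colour (v # xs) k))"
      using col by simp
  qed
  hence C: "xs \<in> tour_class (y (E T)) v (h (E T) {v, flip v})"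
    using tT ET N by (simp add: tour_class_def)
  have v: "v \<in> verts m" using tour_verts[OF tT] by simp
  hence "{v, flip v} \<in> base_matching m" by (auto simp: base_matching_def)
  hence "h (E T) {v, flip v} \<in> {- int d..0}" "y (E T) \<in> {1..t}"
    using cd N unfolding class_data_def by auto
  thus ?thesis using that j(1) vx v C by blast
qed

text \<open>The classes are indexed by cut row, start vertex and start value, and each holds at most
  a fraction \<open>1 / 2 ^ (m div 2)\<close> of the total
  \<open>2 ^ (m - 1) * fact (m - 1)\<close>.\<close>

theorem matching_bound: "2 ^ (m div 2) \<le> t * (2 * m) * (d + 1)"
proof -
  let ?T = "{T. tour m T \<and> hd T = (0, True)}"
  let ?K = "{1..t} \<times> verts m \<times> {- int d..0}"
  let ?S = "SIGMA k:?K. tour_class (fst k) (fst (snd k)) (snd (snd k))"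
  define P where "P T j v xs \<longleftrightarrow> j < m \<and> rotate j T = v # xs \<and> ((y (E T), v, h (E T) {v, flip v}), xs) \<in> ?S" for T j v xs
  have "\<exists>j v xs. P T j v xs" if "T \<in> ?T" for T
  proof -
    have *: "tour m T" "hd T = (0, True)" using that by auto
    show ?thesis
    proof (rule tour_rotation_class[OF *], goal_cases)
      case (1 j v xs)
      hence "P T j v xs" unfolding P_def by simp
      thus ?case by blast
    qed
  qed
  then obtain J V X where P: "\<And>T. T \<in> ?T \<Longrightarrow> P T (J T) (V T) (X T)" by metis
  define F where "F T = ((y (E T), V T, h (E T) {V T, flip (V T)}), X T)" for T
  have finS: "finite ?S" using finite_tour_class by (intro finite_SigmaI) auto
  have inj: "inj_on F ?T"
  proof (rule inj_onI)
    fix T1 T2 assume T: "T1 \<in> ?T" "T2 \<in> ?T" and "F T1 = F T2"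
    hence r: "rotate (J T1) T1 = rotate (J T2) T2" using P[OF T(1)] P[OF T(2)] unfolding P_def F_def by simp
    have len: "length T1 = m" "length T2 = m" using T tour_length by auto
    have d: "distinct (rotate (J T1) T1)" using T(1) by (auto simp: tour_def distinct_map)
    \<comment> \<open>The position of \<open>(0, True)\<close> in the rotated list determines the
      amount of rotation, so the tour can be recovered.\<close>
    have idx: "rotate (J T) T ! ((m - J T) mod m) = (0, True)" if "T \<in> ?T" for T
    proof -
      have "length T = m" "T \<noteq> []" using that tour_length m by force+
      moreover have "J T < m" using P[OF that] by (simp add: P_def)
      moreover have "(J T + (m - J T) mod m) mod m = 0" using \<open>J T < m\<close> by (simp add: mod_simps)
      ultimately show ?thesis using nth_rotate[of "(m - J T) mod m" T "J T"] that m hd_conv_nth[of T] by simp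
    qed
    have "(m - J T1) mod m = (m - J T2) mod m"
      using idx[OF T(1)] idx[OF T(2)] nth_eq_iff_index_eq[OF d] len m unfolding r
      by (metis length_rotate mod_less_divisor not_numeral_le_zero gr0I)
    moreover have "J T1 < m" "J T2 < m" using P T by (auto simp: P_def)
    ultimately have "J T1 = J T2" by (cases "J T1 = 0"; cases "J T2 = 0") auto
    hence "rotate (m - J T1) (rotate (J T1) T1) = rotate (m - J T2) (rotate (J T2) T2)" using r by simp
    thus "T1 = T2" using \<open>J T1 < m\<close> \<open>J T2 < m\<close> len by (simp add: rotate_rotate)
  qed
  have "F ` ?T \<subseteq> ?S" using P unfolding P_def F_def by blast
  hence "card ?T \<le> card ?S" using card_inj_on_le[OF inj _ finS] by blast
  also have "card ?S = (\<Sum>k\<in>?K. card (tour_class (fst k) (fst (snd k)) (snd (snd k))))"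
    by (rule card_SigmaI) (auto simp: finite_tour_class)
  finally have "card ?T * 2 ^ (m div 2) \<le> (\<Sum>k\<in>?K. card (tour_class (fst k) (fst (snd k)) (snd (snd k)))) * 2 ^ (m div 2)" by simp
  also have "\<dots> = (\<Sum>k\<in>?K. card (tour_class (fst k) (fst (snd k)) (snd (snd k))) * 2 ^ (m div 2))"
    by (rule sum_distrib_right)
  also have "\<dots> \<le> (\<Sum>k\<in>?K. 2 ^ (m - 1) * fact (m - 1))" by (intro sum_mono card_tour_class)
  also have "\<dots> = (t * (2 * m) * (d + 1)) * (2 ^ (m - 1) * fact (m - 1))"
    by (simp add: card_cartesian_product card_verts nat_add_distrib algebra_simps)
  finally have "(2 ^ (m - 1) * fact (m - 1)) * 2 ^ (m div 2) \<le> (t * (2 * m) * (d + 1)) * (2 ^ (m - 1) * fact (m - 1))"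
    using tours_count[of m] m(1) by (meson le_trans mult_le_mono1 one_le_numeral)
  thus ?thesis by (simp add: mult.commute)
qed

end

lemma (in matching_face) size_bound: "2 ^ (m div 2) \<le> t * (2 * m) * (d + 1)"
proof -
  obtain y h where "class_data m t d y h" using class_data_exists by blast
  hence "tour_classes m t d y h" using m by (simp add: tour_classes_def)
  thus ?thesis by (rule tour_classes.matching_bound)
qed

section \<open>The satisfiability family\<close>

text \<open>Different closed walks can share a monomial, so coefficients are multiplicities. They
  never vanish: repeated addition of 1 moves away from 0, on whichever side of 0 the unit
  lies.\<close>

lemma of_nat_neq_0_ordered:
  assumes "k > 0"
  shows "(of_nat k :: 'a::{comm_semiring_1, ordered_comm_semiring, linorder}) \<noteq> 0"
proof (cases "(0::'a) \<le> 1")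
  case True
  have "(1::'a) \<le> of_nat (Suc j)" for j
  proof (induction j)
    case (Suc j)
    thus ?case using add_mono[OF True Suc] by simp
  qed simp
  from this[of "k - 1"] assms True show ?thesis by auto
next
  case False
  have "of_nat (Suc j) \<le> (1::'a)" for j
  proof (induction j)
    case (Suc j)
    thus ?case using add_mono[of 1 0 "of_nat (Suc j)" "1::'a"] False by simp
  qed simp
  from this[of "k - 1"] assms False show ?thesis by auto
qed

text \<open>A nonconstant monomial excludes the case 1 < 0; otherwise every positive multiplicity is
  unital, and the support is the full set of exponent vectors.\<close>

lemma mono_proj_support:
  fixes g :: "'i \<Rightarrow> ('v \<Rightarrow>\<^sub>0 nat)"
  assumes fin: "finite I" and i: "i \<in> I" "g i \<noteq> 0"
    and proj: "mono_proj V (\<Sum>i\<in>I. Poly_Mapping.single (g i) (1::'a::{comm_semiring_1, ordered_comm_semiring, linorder})) (Perm t :: (_, 'a) fpoly)"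
  obtains L where "perm_sums t L = g ` I"
    "\<And>i j \<mu>. \<mu> \<in> L i j \<Longrightarrow> \<mu> = 0 \<or> (\<exists>v. \<mu> = Poly_Mapping.single v 1)"
proof -
  let ?f = "\<Sum>i\<in>I. Poly_Mapping.single (g i) (1::'a)"
  have "Poly_Mapping.lookup ?f (g i) = of_nat (card {j \<in> I. g j = g i})"
    using fin by (simp add: lookup_sum lookup_single when_def sum.If_cases Int_def)
  moreover have "card {j \<in> I. g j = g i} > 0" using fin i by (auto simp: card_gt_0_iff)
  ultimately have "Poly_Mapping.lookup ?f (g i) \<noteq> 0" using of_nat_neq_0_ordered by simp
  hence 0: "(0::'a) \<le> 1" using mono_proj_degenerate[OF _ proj i(2)] by blast
  have "psupp ?f = g ` I"
    using psupp_sum[OF 0 fin, of "\<lambda>i. Poly_Mapping.single (g i) (1::'a)"] nonneg_poly_single[OF 0]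
    by (auto simp: psupp_single_one[OF 0])
  thus ?thesis using mono_proj_perm_sums[OF 0 proj] that by metis
qed

lemma lookup_sum_power:
  assumes "finite I"
  shows "Poly_Mapping.lookup (\<Sum>x\<in>I. \<Sum>k<d. Poly_Mapping.single (f x) (1::nat)) v = d * card {x \<in> I. f x = v}"
  using assms by (simp add: lookup_sum lookup_single when_def sum.If_cases Int_def sum_distrib_left[symmetric] mult.commute)

lemma disjoint_pairs_card:
  assumes N: "N \<subseteq> vpairs m" and dis: "\<And>e f. e \<in> N \<Longrightarrow> f \<in> N \<Longrightarrow> e \<noteq> f \<Longrightarrow> e \<inter> f = {}"
  shows "card N \<le> m" "card N = m \<Longrightarrow> perfect_matching m N"
proof -
  have c: "card (\<Union>N) = 2 * card N" using card_Union_vpairs[OF N dis] .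
  have sub: "\<Union>N \<subseteq> verts m" using N by (auto simp: vpairs_def)
  show "card N \<le> m" using card_mono[OF finite_verts sub] c card_verts[of m] by simp
  assume "card N = m"
  hence "\<Union>N = verts m" using card_subset_eq[OF finite_verts sub] c card_verts by simp
  thus "perfect_matching m N" unfolding perfect_matching_def using N dis by blast
qed

definition sat_mon :: "nat \<Rightarrow> nat \<Rightarrow> nat set \<Rightarrow> (nat + (nat \<times> bool) set) \<Rightarrow>\<^sub>0 nat" where
  "sat_mon d n S = (\<Sum>i\<in>S. \<Sum>k<d. Poly_Mapping.single (Inl i) 1) +
     (\<Sum>c\<in>{c\<in>clauses n. satisfies S c}. \<Sum>k<d. Poly_Mapping.single (Inr c) 1)"

lemma finite_clauses: "finite (clauses n)"
  by (rule finite_subset[of _ "Pow ({1..n} \<times> UNIV)"]) (auto simp: clauses_def)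

lemma Sat_eq: "Sat q n = (\<Sum>S\<in>Pow {1..n}. Poly_Mapping.single (sat_mon (q - 1) n S) 1)"
  unfolding Sat_def pvar_def sat_mon_def
  by (simp add: power_single_one prod_single_one mult_single)

lemma lookup_sat_mon:
  assumes "finite S"
  shows "Poly_Mapping.lookup (sat_mon d n S) (Inl i) = (if i \<in> S then d else 0)"
    "Poly_Mapping.lookup (sat_mon d n S) (Inr c) = (if c \<in> clauses n \<and> satisfies S c then d else 0)"
proof -
  have "{x \<in> S. (Inl x :: nat + (nat \<times> bool) set) = Inl i} = (if i \<in> S then {i} else {})" by auto
  thus "Poly_Mapping.lookup (sat_mon d n S) (Inl i) = (if i \<in> S then d else 0)"
    unfolding sat_mon_def lookup_add
    using lookup_sum_power[OF assms, where d = d and f = "Inl :: _ \<Rightarrow> nat + (nat \<times> bool) set" and v = "Inl i"]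
      lookup_sum_power[where I = "{c\<in>clauses n. satisfies S c}" and d = d and f = "Inr :: _ \<Rightarrow> nat + (nat \<times> bool) set" and v = "Inl i"]
      finite_clauses[of n] by simp
  have "{x \<in> {c\<in>clauses n. satisfies S c}. (Inr x :: nat + (nat \<times> bool) set) = Inr c} = (if c \<in> clauses n \<and> satisfies S c then {c} else {})" by auto
  thus "Poly_Mapping.lookup (sat_mon d n S) (Inr c) = (if c \<in> clauses n \<and> satisfies S c then d else 0)"
    unfolding sat_mon_def lookup_add
    using lookup_sum_power[OF assms, where d = d and f = "Inl :: _ \<Rightarrow> nat + (nat \<times> bool) set" and v = "Inr c"]
      lookup_sum_power[where I = "{c\<in>clauses n. satisfies S c}" and d = d and f = "Inr :: _ \<Rightarrow> nat + (nat \<times> bool) set" and v = "Inr c"]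
      finite_clauses[of n] by simp
qed

text \<open>Variables are edges, the clauses in \<open>\<phi>\<close> forbid adjacent edges (a third literal is added to reach
  width 3), and the weight prefers first the clauses of \<open>\<phi>\<close> and then as many edges as possible.\<close>

lemma Sat_bound:
  assumes proj: "mono_proj V (Sat q n :: (_, 'a::{comm_semiring_1, ordered_comm_semiring, linorder}) fpoly) (Perm t :: (_, 'a) fpoly)"
    and q: "q \<ge> 2" and m: "m \<ge> 2" "even m" and n: "(2 * m) choose 2 \<le> n" "n \<ge> 3"
  shows "2 ^ (m div 2) \<le> t * (2 * m) * q"
proof -
  define d where "d = q - 1"
  have d: "d \<ge> 1" "q = d + 1" using q by (auto simp: d_def)
  note q_eq = d(2)
  have lk1: "Poly_Mapping.lookup (sat_mon d n {1}) (Inl 1) = d" by (simp add: lookup_sat_mon)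
  obtain L where L: "perm_sums t L = sat_mon d n ` Pow {1..n}"
    "\<And>i j \<mu>. \<mu> \<in> L i j \<Longrightarrow> \<mu> = 0 \<or> (\<exists>v. \<mu> = Poly_Mapping.single v 1)"
  proof (rule mono_proj_support)
    show "mono_proj V (\<Sum>S\<in>Pow {1..n}. Poly_Mapping.single (sat_mon d n S) (1::'a)) (Perm t :: (_, 'a) fpoly)"
      using proj unfolding Sat_eq d_def .
    show "{1} \<in> Pow {1..n}" using n(2) by auto
    show "sat_mon d n {1} \<noteq> 0" using lk1 d by auto
  qed auto
  define b where "b = card (vpairs m)"
  have "b = (2 * m) choose 2"
    unfolding b_def vpairs_def using n_subsets[OF finite_verts[of m], of 2] card_verts[of m] by simp
  hence "card (vpairs m) \<le> card {1..n}" using n(1) b_def by simp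
  \<comment> \<open>One propositional variable for each pair of vertices: this quadratic cost is the
    source of the square root in the final bound.\<close>
  then obtain idx where idx: "idx ` vpairs m \<subseteq> {1..n}" "inj_on idx (vpairs m)"
    using card_le_inj[OF finite_vpairs finite_atLeastAtMost] by blast
  define \<phi> where "\<phi> = {c \<in> clauses n. \<exists>e\<in>vpairs m. \<exists>f\<in>vpairs m. e \<noteq> f \<and> e \<inter> f \<noteq> {} \<and> (idx e, False) \<in> c \<and> (idx f, False) \<in> c}"
  have fin\<phi>: "finite \<phi>" using finite_clauses unfolding \<phi>_def by simp
  define W :: "(nat + (nat \<times> bool) set) set" where "W = Inl ` idx ` vpairs m \<union> Inr ` \<phi>"
  \<comment> \<open>\<open>b\<close> is the number of pairs, so losing one clause outweighs whatever
    edges can gain.\<close>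
  define a :: "nat + (nat \<times> bool) set \<Rightarrow> int" where "a = case_sum (\<lambda>_. 1) (\<lambda>_. int b + 1)"
  define A where "A = int d * (int m + (int b + 1) * int (card \<phi>))"
  define \<phi>S where "\<phi>S S = {c \<in> \<phi>. satisfies S c}" for S
  define NS where "NS S = {e \<in> vpairs m. idx e \<in> S}" for S
  have wt: "weight W a (sat_mon d n S) = int d * (int (card (NS S)) + (int b + 1) * int (card (\<phi>S S)))"
    if "S \<subseteq> {1..n}" for S
  proof -
    have fS: "finite S" using that finite_subset by auto
    have "weight W a (sat_mon d n S) = (\<Sum>v\<in>Inl ` idx ` vpairs m. a v * int (Poly_Mapping.lookup (sat_mon d n S) v)) +
        (\<Sum>v\<in>Inr ` \<phi>. a v * int (Poly_Mapping.lookup (sat_mon d n S) v))"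
      unfolding weight_def W_def using fin\<phi> by (intro sum.union_disjoint) auto
    also have "(\<Sum>v\<in>Inl ` idx ` vpairs m. a v * int (Poly_Mapping.lookup (sat_mon d n S) v))
        = (\<Sum>e\<in>vpairs m. if idx e \<in> S then int d else 0)"
      using idx(2) fS by (subst sum.reindex) (auto simp: sum.reindex a_def lookup_sat_mon intro!: sum.cong)
    also have "\<dots> = int d * int (card (NS S))" unfolding NS_def by (simp add: sum.If_cases Int_def)
    also have "(\<Sum>v\<in>Inr ` \<phi>. a v * int (Poly_Mapping.lookup (sat_mon d n S) v))
        = (\<Sum>c\<in>\<phi>. if satisfies S c then (int b + 1) * int d else 0)"
    proof -
      have "\<phi> \<subseteq> clauses n" by (auto simp: \<phi>_def)
      thus ?thesis using fS by (subst sum.reindex) (auto simp: a_def lookup_sat_mon intro!: sum.cong)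
    qed
    also have "\<dots> = (int b + 1) * int d * int (card (\<phi>S S))" unfolding \<phi>S_def using fin\<phi> by (simp add: sum.If_cases Int_def)
    finally show ?thesis by (simp add: algebra_simps)
  qed
  have conflict: "e \<inter> f = {}" if S: "S \<subseteq> {1..n}" "\<phi>S S = \<phi>" and ef: "e \<in> NS S" "f \<in> NS S" "e \<noteq> f" for S e f
  proof (rule ccontr)
    assume i: "e \<inter> f \<noteq> {}"
    have v: "e \<in> vpairs m" "f \<in> vpairs m" "idx e \<in> S" "idx f \<in> S" using ef by (auto simp: NS_def)
    have ne: "idx e \<noteq> idx f" using idx(2) v ef(3) by (auto simp: inj_on_def)
    have "card ({1..n} - {idx e, idx f}) \<ge> 1"
      using n(2) ne v S(1) by (subst card_Diff_subset) auto
    then obtain z where z: "z \<in> {1..n}" "z \<noteq> idx e" "z \<noteq> idx f"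
      by (metis Diff_iff card.empty empty_iff ex_in_conv insertCI not_one_le_zero)
    \<comment> \<open>The third literal is chosen false under \<open>S\<close>; the clause is in
      \<open>\<phi>\<close> because \<open>\<phi>\<close> admits every third literal.\<close>
    define c where "c = {(idx e, False), (idx f, False), (z, z \<notin> S)}"
    have "c \<in> clauses n" using z v S(1) ne by (auto simp: clauses_def c_def)
    moreover have "(idx e, False) \<in> c" "(idx f, False) \<in> c" by (simp_all add: c_def)
    ultimately have "c \<in> \<phi>" unfolding \<phi>_def using v(1,2) i ef(3) by blast
    moreover have "\<not> satisfies S c" using v by (auto simp: satisfies_def c_def)
    ultimately show False using S(2) by (auto simp: \<phi>S_def)
  qed
  have NSv: "NS S \<subseteq> vpairs m" for S by (auto simp: NS_def)
  have strict: "weight W a (sat_mon d n S) < A" if S: "S \<subseteq> {1..n}" "\<phi>S S \<noteq> \<phi>" for S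
  proof -
    have "\<phi>S S \<subset> \<phi>" using S(2) by (auto simp: \<phi>S_def)
    hence "card (\<phi>S S) < card \<phi>" using fin\<phi> psubset_card_mono by blast
    hence "(int b + 1) * (int (card (\<phi>S S)) + 1) \<le> (int b + 1) * int (card \<phi>)" by (intro mult_left_mono) auto
    moreover have "int (card (NS S)) \<le> int b" using card_mono[OF finite_vpairs NSv] by (simp add: b_def)
    ultimately have "int (card (NS S)) + (int b + 1) * int (card (\<phi>S S)) < int m + (int b + 1) * int (card \<phi>)"
      using m(1) by (simp add: algebra_simps)
    thus ?thesis unfolding wt[OF S(1)] A_def using d by simp
  qed
  interpret matching_face t m d L "\<lambda>e. Inl (idx e)" W a A
  proof (unfold_locales)
    show "inj_on (\<lambda>e. Inl (idx e)) (vpairs m)" using idx(2) by (auto simp: inj_on_def)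
    fix f assume "f \<in> perm_sums t L"
    then obtain S where S: "S \<subseteq> {1..n}" "f = sat_mon d n S" unfolding L(1) by auto
    show "weight W a f \<le> A"
    proof (cases "\<phi>S S = \<phi>")
      case True
      have "card (NS S) \<le> m" using disjoint_pairs_card(1)[OF NSv] conflict[OF S(1) True] by blast
      hence "int d * int (card (NS S)) \<le> int d * int m" by (intro mult_left_mono) auto
      thus ?thesis using wt[OF S(1)] True S(2) by (simp add: A_def algebra_simps)
    next
      case False
      thus ?thesis using strict[OF S(1)] S(2) by simp
    qed
    assume eq: "weight W a f = A"
    hence True: "\<phi>S S = \<phi>" using strict[OF S(1)] S(2) by (cases "\<phi>S S = \<phi>") auto
    have "card (NS S) = m" using eq wt[OF S(1)] d unfolding S(2) True A_def by simp
    hence "perfect_matching m (NS S)" using disjoint_pairs_card(2)[OF NSv] conflict[OF S(1) True] by blast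
    moreover have "Poly_Mapping.lookup f (Inl (idx e)) = (if e \<in> NS S then d else 0)" if "e \<in> vpairs m" for e
      using that lookup_sat_mon(1)[of S] S finite_subset[OF S(1)] by (auto simp: NS_def)
    ultimately show "\<exists>N. matching_shape m d (\<lambda>e. Inl (idx e)) f N" unfolding matching_shape_def by blast
  next
    fix N assume "N \<in> insert (base_matching m) (target_matchings m)"
    hence pm: "perfect_matching m N"
      using perfect_matching_base perfect_matching_tour[OF _ m(1)] unfolding target_matchings_def by blast
    hence Nv: "N \<subseteq> vpairs m" by (simp add: perfect_matching_def)
    have S: "idx ` N \<subseteq> {1..n}" using Nv idx(1) by blast
    have NSN: "NS (idx ` N) = N" unfolding NS_def using Nv idx(2) by (auto dest: inj_onD)
    have "satisfies (idx ` N) c" if "c \<in> \<phi>" for c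
    proof -
      obtain e f where ef: "e \<in> vpairs m" "f \<in> vpairs m" "e \<noteq> f" "e \<inter> f \<noteq> {}" "(idx e, False) \<in> c" "(idx f, False) \<in> c"
        using \<open>c \<in> \<phi>\<close> unfolding \<phi>_def by blast
      have "e \<notin> N \<or> f \<notin> N" using perfect_matching_unique[OF pm, of e f] ef(3,4) by blast
      hence "idx e \<notin> idx ` N \<or> idx f \<notin> idx ` N" using ef(1,2) NSN unfolding NS_def by blast
      thus ?thesis
      proof
        assume "idx e \<notin> idx ` N"
        thus ?thesis unfolding satisfies_def by (intro bexI[OF _ ef(5)]) simp
      next
        assume "idx f \<notin> idx ` N"
        thus ?thesis unfolding satisfies_def by (intro bexI[OF _ ef(6)]) simp
      qed
    qed
    hence "\<phi>S (idx ` N) = \<phi>" by (auto simp: \<phi>S_def)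
    hence "weight W a (sat_mon d n (idx ` N)) = A"
      using wt[OF S] NSN perfect_matching_card[OF pm] by (simp add: A_def)
    moreover have "matching_shape m d (\<lambda>e. Inl (idx e)) (sat_mon d n (idx ` N)) N"
      unfolding matching_shape_def using pm lookup_sat_mon(1)[of "idx ` N"] S finite_subset[OF S] NSN unfolding NS_def by auto
    ultimately show "\<exists>f\<in>perm_sums t L. weight W a f = A \<and> matching_shape m d (\<lambda>e. Inl (idx e)) f N"
      unfolding L(1) using S by blast
  qed (use L(2) m d in auto)
  show ?thesis using size_bound q_eq by simp
qed

section \<open>The closed walk family\<close>

fun consec :: "'b list \<Rightarrow> 'b set set" where
  "consec (x # y # zs) = insert {x, y} (consec (y # zs))"
| "consec _ = {}"

lemma consec_append: "consec (xs @ y # ys) = consec (xs @ [y]) \<union> consec (y # ys)"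
proof (induction xs)
  case (Cons x xs)
  thus ?case by (cases xs) auto
qed simp

lemma consec_mid: "{x, y} \<in> consec (xs @ x # y # ys)"
  unfolding consec_append[of xs x "y # ys"] by simp

lemma consec_subset: "e \<in> consec L \<Longrightarrow> e \<subseteq> set L"
  by (induction L rule: consec.induct) auto

lemma consec_nth: "consec L = (\<lambda>k. {L ! k, L ! Suc k}) ` {k. Suc k < length L}"
proof (induction L rule: consec.induct)
  case (1 x y zs)
  have "{k. Suc k < length (x # y # zs)} = insert 0 (Suc ` {k. Suc k < length (y # zs)})"
    by (auto simp: image_iff) (metis Suc_less_eq gr0_implies_Suc not_gr_zero)
  thus ?case using 1 by (simp add: image_image)
qed auto

text \<open>Each vertex \<open>v\<close> becomes a path \<open>b v\<close>, \<open>c v\<close>, \<open>p v\<close>. The only allowed neighbours of \<open>c v\<close> are \<open>b v\<close> and \<open>p v\<close>,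
  so in an allowed Hamiltonian cycle the second edge at \<open>b v\<close> leads to another \<open>b u\<close>, and these
  edges form a perfect matching. The weight counts visited vertices minus forbidden edges.\<close>

locale clow_gadget =
  fixes m n :: nat
  assumes m: "m \<ge> 2" and n: "6 * m \<le> n"
begin

text \<open>\<open>(0, True)\<close> has code 0, so \<open>b (0, True)\<close> is vertex 1, where a
  closed walk through all vertices must start.\<close>

definition code :: "nat \<times> bool \<Rightarrow> nat" where "code v = 2 * fst v + (if snd v then 0 else 1)"
definition b where "b v = 1 + code v"
definition c where "c v = 1 + 2 * m + code v"
definition p where "p v = 1 + 4 * m + code v"
definition B where "B = {1..2 * m}"
text \<open>Besides all \<open>p v\<close>, this contains the spare vertices above
  \<open>6 * m\<close>. Its edges are all allowed, so a cycle can absorb the spare vertices and join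
  the paths there in any order.\<close>

definition P where "P = {4 * m + 1..n}"

definition allowed :: "nat set \<Rightarrow> bool" where
  "allowed e \<longleftrightarrow> e \<subseteq> B \<or> e \<subseteq> P \<or> (\<exists>v\<in>verts m. e = {b v, c v} \<or> e = {c v, p v})"

lemma code_inj: "code u = code v \<longleftrightarrow> u = v"
  by (cases u; cases v) (auto simp: code_def split: if_splits; presburger)

lemma code_less: "v \<in> verts m \<Longrightarrow> code v < 2 * m"
  by (auto simp: code_def verts_def)

lemma code_surj: "k < 2 * m \<Longrightarrow> \<exists>v\<in>verts m. code v = k"
  by (rule bexI[of _ "(k div 2, even k)"]) (auto simp: code_def verts_def)

lemma gadget_inj: "b u = b v \<longleftrightarrow> u = v" "c u = c v \<longleftrightarrow> u = v" "p u = p v \<longleftrightarrow> u = v"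
  by (auto simp: b_def c_def p_def code_inj)

lemma gadget_distinct:
  assumes "u \<in> verts m" "v \<in> verts m"
  shows "b u \<noteq> c v" "b u \<noteq> p v" "c u \<noteq> p v" "c u \<noteq> b v" "p v \<noteq> b u" "p v \<noteq> c u"
  using code_less[OF assms(1)] code_less[OF assms(2)] by (auto simp: b_def c_def p_def)

lemma gadget_mem: "v \<in> verts m \<Longrightarrow> b v \<in> B" "v \<in> verts m \<Longrightarrow> c v \<notin> B" "v \<in> verts m \<Longrightarrow> c v \<notin> P"
  "v \<in> verts m \<Longrightarrow> p v \<in> P" "v \<in> verts m \<Longrightarrow> b v \<notin> P" "v \<in> verts m \<Longrightarrow> p v \<notin> B"
  using code_less[of v] n by (auto simp: b_def c_def p_def B_def P_def)

lemma B_image: "x \<in> B \<Longrightarrow> \<exists>v\<in>verts m. x = b v"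
  using code_surj[of "x - 1"] by (force simp: B_def b_def)

lemma gadget_range: "v \<in> verts m \<Longrightarrow> b v \<in> {1..n}" "v \<in> verts m \<Longrightarrow> c v \<in> {1..n}" "v \<in> verts m \<Longrightarrow> p v \<in> {1..n}"
  using code_less[of v] n by (auto simp: b_def c_def p_def)

lemma allowed_c: "allowed {x, c v} \<Longrightarrow> v \<in> verts m \<Longrightarrow> x = b v \<or> x = p v"
  unfolding allowed_def
  using gadget_mem(2,3)[of v] gadget_inj gadget_distinct by (auto simp: doubleton_eq_iff)

lemma allowed_b: "allowed {x, b v} \<Longrightarrow> v \<in> verts m \<Longrightarrow> x = c v \<or> (\<exists>u\<in>verts m. x = b u)"
  unfolding allowed_def
  using gadget_mem(1,5)[of v] B_image[of x] gadget_inj gadget_distinct by (auto simp: doubleton_eq_iff)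

lemma hamiltonian_allowed_matching:
  fixes N :: "(nat \<times> bool) set set"
  assumes nb: "\<And>x. x \<in> {1..n} \<Longrightarrow> \<exists>y z. y \<noteq> z \<and> (\<forall>w. {x, w} \<in> C \<longleftrightarrow> w = y \<or> w = z)"
    and al: "\<And>e. e \<in> C \<Longrightarrow> allowed e" and ne: "\<And>x. {x} \<notin> C"
  defines "N \<equiv> {e \<in> vpairs m. b ` e \<in> C}"
  shows "perfect_matching m N"
  unfolding perfect_matching_def
proof (intro conjI ballI)
  show "N \<subseteq> vpairs m" by (auto simp: N_def)
  fix v assume v: "v \<in> verts m"
  obtain y z where yz: "y \<noteq> z" "\<And>w. {c v, w} \<in> C \<longleftrightarrow> w = y \<or> w = z" using nb[OF gadget_range(2)[OF v]] by blast
  have "{c v, y} \<in> C" "{c v, z} \<in> C" using yz(2) by auto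
  hence "allowed {y, c v}" "allowed {z, c v}" using al by (simp_all add: insert_commute)
  \<comment> \<open>\<open>c v\<close> has two different neighbours and only two permitted ones, so
    both occur.\<close>
  hence "b v = y \<or> b v = z" using allowed_c[OF _ v] yz(1) by metis
  hence "{c v, b v} \<in> C" using yz(2) by simp
  hence cb: "{b v, c v} \<in> C" by (simp add: insert_commute)
  obtain y' z' where yz': "y' \<noteq> z'" "\<And>w. {b v, w} \<in> C \<longleftrightarrow> w = y' \<or> w = z'" using nb[OF gadget_range(1)[OF v]] by blast
  define w where "w = (if y' = c v then z' else y')"
  have w: "w \<noteq> c v" "\<And>x. {b v, x} \<in> C \<longleftrightarrow> x = c v \<or> x = w"
    using yz' cb by (auto simp: w_def)
  have "{b v, w} \<in> C" using w(2) by simp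
  hence "allowed {w, b v}" using al by (simp add: insert_commute)
  then obtain u where u: "u \<in> verts m" "w = b u" using allowed_b[OF _ v] w(1) by blast
  have "{b v, b u} \<in> C" using \<open>{b v, w} \<in> C\<close> u(2) by simp
  hence "u \<noteq> v" using ne[of "b v"] by auto
  hence N: "{v, u} \<in> N" using v u \<open>{b v, b u} \<in> C\<close> by (simp add: N_def)
  show "\<exists>!e. e \<in> N \<and> v \<in> e"
  proof (rule ex1I[of _ "{v, u}"])
    fix e assume e: "e \<in> N \<and> v \<in> e"
    hence ev: "e \<in> vpairs m" "b ` e \<in> C" by (auto simp: N_def)
    obtain u' where u': "e = {v, u'}" using ev(1) e unfolding vpairs_def by (auto simp: card_2_iff)
    hence uv: "u' \<in> verts m" using ev(1) by (auto simp: vpairs_def)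
    have "{b v, b u'} \<in> C" using ev(2) u' by simp
    hence "b u' = b u" using w(2) u(2) gadget_distinct(1)[OF uv v] by auto
    thus "e = {v, u}" using u' gadget_inj by simp
  qed (use N in auto)
qed

section \<open>Hamiltonian closed walks and their edges\<close>

definition cyc_edge :: "(nat \<Rightarrow> nat) \<Rightarrow> nat \<Rightarrow> nat set" where
  "cyc_edge w i = {w (i - 1), w (i mod n)}"

lemma n3: "n \<ge> 12" using m n by simp

lemma cyc_edge_Suc: "k < n \<Longrightarrow> cyc_edge w (Suc k) = {w k, w (Suc k mod n)}"
  by (simp add: cyc_edge_def)

text \<open>On a cycle of at least 3 vertices, going on twice never returns to the start
  (\<open>s (s k) \<noteq> k\<close>). Hence the \<open>n\<close> steps use different edges, each
  with multiplicity one, and every vertex has exactly two neighbours.\<close>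

lemma hamiltonian_walk:
  assumes inj: "inj_on w {0..<n}" and im: "w ` {0..<n} = {1..n}"
  defines "C \<equiv> cyc_edge w ` {1..n}"
  shows "inj_on (cyc_edge w) {1..n}" "\<And>x. {x} \<notin> C"
    "\<And>x. x \<in> {1..n} \<Longrightarrow> \<exists>y z. y \<noteq> z \<and> (\<forall>u. {x, u} \<in> C \<longleftrightarrow> u = y \<or> u = z)"
proof -
  have weq: "w i = w j \<longleftrightarrow> i = j" if "i < n" "j < n" for i j
    using inj that by (auto simp: inj_on_def)
  define s where "s k = (if Suc k < n then Suc k else 0)" for k
  have sm: "Suc k mod n = s k" if "k < n" for k using that by (cases "Suc k = n") (auto simp: s_def)
  have s: "s k < n" "s k \<noteq> k" "s (s k) \<noteq> k" if "k < n" for k using that n3 by (auto simp: s_def)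
  have sinj: "s i = s j \<Longrightarrow> i = j" if "i < n" "j < n" for i j using that by (auto simp: s_def split: if_splits)
  have I: "{1..n} = Suc ` {0..<n}" by (simp add: image_Suc_atLeastLessThan atLeastLessThanSuc_atLeastAtMost)
  have E: "cyc_edge w (Suc k) = {w k, w (s k)}" if "k < n" for k using cyc_edge_Suc[OF that] sm[OF that] by simp
  have C: "C = (\<lambda>k. {w k, w (s k)}) ` {0..<n}"
    unfolding C_def I image_image by (intro image_cong) (auto simp: E)
  show "inj_on (cyc_edge w) {1..n}"
    unfolding I
  proof (intro inj_onI)
    fix i j assume "i \<in> Suc ` {0..<n}" "j \<in> Suc ` {0..<n}" and e: "cyc_edge w i = cyc_edge w j"
    then obtain k l where kl: "i = Suc k" "j = Suc l" "k < n" "l < n" by (metis imageE atLeastLessThan_iff)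
    have "{w k, w (s k)} = {w l, w (s l)}" using e kl E by simp
    hence "w k = w l \<or> (w k = w (s l) \<and> w (s k) = w l)" by (auto simp: doubleton_eq_iff)
    hence "k = l \<or> (k = s l \<and> s k = l)" using weq kl s by auto
    thus "i = j" using s(3)[OF kl(4)] kl by auto
  qed
  show "{x} \<notin> C" for x
  proof
    assume "{x} \<in> C"
    then obtain k where "k < n" "{x} = {w k, w (s k)}" unfolding C by auto
    thus False using weq s(1,2) by (metis doubleton_eq_iff insert_absorb2)
  qed
  fix x assume "x \<in> {1..n}"
  then obtain k where k: "k < n" "x = w k" using im by (metis atLeastLessThan_iff imageE)
  define j where "j = (if k = 0 then n - 1 else k - 1)"
  have j: "j < n" "s j = k" using k(1) n3 by (auto simp: j_def s_def)
  show "\<exists>y z. y \<noteq> z \<and> (\<forall>u. {x, u} \<in> C \<longleftrightarrow> u = y \<or> u = z)"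
  proof (rule exI[of _ "w (s k)"], rule exI[of _ "w j"], intro conjI allI)
    show "w (s k) \<noteq> w j" using weq[OF s(1)[OF k(1)] j(1)] s(3)[OF j(1)] j(2) by auto
    fix u show "{x, u} \<in> C \<longleftrightarrow> u = w (s k) \<or> u = w j"
    proof
      assume "{x, u} \<in> C"
      then obtain l where l: "l < n" "{x, u} = {w l, w (s l)}" unfolding C by auto
      then consider "w k = w l" "u = w (s l)" | "w k = w (s l)" "u = w l" unfolding k(2) by (auto simp: doubleton_eq_iff)
      thus "u = w (s k) \<or> u = w j"
      proof cases
        case 1 thus ?thesis using weq k l by simp
      next
        case 2
        hence "s l = s j" using weq k(1) s(1)[OF l(1)] j(2) by simp
        thus ?thesis using sinj l j 2 by blast
      qed
    next
      assume "u = w (s k) \<or> u = w j"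
      thus "{x, u} \<in> C"
      proof
        assume "u = w (s k)" thus ?thesis unfolding C using k by auto
      next
        assume "u = w j" thus ?thesis unfolding C using k j by (auto intro!: image_eqI[of _ _ j] simp: insert_commute)
      qed
    qed
  qed
qed

section \<open>Hamiltonian cycles realizing prescribed matchings\<close>

definition Z where "Z = [6 * m + 1..<n + 1]"

lemma list_walk:
  assumes set: "set ws = {1..n}" and len: "length ws = n" and hd: "hd ws = 1"
  defines "w \<equiv> restrict (\<lambda>i. ws ! i) {0..<n}"
  shows "w \<in> clow_walks n" "inj_on w {0..<n}" "w ` {0..<n} = {1..n}"
    "cyc_edge w ` {1..n} = consec (ws @ [hd ws])"
proof -
  have d: "distinct ws" using set len by (intro card_distinct) simp
  have ne: "ws \<noteq> []" using len n3 by auto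
  have w: "w k = ws ! k" if "k < n" for k using that by (simp add: w_def)
  show inj: "inj_on w {0..<n}" using d len by (auto simp: inj_on_def w nth_eq_iff_index_eq)
  have "w ` {0..<n} = (\<lambda>k. ws ! k) ` {0..<n}" by (rule image_cong) (auto simp: w)
  thus im: "w ` {0..<n} = {1..n}" using set len nth_image[of n ws] by simp
  have "w (i - 1) \<noteq> w (i mod n)" if "i \<in> {1..n}" for i
  proof -
    have "i - 1 \<noteq> i mod n" using that n3 by (cases "i = n") auto
    moreover have "i - 1 < n" "i mod n < n" using that n3 by auto
    ultimately show ?thesis using inj by (auto simp: inj_on_def)
  qed
  moreover have "w 0 < w j" if "j \<in> {1..<n}" for j
  proof -
    have "w 0 = 1" using hd ne len n3 by (simp add: w hd_conv_nth)
    moreover have "w j \<in> {1..n}" using im that by auto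
    moreover have "w j \<noteq> w 0" using inj_onD[OF inj, of j 0] that n3 by auto
    ultimately show ?thesis by auto
  qed
  moreover have "w \<in> {0..<n} \<rightarrow>\<^sub>E {1..n}" using im by (auto simp: w_def)
  ultimately show "w \<in> clow_walks n" by (simp add: clow_walks_def)
  have I: "{1..n} = Suc ` {0..<n}" by (simp add: image_Suc_atLeastLessThan atLeastLessThanSuc_atLeastAtMost)
  have "cyc_edge w (Suc k) = {(ws @ [hd ws]) ! k, (ws @ [hd ws]) ! Suc k}" if "k < n" for k
  proof (cases "Suc k = n")
    case True
    hence "cyc_edge w (Suc k) = {w k, w 0}" using cyc_edge_Suc[OF that] by simp
    moreover have "0 < n" using n3 by simp
    ultimately show ?thesis using that True len ne by (simp add: w nth_append hd_conv_nth)
  next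
    case False
    thus ?thesis using that len by (simp add: cyc_edge_Suc w nth_append)
  qed
  thus "cyc_edge w ` {1..n} = consec (ws @ [hd ws])"
    unfolding I image_image consec_nth using len by (intro image_cong) auto
qed

text \<open>The route for tours: it begins at \<open>b v\<close> and ends at
  \<open>b (flip v)\<close>, so the edges inside \<open>B\<close> are those joining consecutive
  segments.\<close>

definition seg where "seg v = [b v, c v, p v, p (flip v), c (flip v), b (flip v)]"
text \<open>The route for the base matching, turned inside out: the two \<open>b\<close> vertices
  are adjacent, and consecutive segments are joined inside \<open>P\<close>.\<close>

definition seg' where "seg' v = [p v, c v, b v, b (flip v), c (flip v), p (flip v)]"

lemma consec_segs:
  assumes "set (v # xs @ [z]) \<subseteq> verts m"
  shows "(\<forall>e\<in>consec (b (flip v) # concat (map seg xs) @ [b z]). allowed e) \<and>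
    (\<lambda>e. b ` e) ` path_edges (v # xs @ [z]) \<subseteq> consec (b (flip v) # concat (map seg xs) @ [b z])"
  using assms
proof (induction xs arbitrary: v)
  case Nil
  thus ?case using gadget_mem(1) by (auto simp: allowed_def)
next
  case (Cons x xs)
  hence x: "x \<in> verts m" "flip x \<in> verts m" "flip v \<in> verts m" by auto
  define D where "D = {{b (flip v), b x}, {b x, c x}, {c x, p x}, {p x, p (flip x)}, {c (flip x), p (flip x)}, {b (flip x), c (flip x)}}"
  have E: "consec (b (flip v) # concat (map seg (x # xs)) @ [b z]) =
      D \<union>
      consec (b (flip x) # concat (map seg xs) @ [b z])"
    by (auto simp: seg_def D_def insert_commute)
  have "allowed {b (flip v), b x}" "allowed {p x, p (flip x)}" using x gadget_mem by (auto simp: allowed_def)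
  moreover have "allowed {b u, c u}" "allowed {c u, p u}" if "u \<in> verts m" for u
    using that unfolding allowed_def by blast+
  ultimately have al: "\<forall>e\<in>D. allowed e"
    using x by (simp add: D_def)
  have IH: "(\<forall>e\<in>consec (b (flip x) # concat (map seg xs) @ [b z]). allowed e) \<and>
    (\<lambda>e. b ` e) ` path_edges (x # xs @ [z]) \<subseteq> consec (b (flip x) # concat (map seg xs) @ [b z])"
    using Cons.prems by (intro Cons.IH) simp
  have "(\<lambda>e. b ` e) ` path_edges (v # (x # xs) @ [z]) = insert {b (flip v), b x} ((\<lambda>e. b ` e) ` path_edges (x # xs @ [z]))"
    by simp
  moreover have "{b (flip v), b x} \<in> D" by (simp add: D_def)
  ultimately show ?case using IH al unfolding E by (simp add: ball_Un le_supI2)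
qed

lemma consec_segs':
  assumes "u \<in> P" "set (xs @ [z]) \<subseteq> verts m"
  shows "\<forall>e\<in>consec (u # concat (map seg' xs) @ [p z]). allowed e"
  using assms
proof (induction xs arbitrary: u)
  case Nil
  thus ?case using gadget_mem(4) by (auto simp: allowed_def)
next
  case (Cons x xs)
  hence x: "x \<in> verts m" "flip x \<in> verts m" by auto
  define D where "D = {{u, p x}, {c x, p x}, {b x, c x}, {b x, b (flip x)}, {b (flip x), c (flip x)}, {c (flip x), p (flip x)}}"
  have E: "consec (u # concat (map seg' (x # xs)) @ [p z]) =
      D \<union>
      consec (p (flip x) # concat (map seg' xs) @ [p z])"
    by (auto simp: seg'_def D_def insert_commute)
  have "allowed {u, p x}" "allowed {b x, b (flip x)}" using x Cons.prems gadget_mem by (auto simp: allowed_def)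
  moreover have "allowed {b u, c u}" "allowed {c u, p u}" if "u \<in> verts m" for u
    using that unfolding allowed_def by blast+
  ultimately have al: "\<forall>e\<in>D. allowed e"
    using x by (simp add: D_def)
  have IH: "\<forall>e\<in>consec (p (flip x) # concat (map seg' xs) @ [p z]). allowed e"
    using Cons.prems gadget_mem(4)[OF x(2)] by (intro Cons.IH) auto
  show ?case unfolding E using IH al by blast
qed

lemma consec_P: "set L \<subseteq> P \<Longrightarrow> e \<in> consec L \<Longrightarrow> allowed e"
  using consec_subset[of e L] unfolding allowed_def by blast

lemma Z: "set Z \<subseteq> P" "length Z = n - 6 * m"
  by (auto simp: Z_def P_def)

lemma vertex_cover:
  assumes "tour m T"
  shows "{1..n} = set Z \<union> (\<Union>v\<in>set T. {b v, c v, p v, p (flip v), c (flip v), b (flip v)})"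
proof
  have T: "v \<in> set T \<or> flip v \<in> set T" if "v \<in> verts m" for v
  proof -
    have "fst v \<in> fst ` set T" using that assms by (auto simp: tour_def verts_def)
    then obtain u where "u \<in> set T" "fst v = fst u" by auto
    thus ?thesis using fst_eq_flip by metis
  qed
  show "set Z \<union> (\<Union>v\<in>set T. {b v, c v, p v, p (flip v), c (flip v), b (flip v)}) \<subseteq> {1..n}"
  proof -
    have "{b v, c v, p v, p (flip v), c (flip v), b (flip v)} \<subseteq> {1..n}" if "v \<in> set T" for v
    proof -
      have "v \<in> verts m" "flip v \<in> verts m" using that tour_verts[OF assms] by auto
      thus ?thesis using gadget_range by blast
    qed
    moreover have "set Z \<subseteq> {1..n}" by (auto simp: Z_def)
    ultimately show ?thesis by blast
  qed
  show "{1..n} \<subseteq> set Z \<union> (\<Union>v\<in>set T. {b v, c v, p v, p (flip v), c (flip v), b (flip v)})"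
  proof
    fix x assume x: "x \<in> {1..n}"
    have *: "y \<in> set Z \<union> (\<Union>v\<in>set T. {b v, c v, p v, p (flip v), c (flip v), b (flip v)})"
      if "v \<in> verts m" "y \<in> {b v, c v, p v}" for y v
      using T[OF that(1)]
    proof
      assume "v \<in> set T"
      thus ?thesis using that(2) by (intro UnI2 UN_I[of v]) auto
    next
      assume "flip v \<in> set T"
      thus ?thesis using that(2) by (intro UnI2 UN_I[of "flip v"]) auto
    qed
    consider "x - 1 < 2 * m" | "2 * m \<le> x - 1" "x - 1 - 2 * m < 2 * m" | "4 * m \<le> x - 1" "x - 1 - 4 * m < 2 * m" | "6 * m \<le> x - 1"
      by linarith
    thus "x \<in> set Z \<union> (\<Union>v\<in>set T. {b v, c v, p v, p (flip v), c (flip v), b (flip v)})"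
    proof cases
      case 1
      then obtain v where "v \<in> verts m" "code v = x - 1" using code_surj by blast
      thus ?thesis using *[of v x] x by (auto simp: b_def)
    next
      case 2
      then obtain v where "v \<in> verts m" "code v = x - 1 - 2 * m" using code_surj by blast
      thus ?thesis using *[of v x] x 2 by (auto simp: c_def)
    next
      case 3
      then obtain v where "v \<in> verts m" "code v = x - 1 - 4 * m" using code_surj by blast
      thus ?thesis using *[of v x] x 3 by (auto simp: p_def)
    next
      case 4
      thus ?thesis using x by (auto simp: Z_def)
    qed
  qed
qed

lemma walk_of_tour:
  assumes T: "tour m T" "hd T = (0, True)"
  obtains ws where "set ws = {1..n}" "length ws = n" "hd ws = 1"
    "\<And>e. e \<in> consec (ws @ [hd ws]) \<Longrightarrow> allowed e"
    "(\<lambda>e. b ` e) ` tour_edges T \<subseteq> consec (ws @ [hd ws])"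
proof -
  obtain v xs where vx: "T = v # xs" "v = (0, True)" using T tour_length[OF T(1)] m by (cases T) auto
  have lx: "length xs = m - 1" using tour_length[OF T(1)] vx by simp
  have vm: "v \<in> verts m" "flip v \<in> verts m" "set xs \<subseteq> verts m" using tour_verts[OF T(1)] vx by auto
  \<comment> \<open>The segment of \<open>v\<close> is opened between \<open>p v\<close> and
    \<open>p (flip v)\<close> to take in the spare vertices.\<close>
  let ?H = "[b v, c v] @ ([p v] @ Z @ [p (flip v)]) @ [c (flip v)]"
  let ?S = "concat (map seg xs)"
  let ?ws = "?H @ b (flip v) # ?S"
  have hd: "hd ?ws = b v" by simp
  have c1: "consec (?ws @ [b v]) = consec (?H @ [b (flip v)]) \<union> consec (b (flip v) # ?S @ [b v])"
    using consec_append[of ?H "b (flip v)" "?S @ [b v]"] by (simp only: append_assoc append_Cons append_Nil)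
  have c2: "consec (?H @ [b (flip v)]) = {{b v, c v}, {c v, p v}, {p (flip v), c (flip v)}, {c (flip v), b (flip v)}} \<union> consec ([p v] @ Z @ [p (flip v)])"
    using consec_append[of "[b v, c v]" "p v" "Z @ [p (flip v), c (flip v), b (flip v)]"]
      consec_append[of "p v # Z" "p (flip v)" "[c (flip v), b (flip v)]"] by auto
  have C: "consec (?ws @ [hd ?ws]) = {{b v, c v}, {c v, p v}, {p (flip v), c (flip v)}, {c (flip v), b (flip v)}}
     \<union> consec ([p v] @ Z @ [p (flip v)]) \<union> consec (b (flip v) # ?S @ [b v])" unfolding hd c1 c2 ..
  note segs = consec_segs[of v xs v]
  show ?thesis
  proof (rule that[of ?ws])
    have "length ?S = 6 * (m - 1)" unfolding lx[symmetric] by (induction xs) (auto simp: seg_def)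
    thus "length ?ws = n" using Z(2) m n by simp
    have "set ?S = (\<Union>v\<in>set xs. {b v, c v, p v, p (flip v), c (flip v), b (flip v)})" by (auto simp: seg_def)
    thus "set ?ws = {1..n}" unfolding vertex_cover[OF T(1)] vx(1) by auto
    show "hd ?ws = 1" unfolding hd vx(2) by (simp add: b_def code_def)
    show "(\<lambda>e. b ` e) ` tour_edges T \<subseteq> consec (?ws @ [hd ?ws])"
      using segs vm unfolding C vx(1) tour_edges_def by auto
    fix e assume "e \<in> consec (?ws @ [hd ?ws])"
    then consider "e \<in> {{b v, c v}, {c v, p v}, {p (flip v), c (flip v)}, {c (flip v), b (flip v)}}"
      | "e \<in> consec ([p v] @ Z @ [p (flip v)])" | "e \<in> consec (b (flip v) # ?S @ [b v])" unfolding C by blast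
    thus "allowed e"
    proof cases
      case 1
      hence "e = {b v, c v} \<or> e = {c v, p v} \<or> e = {c (flip v), p (flip v)} \<or> e = {b (flip v), c (flip v)}"
        by (auto simp: insert_commute)
      thus ?thesis unfolding allowed_def using vm by blast
    next
      case 2
      thus ?thesis using consec_P[of "[p v] @ Z @ [p (flip v)]"] gadget_mem(4) vm Z(1) by auto
    next
      case 3
      thus ?thesis using segs vm by auto
    qed
  qed
qed

lemma walk_of_base:
  obtains ws where "set ws = {1..n}" "length ws = n" "hd ws = 1"
    "\<And>e. e \<in> consec (ws @ [hd ws]) \<Longrightarrow> allowed e"
    "(\<lambda>e. b ` e) ` base_matching m \<subseteq> consec (ws @ [hd ws])"
proof -
  define v where "v = (0::nat, True)"
  define xs where "xs = map (\<lambda>i. (i, True)) [1..<m]"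
  \<comment> \<open>This tour serves as an enumeration of the base edges.\<close>
  have T: "tour m (v # xs)" using m by (auto simp: tour_def v_def xs_def comp_def image_image)
  have lx: "length xs = m - 1" by (simp add: xs_def)
  have vm: "v \<in> verts m" "flip v \<in> verts m" "set xs \<subseteq> verts m" using tour_verts[OF T] by auto
  \<comment> \<open>To begin at vertex 1, the walk starts in the middle of the segment of
    \<open>v\<close>; the other half, \<open>p v\<close> and \<open>c v\<close>, closes it at the
    end.\<close>
  let ?H = "[b v, b (flip v), c (flip v)] @ ([p (flip v)] @ Z)"
  let ?S = "concat (map seg' xs)"
  let ?ws = "?H @ ?S @ [p v, c v]"
  have hd: "hd ?ws = b v" by simp
  \<comment> \<open>\<open>u\<close> is the vertex from which the other segments are reached: the
    end of \<open>Z\<close>, or \<open>p (flip v)\<close> if there are no spare vertices.\<close>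
  obtain L u where L: "[p (flip v)] @ Z = L @ [u]" by (metis append_is_Nil_conv not_Cons_self2 rev_exhaust)
  have LP: "set (L @ [u]) \<subseteq> P" unfolding L[symmetric] using gadget_mem(4) vm Z(1) by auto
  have C: "consec (?ws @ [hd ?ws]) = {{b v, b (flip v)}, {b (flip v), c (flip v)}, {c (flip v), p (flip v)}, {p v, c v}, {c v, b v}}
     \<union> consec (L @ [u]) \<union> consec (u # ?S @ [p v])"
  proof -
    have "consec (?ws @ [b v]) = consec ([b v, b (flip v), c (flip v)] @ (L @ [u]) @ ?S @ [p v, c v, b v])"
      unfolding L[symmetric] by simp
    also have "\<dots> = consec (([b v, b (flip v), c (flip v)] @ L) @ [u]) \<union> consec (u # ?S @ [p v, c v, b v])"
      using consec_append[of "[b v, b (flip v), c (flip v)] @ L" u "?S @ [p v, c v, b v]"] by simp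
    also have "consec (u # ?S @ [p v, c v, b v]) = consec (u # ?S @ [p v]) \<union> {{p v, c v}, {c v, b v}}"
      using consec_append[of "u # ?S" "p v" "[c v, b v]"] by simp
    also have "([b v, b (flip v), c (flip v)] @ L) @ [u] = [b v, b (flip v), c (flip v)] @ p (flip v) # Z"
      using L by simp
    also have "consec \<dots> = {{b v, b (flip v)}, {b (flip v), c (flip v)}, {c (flip v), p (flip v)}} \<union> consec (L @ [u])"
    proof -
      have LL: "p (flip v) # Z = L @ [u]" using L by simp
      show ?thesis unfolding consec_append[of "[b v, b (flip v), c (flip v)]" "p (flip v)" Z] unfolding LL by auto
    qed
    moreover have "({a1, a2, a3} \<union> X) \<union> (Y \<union> {a4, a5}) = {a1, a2, a3, a4, a5} \<union> X \<union> Y"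
      for a1 a2 a3 a4 a5 :: "nat set" and X Y by auto
    ultimately show ?thesis unfolding hd by (simp only:)
  qed
  show ?thesis
  proof (rule that[of ?ws])
    have "length ?S = 6 * (m - 1)" unfolding lx[symmetric] by (induction xs) (auto simp: seg'_def)
    thus "length ?ws = n" using Z(2) m n by simp
    have "set ?S = (\<Union>v\<in>set xs. {b v, c v, p v, p (flip v), c (flip v), b (flip v)})" by (auto simp: seg'_def)
    thus "set ?ws = {1..n}" unfolding vertex_cover[OF T] by auto
    show "hd ?ws = 1" unfolding hd by (simp add: b_def code_def v_def)
    show "(\<lambda>e. b ` e) ` base_matching m \<subseteq> consec (?ws @ [hd ?ws])"
    proof (rule image_subsetI)
      fix e assume "e \<in> base_matching m"
      then obtain u' where u': "u' \<in> verts m" "e = {u', flip u'}" by (auto simp: base_matching_def)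
      have "fst u' \<in> fst ` set (v # xs)" using u' T by (auto simp: tour_def verts_def)
      then obtain x where x: "x \<in> set (v # xs)" "fst u' = fst x" by (metis imageE)
      hence "u' = x \<or> u' = flip x" using fst_eq_flip by metis
      hence e: "e = {x, flip x}" using u' by (auto simp: insert_commute)
      show "b ` e \<in> consec (?ws @ [hd ?ws])"
      proof (cases "x = v")
        case True
        thus ?thesis unfolding C e by simp
      next
        case False
        then obtain as bs where "xs = as @ x # bs" using x(1) by (auto dest: split_list)
        hence "u # ?S @ [p v] = (u # concat (map seg' as) @ [p x, c x]) @ b x # b (flip x) # [c (flip x), p (flip x)] @ concat (map seg' bs) @ [p v]"
          by (simp add: seg'_def)
        hence "{b x, b (flip x)} \<in> consec (u # ?S @ [p v])" by (simp only: consec_mid)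
        thus ?thesis unfolding C e by simp
      qed
    qed
    fix e assume "e \<in> consec (?ws @ [hd ?ws])"
    then consider "e \<in> {{b v, b (flip v)}, {b (flip v), c (flip v)}, {c (flip v), p (flip v)}, {p v, c v}, {c v, b v}}"
      | "e \<in> consec (L @ [u])" | "e \<in> consec (u # ?S @ [p v])" unfolding C by blast
    thus "allowed e"
    proof cases
      case 1
      hence "e = {b v, b (flip v)} \<or> e = {b v, c v} \<or> e = {c v, p v} \<or> e = {c (flip v), p (flip v)} \<or> e = {b (flip v), c (flip v)}"
        by (auto simp: insert_commute)
      thus ?thesis unfolding allowed_def using vm gadget_mem(1) by blast
    next
      case 2
      thus ?thesis using consec_P[OF LP] by blast
    next
      case 3
      thus ?thesis using consec_segs'[of u xs v] vm LP by auto
    qed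
  qed
qed

end

section \<open>The face of the closed walk polynomial\<close>

definition clow_mon :: "nat \<Rightarrow> nat \<Rightarrow> (nat \<Rightarrow> nat) \<Rightarrow> (nat set + nat) \<Rightarrow>\<^sub>0 nat" where
  "clow_mon d n w = (\<Sum>i\<in>{1..n}. \<Sum>k<d. Poly_Mapping.single (Inl {w (i - 1), w (i mod n)}) 1) +
     (\<Sum>v\<in>w ` {0..<n}. \<Sum>k<d. Poly_Mapping.single (Inr v) 1)"

lemma Clow_eq: "Clow q n = (\<Sum>w\<in>clow_walks n. Poly_Mapping.single (clow_mon (q - 1) n w) 1)"
  unfolding Clow_def pvar_def clow_mon_def
  by (simp add: power_single_one prod_single_one mult_single)

lemma lookup_clow_mon:
  "Poly_Mapping.lookup (clow_mon d n w) (Inl e) = d * card {i \<in> {1..n}. {w (i - 1), w (i mod n)} = e}"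
  "Poly_Mapping.lookup (clow_mon d n w) (Inr v) = (if v \<in> w ` {0..<n} then d else 0)"
proof -
  show "Poly_Mapping.lookup (clow_mon d n w) (Inl e) = d * card {i \<in> {1..n}. {w (i - 1), w (i mod n)} = e}"
    unfolding clow_mon_def lookup_add lookup_sum_power[OF finite_atLeastAtMost]
      lookup_sum_power[OF finite_imageI[OF finite_atLeastLessThan]] by simp
  have "{x \<in> w ` {0..<n}. x = v} = (if v \<in> w ` {0..<n} then {v} else {})" by auto
  thus "Poly_Mapping.lookup (clow_mon d n w) (Inr v) = (if v \<in> w ` {0..<n} then d else 0)"
    unfolding clow_mon_def lookup_add lookup_sum_power[OF finite_atLeastAtMost]
      lookup_sum_power[OF finite_imageI[OF finite_atLeastLessThan]] by simp
qed

lemma finite_clow_walks: "finite (clow_walks n)"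
  unfolding clow_walks_def by (rule finite_subset[of _ "{0..<n} \<rightarrow>\<^sub>E {1..n}"]) (auto intro: finite_PiE)

context clow_gadget
begin

definition forbidden where "forbidden = {e. e \<subseteq> {1..n} \<and> card e = 2 \<and> \<not> allowed e}"
definition clow_vars :: "(nat set + nat) set" where "clow_vars = Inr ` {1..n} \<union> Inl ` forbidden"
definition clow_coeff :: "nat set + nat \<Rightarrow> int" where "clow_coeff = case_sum (\<lambda>_. - 1) (\<lambda>_. 1)"

abbreviation wt where "wt \<equiv> weight clow_vars clow_coeff"

lemma finite_forbidden: "finite forbidden"
  by (rule finite_subset[of _ "Pow {1..n}"]) (auto simp: forbidden_def)

lemma clow_walkD:
  assumes "w \<in> clow_walks n"
  shows "w ` {0..<n} \<subseteq> {1..n}" "i \<in> {1..n} \<Longrightarrow> cyc_edge w i \<subseteq> {1..n} \<and> card (cyc_edge w i) = 2"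
proof -
  show sub: "w ` {0..<n} \<subseteq> {1..n}" using assms by (auto simp: clow_walks_def)
  assume i: "i \<in> {1..n}"
  have "w (i - 1) \<noteq> w (i mod n)" using assms i by (auto simp: clow_walks_def)
  moreover have "i - 1 \<in> {0..<n}" "i mod n \<in> {0..<n}" using i n3 by auto
  hence "w (i - 1) \<in> {1..n}" "w (i mod n) \<in> {1..n}" using sub by blast+
  ultimately show "cyc_edge w i \<subseteq> {1..n} \<and> card (cyc_edge w i) = 2" by (simp add: cyc_edge_def)
qed

lemma weight_clow:
  assumes "w \<in> clow_walks n"
  shows "wt (clow_mon d n w) = int d * int (card (w ` {0..<n})) -
    (\<Sum>e\<in>forbidden. int d * int (card {i \<in> {1..n}. cyc_edge w i = e}))"
proof -
  have "wt (clow_mon d n w) = (\<Sum>v\<in>Inr ` {1..n}. clow_coeff v * int (Poly_Mapping.lookup (clow_mon d n w) v)) +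
      (\<Sum>v\<in>Inl ` forbidden. clow_coeff v * int (Poly_Mapping.lookup (clow_mon d n w) v))"
    unfolding weight_def clow_vars_def using finite_forbidden by (intro sum.union_disjoint) auto
  also have "(\<Sum>v\<in>Inl ` forbidden. clow_coeff v * int (Poly_Mapping.lookup (clow_mon d n w) v)) =
      (\<Sum>e\<in>forbidden. - (int d * int (card {i \<in> {1..n}. cyc_edge w i = e})))"
    by (subst sum.reindex) (simp_all add: clow_coeff_def lookup_clow_mon cyc_edge_def)
  also have "(\<Sum>v\<in>Inr ` {1..n}. clow_coeff v * int (Poly_Mapping.lookup (clow_mon d n w) v)) =
      (\<Sum>v\<in>{1..n}. if v \<in> w ` {0..<n} then int d else 0)"
    by (subst sum.reindex) (auto simp: clow_coeff_def lookup_clow_mon intro!: sum.cong)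
  also have "\<dots> = int d * int (card ({1..n} \<inter> w ` {0..<n}))"
    by (simp add: sum.If_cases)
  also have "{1..n} \<inter> w ` {0..<n} = w ` {0..<n}" using clow_walkD(1)[OF assms] by blast
  finally show ?thesis by (simp add: sum_negf)
qed

lemma weight_clow_le:
  assumes "w \<in> clow_walks n"
  shows "wt (clow_mon d n w) \<le> int d * int n"
proof -
  have "card (w ` {0..<n}) \<le> n" using card_image_le[of "{0..<n}" w] by simp
  hence "int d * int (card (w ` {0..<n})) \<le> int d * int n" by (intro mult_left_mono) auto
  moreover have "0 \<le> (\<Sum>e\<in>forbidden. int d * int (card {i \<in> {1..n}. cyc_edge w i = e}))" by (intro sum_nonneg) auto
  ultimately show ?thesis unfolding weight_clow[OF assms] by linarith
qed

lemma inj_image_b: "inj (\<lambda>e. b ` e)"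
  using gadget_inj(1) by (intro injI) (simp add: inj_image_eq_iff inj_def)

text \<open>Maximal weight leaves no slack: \<open>n\<close> steps visit \<open>n\<close> vertices
  and use no forbidden edge, so the walk is a Hamiltonian cycle of allowed edges.\<close>

lemma weight_clow_eq:
  assumes w: "w \<in> clow_walks n" and d: "d \<ge> 1" and eq: "wt (clow_mon d n w) = int d * int n"
  shows "matching_shape m d (\<lambda>e. Inl (b ` e)) (clow_mon d n w) {e \<in> vpairs m. b ` e \<in> cyc_edge w ` {1..n}}"
proof -
  let ?s = "\<Sum>e\<in>forbidden. int d * int (card {i \<in> {1..n}. cyc_edge w i = e})"
  have cn: "card (w ` {0..<n}) \<le> n" using card_image_le[of "{0..<n}" w] by simp
  hence "int d * int (card (w ` {0..<n})) \<le> int d * int n" by (intro mult_left_mono) auto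
  moreover have s0: "0 \<le> ?s" by (intro sum_nonneg) auto
  ultimately have "int d * int (card (w ` {0..<n})) = int d * int n" and s: "?s = 0"
    using eq unfolding weight_clow[OF w] by linarith+
  hence card: "card (w ` {0..<n}) = n" using d by simp
  hence im: "w ` {0..<n} = {1..n}" using clow_walkD(1)[OF w] by (intro card_subset_eq) auto
  have inj: "inj_on w {0..<n}" using card by (intro eq_card_imp_inj_on) auto
  have al: "allowed e" if eC: "e \<in> cyc_edge w ` {1..n}" for e
  proof (rule ccontr)
    assume na: "\<not> allowed e"
    obtain i where i: "i \<in> {1..n}" "e = cyc_edge w i" using eC by blast
    hence f: "e \<in> forbidden" using na clow_walkD(2)[OF w i(1)] by (simp add: forbidden_def)
    have "int d * int (card {i \<in> {1..n}. cyc_edge w i = e}) = 0"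
      using s f finite_forbidden by (subst (asm) sum_nonneg_eq_0_iff) auto
    hence "{i \<in> {1..n}. cyc_edge w i = e} = {}" using d by simp
    thus False using i by blast
  qed
  note H = hamiltonian_walk[OF inj im]
  have "perfect_matching m {e \<in> vpairs m. b ` e \<in> cyc_edge w ` {1..n}}"
    by (rule hamiltonian_allowed_matching[OF H(3) al H(2)])
  moreover have "Poly_Mapping.lookup (clow_mon d n w) (Inl e) = (if e \<in> cyc_edge w ` {1..n} then d else 0)" for e
  proof -
    have "card {i \<in> {1..n}. cyc_edge w i = e} = (if e \<in> cyc_edge w ` {1..n} then 1 else 0)"
    proof (cases "e \<in> cyc_edge w ` {1..n}")
      case True
      then obtain i where "i \<in> {1..n}" "e = cyc_edge w i" by blast
      hence "{j \<in> {1..n}. cyc_edge w j = e} = {i}" using H(1) by (auto dest: inj_onD)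
      thus ?thesis using True by simp
    next
      case False
      hence "{i \<in> {1..n}. cyc_edge w i = e} = {}" by blast
      thus ?thesis using False by (simp only: card.empty if_False)
    qed
    thus ?thesis by (simp add: lookup_clow_mon cyc_edge_def)
  qed
  ultimately show ?thesis unfolding matching_shape_def by simp
qed

text \<open>The walk has maximal weight and thus carries some perfect matching; since that contains
  \<open>N\<close>, it equals \<open>N\<close>.\<close>

lemma realize_clow:
  assumes ws: "set ws = {1..n}" "length ws = n" "hd ws = 1"
    "\<And>e. e \<in> consec (ws @ [hd ws]) \<Longrightarrow> allowed e"
    and N: "perfect_matching m N" "(\<lambda>e. b ` e) ` N \<subseteq> consec (ws @ [hd ws])" and d: "d \<ge> 1"
  shows "\<exists>w\<in>clow_walks n. wt (clow_mon d n w) = int d * int n \<and> matching_shape m d (\<lambda>e. Inl (b ` e)) (clow_mon d n w) N"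
proof -
  let ?w = "restrict (\<lambda>i. ws ! i) {0..<n}"
  note w = list_walk[OF ws(1,2,3)]
  have "(\<Sum>e\<in>forbidden. int d * int (card {i \<in> {1..n}. cyc_edge ?w i = e})) = 0"
  proof (rule sum.neutral, rule ballI)
    fix e assume "e \<in> forbidden"
    hence "e \<notin> cyc_edge ?w ` {1..n}" using ws(4) w(4) by (auto simp: forbidden_def)
    hence "{i \<in> {1..n}. cyc_edge ?w i = e} = {}" by blast
    thus "int d * int (card {i \<in> {1..n}. cyc_edge ?w i = e}) = 0" by (simp only: card.empty of_nat_0 mult_zero_right)
  qed
  hence wt: "wt (clow_mon d n ?w) = int d * int n"
    unfolding weight_clow[OF w(1)] using card_image[OF w(2)] by simp
  let ?N = "{e \<in> vpairs m. b ` e \<in> cyc_edge ?w ` {1..n}}"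
  have shape: "matching_shape m d (\<lambda>e. Inl (b ` e)) (clow_mon d n ?w) ?N"
    by (rule weight_clow_eq[OF w(1) d wt])
  have "N \<subseteq> ?N" using N w(4) by (auto simp: perfect_matching_def)
  hence "?N = N" using perfect_matching_subset_eq[OF _ N(1)] shape by (simp add: matching_shape_def)
  thus ?thesis using w(1) wt shape by auto
qed

lemma Clow_bound:
  assumes proj: "mono_proj V (Clow q n :: (_, 'a::{comm_semiring_1, ordered_comm_semiring, linorder}) fpoly) (Perm t :: (_, 'a) fpoly)"
    and q: "q \<ge> 2" and ev: "even m"
  shows "2 ^ (m div 2) \<le> t * (2 * m) * q"
proof -
  define d where "d = q - 1"
  have d: "d \<ge> 1" and q_eq: "q = d + 1" using q by (auto simp: d_def)
  have real: "\<exists>w\<in>clow_walks n. wt (clow_mon d n w) = int d * int n \<and> matching_shape m d (\<lambda>e. Inl (b ` e)) (clow_mon d n w) N"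
    if N: "N \<in> insert (base_matching m) (target_matchings m)" for N
  proof (cases "N = base_matching m")
    case True
    show ?thesis
    proof (rule walk_of_base)
      fix ws assume "set ws = {1..n}" "length ws = n" "hd ws = 1" "\<And>e. e \<in> consec (ws @ [hd ws]) \<Longrightarrow> allowed e"
        "(\<lambda>e. b ` e) ` base_matching m \<subseteq> consec (ws @ [hd ws])"
      from realize_clow[OF this(1-4) perfect_matching_base this(5) d] show ?thesis unfolding True .
    qed
  next
    case False
    then obtain T where T: "tour m T" "hd T = (0, True)" "N = tour_edges T" using N by (auto simp: target_matchings_def)
    show ?thesis
    proof (rule walk_of_tour[OF T(1,2)])
      fix ws assume "set ws = {1..n}" "length ws = n" "hd ws = 1" "\<And>e. e \<in> consec (ws @ [hd ws]) \<Longrightarrow> allowed e"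
        "(\<lambda>e. b ` e) ` tour_edges T \<subseteq> consec (ws @ [hd ws])"
      from realize_clow[OF this(1-4) perfect_matching_tour[OF T(1) m] this(5) d] show ?thesis unfolding T(3) .
    qed
  qed
  \<comment> \<open>\<open>mono_proj_support\<close> asks for a nonconstant monomial.\<close>
  obtain w0 where w0: "w0 \<in> clow_walks n" using real by blast
  have "w0 0 \<in> w0 ` {0..<n}" using n3 by auto
  hence "Poly_Mapping.lookup (clow_mon d n w0) (Inr (w0 0)) = d" by (simp add: lookup_clow_mon)
  hence nz: "clow_mon d n w0 \<noteq> 0" using d by auto
  obtain L where L: "perm_sums t L = clow_mon d n ` clow_walks n"
    "\<And>i j \<mu>. \<mu> \<in> L i j \<Longrightarrow> \<mu> = 0 \<or> (\<exists>v. \<mu> = Poly_Mapping.single v 1)"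
    by (rule mono_proj_support[OF finite_clow_walks w0 nz proj[unfolded Clow_eq, folded d_def]]) blast
  have "matching_face t m d L (\<lambda>e. Inl (b ` e)) clow_vars clow_coeff (int d * int n)"
  proof
    show "inj_on (\<lambda>e. Inl (b ` e)) (vpairs m)" using inj_image_b by (auto simp: inj_def inj_on_def)
    show "wt f \<le> int d * int n" if "f \<in> perm_sums t L" for f
      using that weight_clow_le unfolding L(1) by blast
    show "\<exists>N. matching_shape m d (\<lambda>e. Inl (b ` e)) f N" if "f \<in> perm_sums t L" "wt f = int d * int n" for f
      using that weight_clow_eq[OF _ d] unfolding L(1) by blast
    show "\<exists>f\<in>perm_sums t L. wt f = int d * int n \<and> matching_shape m d (\<lambda>e. Inl (b ` e)) f N"
      if "N \<in> insert (base_matching m) (target_matchings m)" for N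
      using real[OF that] unfolding L(1) by blast
  qed (use L(2) m ev d in auto)
  from matching_face.size_bound[OF this] show ?thesis using q_eq by simp
qed

end

section \<open>Growth\<close>

lemma exp_beats_linear:
  fixes q :: real assumes "q > 0"
  shows "\<forall>\<^sub>F s in at_top. 2 powr (s / 2) * (4 * s * q) \<le> 2 powr (s - 1)"
  using assms by real_asymp

lemma exp_beats_polynomial:
  fixes c C :: real and k :: nat assumes "c > 0"
  shows "\<forall>\<^sub>F n in sequentially. C * (real n + 1) ^ k < 2 powr (c * sqrt (real n))"
  using assms by real_asymp

text \<open>For \<open>m = 2 * p\<close> the bound reads \<open>2 ^ p \<le> t * (4 * p) * q\<close>.
  Half of the exponent is given up to absorb the factor \<open>4 * s * q\<close>.\<close>

lemma size_lower_bound: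
  fixes s q :: real and t p :: nat
  assumes key: "2 powr (s / 2) * (4 * s * q) \<le> 2 powr (s - 1)"
    and p: "real p \<le> s" "s - 1 \<le> real p" "p \<ge> 1" and q: "q > 0" and le: "2 ^ p \<le> real t * (4 * real p) * q"
  shows "2 powr (s / 2) \<le> real t"
proof -
  have "2 powr (s / 2) * (4 * s * q) \<le> 2 powr (s - 1)" using key by simp
  also have "\<dots> \<le> 2 powr real p" using p by simp
  also have "\<dots> = 2 ^ p" by (simp add: powr_realpow)
  also have "\<dots> \<le> real t * (4 * real p) * q" by (rule le)
  also have "\<dots> \<le> real t * (4 * s * q)" using p q by (simp add: mult_left_mono mult_right_mono)
  finally show ?thesis using p q by (simp add: mult_le_cancel_right)
qed

text \<open>With \<open>m = 2 * p\<close> there are at most \<open>8 * p ^ 2\<close> pairs of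
  vertices, so \<open>p\<close> is the integer part of \<open>sqrt (n / 8)\<close>.\<close>

lemma Sat_growth:
  fixes q :: nat
  assumes q: "q \<ge> 2" and t: "mono_proj_blowup Sat_vars (Sat q :: nat \<Rightarrow> (_, 'a::{comm_semiring_1, ordered_comm_semiring, linorder}) fpoly) Perm t"
  shows "\<forall>\<^sub>F n in sequentially. 2 powr (1 / (2 * sqrt 8) * sqrt (real n)) \<le> real (t n)"
proof -
  have lim: "filterlim (\<lambda>n. sqrt (real n / 8)) at_top sequentially" by real_asymp
  have key: "\<forall>\<^sub>F n in sequentially. 2 powr (sqrt (real n / 8) / 2) * (4 * sqrt (real n / 8) * real q) \<le> 2 powr (sqrt (real n / 8) - 1)"
    using eventually_compose_filterlim[OF exp_beats_linear[of "real q"] lim] q by simp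
  have "\<forall>\<^sub>F n in sequentially. mono_proj (Sat_vars n) (Sat q n :: (_, 'a) fpoly) (Perm (t n) :: (_, 'a) fpoly)"
    using t unfolding mono_proj_blowup_def .
  with key eventually_ge_at_top[of 8] show ?thesis
  proof eventually_elim
    case (elim n)
    define s where "s = sqrt (real n / 8)"
    define p where "p = nat \<lfloor>s\<rfloor>"
    have s1: "s \<ge> 1" using elim(2) by (simp add: s_def)
    have p: "real p \<le> s" "s - 1 \<le> real p" "p \<ge> 1" using s1 unfolding p_def by linarith+
    have "real p ^ 2 \<le> s ^ 2" using p(1) by (intro power_mono) auto
    hence "real (8 * p ^ 2) \<le> real n" by (simp add: s_def)
    hence n: "8 * p ^ 2 \<le> n" by (simp only: of_nat_le_iff)
    have "(2 * (2 * p)) choose 2 = 2 * p * (4 * p - 1)" by (simp add: choose_two)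
    also have "\<dots> \<le> 8 * p ^ 2" by (simp add: power2_eq_square diff_mult_distrib2)
    finally have "2 ^ (2 * p div 2) \<le> t n * (2 * (2 * p)) * q"
      using n elim(2) p(3) q by (intro Sat_bound[OF elim(3)]) auto
    hence "2 ^ p \<le> t n * (4 * p) * q" by simp
    hence "real (2 ^ p) \<le> real (t n * (4 * p) * q)" by (simp only: of_nat_le_iff)
    hence "2 powr (s / 2) \<le> real (t n)"
      using size_lower_bound[of s "real q" p "t n"] elim(1) p q by (simp add: s_def)
    thus ?case by (simp add: s_def real_sqrt_divide mult.commute)
  qed
qed

text \<open>With \<open>m = 2 * p\<close> the gadget needs \<open>12 * p\<close> vertices; half of
  the exponent \<open>n / 12\<close> remains.\<close>

lemma Clow_growth:
  fixes q :: nat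
  assumes q: "q \<ge> 2" and t: "mono_proj_blowup Clow_vars (Clow q :: nat \<Rightarrow> (_, 'a::{comm_semiring_1, ordered_comm_semiring, linorder}) fpoly) Perm t"
  shows "\<forall>\<^sub>F n in sequentially. 2 powr (1 / 24 * real n) \<le> real (t n)"
proof -
  have lim: "filterlim (\<lambda>n. real n / 12) at_top sequentially" by real_asymp
  have key: "\<forall>\<^sub>F n in sequentially. 2 powr (real n / 12 / 2) * (4 * (real n / 12) * real q) \<le> 2 powr (real n / 12 - 1)"
    using eventually_compose_filterlim[OF exp_beats_linear[of "real q"] lim] q by simp
  have "\<forall>\<^sub>F n in sequentially. mono_proj (Clow_vars n) (Clow q n :: (_, 'a) fpoly) (Perm (t n) :: (_, 'a) fpoly)"
    using t unfolding mono_proj_blowup_def .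
  with key eventually_ge_at_top[of 12] show ?thesis
  proof eventually_elim
    case (elim n)
    define p where "p = n div 12"
    have p1: "p \<ge> 1" "12 * p \<le> n" "n < 12 * p + 12" using elim(2) unfolding p_def by (presburger+)
    have "clow_gadget (2 * p) n" using p1 by unfold_locales auto
    from clow_gadget.Clow_bound[OF this elim(3) q] have "2 ^ p \<le> t n * (4 * p) * q" by simp
    hence "real (2 ^ p) \<le> real (t n * (4 * p) * q)" by (simp only: of_nat_le_iff)
    hence "2 powr (real n / 12 / 2) \<le> real (t n)"
      using p1 q by (intro size_lower_bound[OF elim(1), of p]) auto
    thus ?case by simp
  qed
qed

lemma not_poly_bounded:
  assumes "c > 0" and t: "\<forall>\<^sub>F n in sequentially. 2 powr (c * sqrt (real n)) \<le> real (t n)"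
  shows "\<not> poly_bounded t"
proof
  assume "poly_bounded t"
  then obtain C k where Ck: "\<And>n. t n \<le> C * (n + 1) ^ k" unfolding poly_bounded_def by blast
  have "\<forall>\<^sub>F n in sequentially. False"
    using exp_beats_polynomial[OF assms(1), of "real C" k] t
  proof eventually_elim
    case (elim n)
    have "real (t n) \<le> real (C * (n + 1) ^ k)" using Ck by (simp only: of_nat_le_iff)
    also have "\<dots> = real C * (real n + 1) ^ k" by (simp add: add.commute)
    finally show ?case using elim by linarith
  qed
  thus False by simp
qed

theorem theorem2:
  fixes q :: nat
  assumes "q \<ge> 2"
  shows "\<not> mono_p_proj Sat_vars (Sat q :: nat \<Rightarrow> (_, 'a::{comm_semiring_1, ordered_comm_semiring, linorder}) fpoly) Perm
       \<and> \<not> mono_p_proj Clow_vars (Clow q :: nat \<Rightarrow> (_, 'a) fpoly) Perm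
       \<and> (\<exists>c>0. \<forall>t. mono_proj_blowup Sat_vars (Sat q :: nat \<Rightarrow> (_, 'a) fpoly) Perm t \<longrightarrow>
              (\<forall>\<^sub>F n in sequentially. real (t n) \<ge> 2 powr (c * sqrt (real n))))
       \<and> (\<exists>c>0. \<forall>t. mono_proj_blowup Clow_vars (Clow q :: nat \<Rightarrow> (_, 'a) fpoly) Perm t \<longrightarrow>
              (\<forall>\<^sub>F n in sequentially. real (t n) \<ge> 2 powr (c * real n)))"
proof (intro conjI)
  show "\<exists>c>0. \<forall>t. mono_proj_blowup Sat_vars (Sat q :: nat \<Rightarrow> (_, 'a) fpoly) Perm t \<longrightarrow>
      (\<forall>\<^sub>F n in sequentially. real (t n) \<ge> 2 powr (c * sqrt (real n)))"
    by (rule exI[of _ "1 / (2 * sqrt 8)"]) (use Sat_growth[OF assms] in auto)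
  show "\<exists>c>0. \<forall>t. mono_proj_blowup Clow_vars (Clow q :: nat \<Rightarrow> (_, 'a) fpoly) Perm t \<longrightarrow>
      (\<forall>\<^sub>F n in sequentially. real (t n) \<ge> 2 powr (c * real n))"
    by (rule exI[of _ "1 / 24"]) (use Clow_growth[OF assms] in auto)
  show "\<not> mono_p_proj Sat_vars (Sat q :: nat \<Rightarrow> (_, 'a) fpoly) Perm"
  proof
    assume "mono_p_proj Sat_vars (Sat q :: nat \<Rightarrow> (_, 'a) fpoly) Perm"
    then obtain t where t: "poly_bounded t" "mono_proj_blowup Sat_vars (Sat q :: nat \<Rightarrow> (_, 'a) fpoly) Perm t"
      unfolding mono_p_proj_def by blast
    thus False using not_poly_bounded[OF _ Sat_growth[OF assms t(2)]] by simp
  qed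
  show "\<not> mono_p_proj Clow_vars (Clow q :: nat \<Rightarrow> (_, 'a) fpoly) Perm"
  proof
    assume "mono_p_proj Clow_vars (Clow q :: nat \<Rightarrow> (_, 'a) fpoly) Perm"
    then obtain t where t: "poly_bounded t" "mono_proj_blowup Clow_vars (Clow q :: nat \<Rightarrow> (_, 'a) fpoly) Perm t"
      unfolding mono_p_proj_def by blast
    \<comment> \<open>Weakened to a square root so that \<open>not_poly_bounded\<close> serves both
      families.\<close>
    have "\<forall>\<^sub>F n in sequentially. 2 powr (1 / 24 * sqrt (real n)) \<le> real (t n)"
      using Clow_growth[OF assms t(2)]
    proof eventually_elim
      case (elim n)
      have "sqrt (real n) \<le> real n" by (cases n) (auto intro!: real_le_lsqrt simp: power2_eq_square)
      hence "2 powr (1 / 24 * sqrt (real n)) \<le> (2::real) powr (1 / 24 * real n)" by simp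
      thus ?case using elim by linarith
    qed
    thus False using t(1) not_poly_bounded[of "1 / 24" t] by simp
  qed
qed

end
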